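(* Let $(P_0,\dots,P_m)$ be a Clifford system on $\mathbb{R}^{2l}$, $m_1=m$, $m_2=l-m-1$. Suppose $9\le 3m_1<m_2+9$, and in the case $m_1=4$ suppose additionally that $P_0P_1P_2P_3P_4\ne\pm\mathrm{Id}$. Let $$N_+:=\{x\in M_+\mid\text{there exist orthonormal }Q_0,\dots,Q_3\in\Sigma\text{ with }Q_0Q_1Q_2Q_3x=x\}.$$ Then $\emptyset\ne N_+\ne M_+$. Thus the focal manifold $M_+$ and the whole isoparametric family are not homogeneously embedded.
   Context: A (symmetric) Clifford system on $\mathbb{R}^{2l}$ is an $(m+1)$-tuple $(P_0,\dots,P_m)$ of symmetric endomorphisms of $\mathbb{R}^{2l}$ with $P_iP_j+P_jP_i=2\delta_{ij}\,\mathrm{Id}$ for all $i,j$. On symmetric endomorphisms use $\langle A,B\rangle:=\frac{1}{2l}\operatorname{Trace}(AB)$; the Clifford sphere $\Sigma$ is the unit sphere of $\operatorname{Span}\{P_0,\dots,P_m\}$. Let $f(x)=1-2\sum_{i=0}^m\langle P_ix,x\rangle^2$ for $x\in S^{2l-1}$. When $m_2>0$, the level sets $f^{-1}(c)$, $-1<c<1$, form an isoparametric family (a parallel family of hypersurfaces with constant principal curvatures) with four distinct principal curvatures of multiplicities $m_1,m_2,m_1,m_2$, with focal manifolds $M_\pm=f^{-1}(\pm1)$; $M_+=\{x\in S^{2l-1}\mid\langle P_ix,x\rangle=0,\ i=0,\dots,m\}$. A submanifold $M\subset S^{2l-1}$ is homogeneously embedded if the group $\{A\in O(2l)\mid A(M)=M\}$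 acts transitively on $M$; the family is homogeneously embedded if its hypersurfaces are (if one hypersurface of the family is, then all are). *)

theory Defs
  imports "HOL-Analysis.Analysis"
begin

text \<open>Symmetric endomorphisms of a Euclidean space \<open>\<real>\<^sup>2\<^sup>l\<close> are represented by their matrices
  with respect to the standard basis; \<open>CARD('n) = 2 * l\<close> is imposed where it is needed.
  A Clifford system is indexed by \<open>0, \<dots>, m\<close>; the values \<open>P i\<close> with \<open>i > m\<close> are irrelevant.\<close>

definition clifford_system :: "nat \<Rightarrow> (nat \<Rightarrow> real ^ 'n ^ 'n) \<Rightarrow> bool" where
  "clifford_system m P \<longleftrightarrow>
     (\<forall>i\<le>m. transpose (P i) = P i) \<and>
     (\<forall>i\<le>m. \<forall>j\<le>m. P i ** P j + P j ** P i = (if i = j then 2 else 0) *\<^sub>R mat 1)"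

definition trace_inner :: "real ^ 'n ^ 'n \<Rightarrow> real ^ 'n ^ 'n \<Rightarrow> real" where
  "trace_inner A B = trace (A ** B) / real CARD('n)"

definition clifford_sphere :: "nat \<Rightarrow> (nat \<Rightarrow> real ^ 'n ^ 'n) \<Rightarrow> (real ^ 'n ^ 'n) set" where
  "clifford_sphere m P = {Q \<in> span (P ` {0..m}). trace_inner Q Q = 1}"

definition isoparametric_fun :: "nat \<Rightarrow> (nat \<Rightarrow> real ^ 'n ^ 'n) \<Rightarrow> real ^ 'n \<Rightarrow> real" where
  "isoparametric_fun m P x = 1 - 2 * (\<Sum>i=0..m. ((P i *v x) \<bullet> x)\<^sup>2)"

definition level_set :: "nat \<Rightarrow> (nat \<Rightarrow> real ^ 'n ^ 'n) \<Rightarrow> real \<Rightarrow> (real ^ 'n) set" where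
  "level_set m P c = {x \<in> sphere 0 1. isoparametric_fun m P x = c}"

definition M_plus :: "nat \<Rightarrow> (nat \<Rightarrow> real ^ 'n ^ 'n) \<Rightarrow> (real ^ 'n) set" where
  "M_plus m P = level_set m P 1"

lemma M_plus_eq: "M_plus m P = {x \<in> sphere 0 1. \<forall>i\<le>m. (P i *v x) \<bullet> x = 0}"
  by (auto simp: M_plus_def level_set_def isoparametric_fun_def sum_nonneg_eq_0_iff)

definition N_plus :: "nat \<Rightarrow> (nat \<Rightarrow> real ^ 'n ^ 'n) \<Rightarrow> (real ^ 'n) set" where
  "N_plus m P = {x \<in> M_plus m P.
     \<exists>Q :: nat \<Rightarrow> real ^ 'n ^ 'n.
       (\<forall>i<4. Q i \<in> clifford_sphere m P) \<and>
       (\<forall>i<4. \<forall>j<4. i \<noteq> j \<longrightarrow> trace_inner (Q i) (Q j) = 0) \<and>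
       (Q 0 ** Q 1 ** Q 2 ** Q 3) *v x = x}"

definition homogeneously_embedded :: "(real ^ 'n) set \<Rightarrow> bool" where
  "homogeneously_embedded M \<longleftrightarrow>
     (\<forall>x\<in>M. \<forall>y\<in>M. \<exists>A :: real ^ 'n ^ 'n.
        orthogonal_matrix A \<and> (*v) A ` M = M \<and> A *v x = y)"

end

theory Submission
  imports Defs
begin

text \<open>Write \<open>W\<close> for the span of the \<open>P i\<close> and \<open>h x = (\<Sum>i. \<langle>P\<^sub>i x, x\<rangle>\<^sup>2)\<close>, so \<open>M\<^sub>+\<close> is the zero set of \<open>h\<close> on the sphere.

  \<open>N\<^sub>+ \<noteq> {}\<close>: \<open>P\<^sub>0P\<^sub>1P\<^sub>2P\<^sub>3\<close> is an involution with an \<open>l\<close>-dimensional \<open>+1\<close>-eigenspace, on which \<open>P\<^sub>4, \<dots>, P\<^sub>m\<close> act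
  as a Clifford system with a nonempty focal manifold.

  \<open>N\<^sub>+ \<noteq> M\<^sub>+\<close>: split \<open>x \<in> M\<^sub>+\<close> as \<open>p + q\<close> along the eigenspaces of some \<open>P\<^sub>k\<close>. If \<open>x\<close> is fixed by a product
  \<open>Q\<^sub>0Q\<^sub>1Q\<^sub>2Q\<^sub>3\<close> whose 4-plane is not orthogonal to \<open>P\<^sub>k\<close>, rotate the frame so that \<open>Q\<^sub>1, Q\<^sub>2, Q\<^sub>3\<close> are orthogonal to
  \<open>P\<^sub>k\<close>; then \<open>q\<close> is a multiple of the projection of \<open>Q\<^sub>1Q\<^sub>2Q\<^sub>3 p\<close> orthogonally to the \<open>P\<^sub>i p\<close>. For fixed \<open>p\<close> such \<open>q\<close>
  depend on \<open>3(m - 3) + 1\<close> parameters, fewer than the \<open>l - m\<close> dimensions in which \<open>q\<close> may vary, so they form a null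
  set. Running through all \<open>k\<close>, finitely many closed subsets of \<open>M\<^sub>+\<close> with dense complement cover \<open>N\<^sub>+\<close>.

  Inhomogeneity: a level set determines the function \<open>|t - t\<^sub>c|\<close>, where \<open>h = cos\<^sup>2 (2 t)\<close>, as the spherical distance to it,
  so an isometry preserving it preserves \<open>h\<close>, or exchanges \<open>h\<close> with \<open>|x|\<^sup>4 - h\<close>. The Laplacian excludes the latter, as it
  would force \<open>l = 2m + 1\<close> whereas \<open>4\<close> divides \<open>l\<close>. An isometry preserving \<open>h\<close> conjugates \<open>W\<close> into itself and
  therefore preserves \<open>N\<^sub>+\<close>.\<close>

subsection \<open>Matrices, subspaces and involutions\<close>

lemma bounded_bilinear_matrix_vector_mult:
  "bounded_bilinear (\<lambda>(A::real^'n^'m) x. A *v x)"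
proof -
  have "bilinear (\<lambda>(A::real^'n^'m) x. A *v x)"
    unfolding bilinear_def
    by (auto intro!: linearI simp: matrix_vector_mult_add_rdistrib scaleR_matrix_vector_assoc
        matrix_vector_right_distrib matrix_vector_mult_scaleR)
  then show ?thesis
    by (simp add: bilinear_conv_bounded_bilinear)
qed

lemmas mv_simps = bounded_bilinear.add_left[OF bounded_bilinear_matrix_vector_mult]
  bounded_bilinear.add_right[OF bounded_bilinear_matrix_vector_mult]
  bounded_bilinear.diff_left[OF bounded_bilinear_matrix_vector_mult]
  bounded_bilinear.diff_right[OF bounded_bilinear_matrix_vector_mult]
  bounded_bilinear.minus_left[OF bounded_bilinear_matrix_vector_mult]
  bounded_bilinear.minus_right[OF bounded_bilinear_matrix_vector_mult]
  bounded_bilinear.scaleR_left[OF bounded_bilinear_matrix_vector_mult]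
  bounded_bilinear.scaleR_right[OF bounded_bilinear_matrix_vector_mult]

lemmas mv_sum = bounded_bilinear.sum_left[OF bounded_bilinear_matrix_vector_mult]
  bounded_bilinear.sum_right[OF bounded_bilinear_matrix_vector_mult]

lemma bilinear_matrix_mult: "bilinear (\<lambda>(A::real^'n^'n) (B::real^'n^'n). A ** B)"
  unfolding bilinear_def
  by (auto intro!: linearI simp: matrix_matrix_mult_def vec_eq_iff algebra_simps sum.distrib sum_distrib_left)

lemma trace_scaleR: "trace (c *\<^sub>R (A::real^'n^'n)) = c * trace A"
  by (simp add: trace_def sum_distrib_left)

lemma bilinear_trace_inner: "bilinear (trace_inner :: real^'n^'n \<Rightarrow> _)"
  unfolding bilinear_def trace_inner_def
  by (auto intro!: linearI simp: bilinear_ladd[OF bilinear_matrix_mult] bilinear_radd[OF bilinear_matrix_mult]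
      bilinear_lmul[OF bilinear_matrix_mult] bilinear_rmul[OF bilinear_matrix_mult] trace_add trace_scaleR add_divide_distrib)

lemma trace_inner_commute: "trace_inner A B = trace_inner B A"
  unfolding trace_inner_def by (subst trace_mul_sym) (rule refl)

lemmas ti_simps = bilinear_ladd[OF bilinear_trace_inner] bilinear_radd[OF bilinear_trace_inner]
  bilinear_lsub[OF bilinear_trace_inner] bilinear_rsub[OF bilinear_trace_inner]
  bilinear_lneg[OF bilinear_trace_inner] bilinear_rneg[OF bilinear_trace_inner]
  bilinear_lmul[OF bilinear_trace_inner] bilinear_rmul[OF bilinear_trace_inner]
  bilinear_lzero[OF bilinear_trace_inner] bilinear_rzero[OF bilinear_trace_inner]

lemma trace_inner_sum_left: "trace_inner (sum f S) B = (\<Sum>i\<in>S. trace_inner (f i) B)"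
  using linear_sum[of "\<lambda>A. trace_inner A B"] bilinear_trace_inner by (auto simp: bilinear_def)

lemma trace_inner_sum_right: "trace_inner B (sum f S) = (\<Sum>i\<in>S. trace_inner B (f i))"
  by (simp add: trace_inner_commute[of B] trace_inner_sum_left)

text \<open>Against a symmetric matrix the trace form is the entrywise inner product up to scale.
  Definiteness and Cauchy-Schwarz on \<open>W\<close> are therefore inherited from the Euclidean
  space of matrices.\<close>

lemma trace_inner_eq_inner:
  fixes A B :: "real^'n^'n"
  assumes "transpose B = B"
  shows "trace_inner A B = (A \<bullet> B) / real CARD('n)"
proof -
  have "B $ i $ j = B $ j $ i" for i j
    using assms by (metis transpose_def vec_lambda_beta)
  then show ?thesis
    by (simp add: trace_inner_def trace_def matrix_matrix_mult_def inner_vec_def)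
qed

lemma matrix_vector_inner_transpose: "((A::real^'n^'m) *v x) \<bullet> y = x \<bullet> (transpose A *v y)"
  by (metis adjoint_matrix adjoint_works matrix_vector_mul_linear inner_commute)

text \<open>Each vector of \<open>V\<close> imposes at most one linear condition on
  \<open>U\<close>. \<open>V\<close> may be dependent and may lie outside \<open>U\<close>, which
  suits families such as the \<open>P i *v x\<close>.\<close>

lemma dim_orthogonal_ge:
  fixes U :: "'a::euclidean_space set"
  assumes "subspace U" "finite V"
  shows "dim U \<le> dim {y \<in> U. \<forall>x\<in>V. x \<bullet> y = 0} + card V"
proof -
  define K where "K = {y \<in> U. \<forall>x\<in>V. x \<bullet> y = 0}"
  have sK: "subspace K"
    using assms(1) by (auto simp: K_def subspace_def inner_add_right)
  have KU: "K \<subseteq> U" by (auto simp: K_def)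
  define L where "L = {y \<in> U. \<forall>x \<in> K. orthogonal x y}"
  have dL: "dim L + dim K = dim U"
    unfolding L_def by (rule dim_subspace_orthogonal_to_vectors[OF sK assms(1) KU])
  have sL: "subspace L"
    using assms(1) by (auto simp: L_def subspace_def orthogonal_def inner_add_right)
  have "dim L \<le> card V"
  proof -
    text \<open>\<open>L\<close> meets \<open>V\<^sup>\<bottom>\<close> trivially, so orthogonal projection to \<open>span V\<close> is injective on it.\<close>
    have "\<exists>f. linear f \<and> inj_on f L \<and> f ` L \<subseteq> span V"
    proof -
      obtain B where B: "B \<subseteq> span V" "pairwise orthogonal B" "\<And>x. x \<in> B \<Longrightarrow> norm x = 1"
          "independent B" "card B = dim (span V)" "span B = span V"
        using orthonormal_basis_subspace[of "span V"] by auto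
      have fB: "finite B" using B(4) by (simp add: independent_imp_finite)
      define f where "f y = (\<Sum>b\<in>B. (b \<bullet> y) *\<^sub>R b)" for y
      have lf: "linear f"
        by (auto intro!: linearI simp: f_def inner_add_right algebra_simps sum.distrib scaleR_sum_right)
      have "y = 0" if y: "y \<in> L" "f y = 0" for y
      proof -
        have "b \<bullet> y = 0" if "b \<in> B" for b
        proof -
          have "0 = b \<bullet> f y" using y by simp
          also have "\<dots> = (\<Sum>c\<in>B. (c \<bullet> y) * (b \<bullet> c))" by (simp add: f_def inner_sum_right)
          also have "\<dots> = (\<Sum>c\<in>B. if c = b then b \<bullet> y else 0)"
            using B(2,3) that by (intro sum.cong) (auto simp: pairwise_def orthogonal_def norm_eq_1)
          finally show ?thesis using that fB by simp
        qed
        then have "v \<bullet> y = 0" if "v \<in> span B" for v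
          using orthogonal_to_span[OF that, of y] by (simp add: orthogonal_def inner_commute)
        then have "\<forall>x\<in>V. x \<bullet> y = 0" using B(6) span_base by metis
        then have "y \<in> K" using y by (auto simp: K_def L_def)
        then have "orthogonal y y" using y by (auto simp: L_def)
        then show ?thesis by (simp add: orthogonal_def)
      qed
      then have "inj_on f L"
        using linear_inj_on_iff_eq_0[OF lf sL] by blast
      moreover have "f ` L \<subseteq> span V"
        using B(1) by (auto simp: f_def intro!: span_sum span_scale)
      ultimately show ?thesis using lf by blast
    qed
    then obtain f where f: "linear f" "inj_on f L" "f ` L \<subseteq> span V" by blast
    have "dim L = dim (f ` L)"
      using dim_image_eq[OF f(1)] f(2) sL by (metis span_eq_iff)
    also have "\<dots> \<le> dim (span V)" by (rule dim_subset[OF f(3)])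
    also have "\<dots> \<le> card V" by (simp add: assms(2) dim_le_card')
    finally show ?thesis .
  qed
  then show ?thesis using dL by (simp add: K_def)
qed

lemma exists_unit_orthogonal:
  fixes U :: "'a::euclidean_space set"
  assumes "subspace U" "finite V" "card V < dim U"
  obtains y where "y \<in> U" "norm y = 1" "\<And>x. x \<in> V \<Longrightarrow> x \<bullet> y = 0"
proof -
  define K where "K = {y \<in> U. \<forall>x\<in>V. x \<bullet> y = 0}"
  have sK: "subspace K"
    using assms(1) by (auto simp: K_def subspace_def inner_add_right)
  have "dim K > 0"
    using dim_orthogonal_ge[OF assms(1,2)] assms(3) by (simp add: K_def)
  then obtain y where y: "y \<in> K" "y \<noteq> 0"
    by (metis dim_eq_0 gr_implies_not0 subsetI singletonI)
  have "y /\<^sub>R norm y \<in> K" using sK y by (simp add: subspace_scale)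
  with y show thesis by (intro that[of "y /\<^sub>R norm y"]) (auto simp: K_def)
qed

text \<open>Anticommutation makes \<open>k\<close> carry each eigenspace injectively into the other,
  so their dimensions agree; symmetry of \<open>f\<close> makes them orthogonal complements in
  \<open>U\<close>.\<close>

lemma involution_eigenspace_dim:
  fixes U :: "'a::euclidean_space set"
  assumes "subspace U" "linear f" "linear k"
    and "f ` U \<subseteq> U" "k ` U \<subseteq> U" "inj_on k U"
    and invol: "\<And>x. x \<in> U \<Longrightarrow> f (f x) = x"
    and sym: "\<And>x y. x \<in> U \<Longrightarrow> y \<in> U \<Longrightarrow> f x \<bullet> y = x \<bullet> f y"
    and anti: "\<And>x. x \<in> U \<Longrightarrow> f (k x) = - k (f x)"
  shows "2 * dim {x \<in> U. f x = x} = dim U" "2 * dim {x \<in> U. f x = - x} = dim U"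
proof -
  define p where "p = {x \<in> U. f x = x}"
  define n where "n = {x \<in> U. f x = - x}"
  have sp: "subspace p" and sn: "subspace n"
    using assms(1,2) by (auto simp: p_def n_def subspace_def linear_add linear_cmul linear_0)
  have dimk: "dim (k ` S) = dim S" if "S \<subseteq> U" "subspace S" for S
    using that dim_image_eq[OF assms(3)] inj_on_subset[OF assms(6)] by (metis span_eq_iff)
  have "k ` p \<subseteq> n" using assms(5) by (auto simp: p_def n_def anti)
  then have 1: "dim p \<le> dim n" using dimk[of p] sp dim_subset[of "k ` p" n] by (auto simp: p_def)
  have "k ` n \<subseteq> p" using assms(5) linear_neg[OF assms(3)] by (auto simp: p_def n_def anti)
  then have 2: "dim n \<le> dim p" using dimk[of n] sn dim_subset[of "k ` n" p] by (auto simp: n_def)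
  have "n = {y \<in> U. \<forall>x \<in> p. orthogonal x y}"
  proof (intro equalityI subsetI)
    fix y assume y: "y \<in> n"
    have "x \<bullet> y = 0" if "x \<in> p" for x
      using sym[of x y] that y by (simp add: p_def n_def)
    then show "y \<in> {y \<in> U. \<forall>x \<in> p. orthogonal x y}" using y by (auto simp: n_def orthogonal_def)
  next
    fix y assume y: "y \<in> {y \<in> U. \<forall>x \<in> p. orthogonal x y}"
    \<comment> \<open>Twice the component of \<open>y\<close> in the +1-eigenspace; it turns out to
      be orthogonal to itself.\<close>
    let ?z = "y + f y"
    have z: "?z \<in> p" using y assms(1,4) invol linear_add[OF assms(2)]
      by (auto simp: p_def subspace_add)
    have "?z \<bullet> ?z = ?z \<bullet> y + ?z \<bullet> f y" by (simp add: inner_add_right)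
    also have "?z \<bullet> f y = f ?z \<bullet> y" using sym[of ?z y] z y by (auto simp: p_def)
    also have "f ?z = ?z" using z by (simp add: p_def)
    also have "?z \<bullet> y = 0" using z y by (simp add: orthogonal_def)
    finally have "?z = 0" by simp
    then show "y \<in> n" using y by (simp add: n_def eq_neg_iff_add_eq_0 add.commute)
  qed
  then have 3: "dim n + dim p = dim U"
    using dim_subspace_orthogonal_to_vectors[OF sp assms(1)] by (auto simp: p_def)
  show "2 * dim {x \<in> U. f x = x} = dim U" "2 * dim {x \<in> U. f x = - x} = dim U"
    using 1 2 3 by (auto simp: p_def n_def)
qed

text \<open>\<open>J\<close>, \<open>K\<close> make \<open>U\<close> a quaternionic vector space.\<close>
lemma four_dvd_dim:
  fixes U :: "'a::euclidean_space set"
  assumes "linear J" "linear K" "subspace U" "J ` U \<subseteq> U" "K ` U \<subseteq> U"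
    and J2: "\<And>x. x \<in> U \<Longrightarrow> J (J x) = - x" and K2: "\<And>x. x \<in> U \<Longrightarrow> K (K x) = - x"
    and JK: "\<And>x. x \<in> U \<Longrightarrow> J (K x) = - K (J x)"
    and skJ: "\<And>x y. x \<in> U \<Longrightarrow> y \<in> U \<Longrightarrow> J x \<bullet> y = - (x \<bullet> J y)"
    and skK: "\<And>x y. x \<in> U \<Longrightarrow> y \<in> U \<Longrightarrow> K x \<bullet> y = - (x \<bullet> K y)"
  shows "4 dvd dim U"
  using assms
proof (induction "dim U" arbitrary: U rule: less_induct)
  case less
  note lJ = less.prems(1) and lK = less.prems(2) and sU = less.prems(3)
  note JU = less.prems(4) and KU = less.prems(5) and J2 = less.prems(6) and K2 = less.prems(7)
    and JK = less.prems(8) and skJ = less.prems(9) and skK = less.prems(10)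
  show ?case
  proof (cases "dim U = 0")
    case False
    then obtain v where v: "v \<in> U" "v \<noteq> 0"
      by (metis dim_eq_0 subsetI singletonI)
    have U: "J x \<in> U" "K x \<in> U" if "x \<in> U" for x using that JU KU by auto
    \<comment> \<open>An orthogonal basis of the quaternionic line through \<open>v\<close>. Its
      complement in \<open>U\<close> is again invariant under \<open>J\<close> and \<open>K\<close>
      and has four dimensions less, so the induction applies to it.\<close>
    define S where "S = {v, J v, K v, J (K v)}"
    have SU: "S \<subseteq> U" using U v by (auto simp: S_def)
    have JJ: "J x \<bullet> J y = x \<bullet> y" if "x \<in> U" "y \<in> U" for x y
      using skJ[of x "J y"] J2[of y] that U by simp
    have KK: "K x \<bullet> K y = x \<bullet> y" if "x \<in> U" "y \<in> U" for x y
      using skK[of x "K y"] K2[of y] that U by simp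
    have J0: "J x \<bullet> x = 0" "x \<bullet> J x = 0" if "x \<in> U" for x
      using skJ[of x x] that by (auto simp: inner_commute)
    have K0: "K x \<bullet> x = 0" "x \<bullet> K x = 0" if "x \<in> U" for x
      using skK[of x x] that by (auto simp: inner_commute)
    have KJ0: "J x \<bullet> K x = 0" "K x \<bullet> J x = 0" if x: "x \<in> U" for x
    proof -
      have "J x \<bullet> K x = - (x \<bullet> J (K x))" using skJ x U by blast
      also have "\<dots> = x \<bullet> K (J x)" using JK x by simp
      also have "\<dots> = - (K x \<bullet> J x)" using skK x U by simp
      finally show "J x \<bullet> K x = 0" "K x \<bullet> J x = 0" by (auto simp: inner_commute)
    qed
    have inn: "v \<bullet> J v = 0" "v \<bullet> K v = 0" "v \<bullet> J (K v) = 0" "J v \<bullet> K v = 0" "J v \<bullet> J (K v) = 0"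
       "K v \<bullet> J (K v) = 0" "J v \<bullet> v = 0" "K v \<bullet> v = 0" "J (K v) \<bullet> v = 0" "K v \<bullet> J v = 0"
       "J (K v) \<bullet> J v = 0" "J (K v) \<bullet> K v = 0"
      using J0[OF v(1)] K0[OF v(1)] KJ0[OF v(1)] skJ[of v "K v"] v(1) U J0[of "K v"] JJ[of v "K v"] JJ[of "K v" v]
      by (auto simp: inner_commute)
    have nz: "v \<bullet> v \<noteq> 0" "J v \<bullet> J v \<noteq> 0" "K v \<bullet> K v \<noteq> 0" "J (K v) \<bullet> J (K v) \<noteq> 0"
      using v U by (simp_all add: JJ KK)
    have orth_ne: "a \<noteq> b" if "a \<bullet> b = 0" "a \<bullet> a \<noteq> 0" for a b :: 'a
      using that by blast
    have ne: "v \<noteq> J v" "v \<noteq> K v" "v \<noteq> J (K v)" "J v \<noteq> K v" "J v \<noteq> J (K v)" "K v \<noteq> J (K v)"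
      by (rule orth_ne; use inn(1-6) nz in \<open>simp only: not_False_eq_True\<close>)+
    have cS: "card S = 4" using ne by (simp add: S_def)
    have "pairwise orthogonal S"
      unfolding S_def pairwise_def orthogonal_def using inn by auto
    moreover have "0 \<notin> S" using nz by (auto simp: S_def)
    ultimately have iS: "independent S" by (rule pairwise_orthogonal_independent)
    then have dS: "dim (span S) = 4" using cS by (simp add: dim_eq_card_independent)
    define V where "V = {y \<in> U. \<forall>x\<in>span S. orthogonal x y}"
    have dV: "dim V + 4 = dim U"
      unfolding V_def dS[symmetric]
      by (rule dim_subspace_orthogonal_to_vectors) (use sU SU in \<open>auto simp: span_minimal\<close>)
    have V: "y \<in> V \<longleftrightarrow> y \<in> U \<and> v \<bullet> y = 0 \<and> J v \<bullet> y = 0 \<and> K v \<bullet> y = 0 \<and> J (K v) \<bullet> y = 0" for y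
    proof -
      have "(\<forall>x\<in>span S. orthogonal x y) \<longleftrightarrow> (\<forall>x\<in>S. orthogonal x y)"
        using orthogonal_to_span span_base by (metis orthogonal_commute)
      then show ?thesis by (auto simp: V_def S_def orthogonal_def)
    qed
    have sV: "subspace V" using sU by (auto simp: V subspace_def inner_add_right)
    have JV: "J ` V \<subseteq> V"
    proof (intro image_subsetI)
      fix y assume y: "y \<in> V"
      then have yU: "y \<in> U" by (simp add: V)
      have "v \<bullet> J y = 0" using skJ[of v y] y v by (simp add: V)
      moreover have "J v \<bullet> J y = 0" using JJ[of v y] y v by (simp add: V)
      moreover have "K v \<bullet> J y = 0" using skJ[of "K v" y] y v U by (simp add: V)
      moreover have "J (K v) \<bullet> J y = 0" using JJ[of "K v" y] y v U by (simp add: V)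
      ultimately show "J y \<in> V" using yU U by (simp add: V)
    qed
    have KV: "K ` V \<subseteq> V"
    proof (intro image_subsetI)
      fix y assume y: "y \<in> V"
      then have yU: "y \<in> U" by (simp add: V)
      have "v \<bullet> K y = 0" using skK[of v y] y v by (simp add: V)
      moreover have "J v \<bullet> K y = 0" using skK[of "J v" y] JK[of v] y v U by (simp add: V)
      moreover have "K v \<bullet> K y = 0" using KK[of v y] y v U by (simp add: V)
      moreover have "J (K v) \<bullet> K y = 0" using JK[of v] KK[of "J v" y] y v U by (simp add: V)
      ultimately show "K y \<in> V" using yU U by (simp add: V)
    qed
    have "4 dvd dim V"
      by (rule less.hyps[OF _ lJ lK sV JV KV]) (use dV J2 K2 JK skJ skK in \<open>simp_all add: V\<close>)
    then show ?thesis using dV by (metis dvd_add_triv_right_iff)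
  qed (simp del: dim_eq_0)
qed

subsection \<open>Images of few parameters and decomposable 3-vectors\<close>

text \<open>A differentiable image with fewer parameters than \<open>dim T\<close> is null in
  \<open>T\<close>. To work with Lebesgue measure on the ambient space, each image is thickened by
  the orthogonal complement of \<open>T\<close>, and its parameters are read off as coordinates
  along orthonormal vectors of \<open>T\<close>.\<close>

lemma exists_avoiding_lowdim_images:
  fixes T :: "'a::euclidean_space set" and G :: "'k \<Rightarrow> ('d \<Rightarrow> real) \<Rightarrow> 'a"
  assumes T: "subspace T" "v \<in> T" and e: "0 < e" and K: "finite K"
    and D: "\<And>k. k \<in> K \<Longrightarrow> finite (D k)" "\<And>k. k \<in> K \<Longrightarrow> card (D k) < dim T"
    and diff: "\<And>k b. k \<in> K \<Longrightarrow> (\<lambda>y :: 'a. G k (\<lambda>d. y \<bullet> b d)) differentiable_on UNIV"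
    and local: "\<And>k c c'. k \<in> K \<Longrightarrow> (\<And>d. d \<in> D k \<Longrightarrow> c d = c' d) \<Longrightarrow> G k c = G k c'"
  obtains w where "w \<in> T" "dist v w < e" "\<And>k c. k \<in> K \<Longrightarrow> w \<noteq> G k c"
proof -
  obtain B where B: "B \<subseteq> T" "pairwise orthogonal B" "\<And>x. x \<in> B \<Longrightarrow> norm x = 1"
      "independent B" "card B = dim T" "span B = T"
    using orthonormal_basis_subspace[OF T(1)] by blast
  have fB: "finite B" using B(4) by (simp add: independent_imp_finite)
  have BB: "a \<bullet> b = (if a = b then 1 else 0)" if "a \<in> B" "b \<in> B" for a b
    using B(2,3) that by (auto simp: pairwise_def orthogonal_def norm_eq_1)
  define pr where "pr y = (\<Sum>b\<in>B. (y \<bullet> b) *\<^sub>R b)" for y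
  have lpr: "linear pr"
    by (rule linearI) (simp_all add: pr_def inner_add_left scaleR_add_left sum.distrib scaleR_sum_right)
  have prT: "pr y \<in> T" for y
    using B(1) T(1) by (auto simp: pr_def intro!: subspace_sum subspace_scale)
  have prB: "pr y \<bullet> b = y \<bullet> b" if "b \<in> B" for y b
  proof -
    have "pr y \<bullet> b = (\<Sum>a\<in>B. if a = b then y \<bullet> b else 0)"
      unfolding pr_def inner_sum_left by (intro sum.cong) (auto simp: BB that)
    then show ?thesis using fB that by simp
  qed
  have zero: "y = 0" if "y \<in> T" "\<And>b. b \<in> B \<Longrightarrow> y \<bullet> b = 0" for y
  proof -
    have "orthogonal y y"
      by (rule orthogonal_to_span[of y B]) (use that B(6) in \<open>auto simp: orthogonal_def\<close>)
    then show ?thesis by (simp add: orthogonal_def)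
  qed
  have pr_id: "pr y = y" if "y \<in> T" for y
  proof -
    have "pr y - y = 0" by (rule zero) (use that prT T(1) in \<open>auto simp: subspace_diff inner_diff_left prB\<close>)
    then show ?thesis by simp
  qed
  have pr_norm: "norm (pr y) \<le> norm y" for y
  proof -
    have "pr y \<bullet> w = (\<Sum>b\<in>B. (y \<bullet> b) * (b \<bullet> w))" for w
      by (simp add: pr_def inner_sum_left)
    moreover have "b \<bullet> (y - pr y) = 0" if "b \<in> B" for b
      using prB[OF that, of y] by (simp add: inner_diff_right inner_commute[of b])
    ultimately have "pr y \<bullet> (y - pr y) = 0" by simp
    then have "(norm y)\<^sup>2 = (norm (pr y))\<^sup>2 + (norm (y - pr y))\<^sup>2"
      using norm_add_Pythagorean[of "pr y" "y - pr y"] by (simp add: orthogonal_def)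
    then show ?thesis by (simp add: power2_le_imp_le)
  qed
  have "\<exists>N. negligible N \<and> (\<forall>c w. (\<forall>b\<in>B. w \<bullet> b = 0) \<longrightarrow> G k c + w \<in> N)" if k: "k \<in> K" for k
  proof -
    obtain b where b: "b ` D k \<subseteq> B" "inj_on b (D k)"
      using card_le_inj[OF D(1)[OF k] fB] D(2)[OF k] B(5) by auto
    have "card (b ` D k) < card B" using D(2)[OF k] B(5) b(2) by (simp add: card_image)
    \<comment> \<open>One basis direction carries no parameter, so the thickened image is already
      covered by the image under \<open>f\<close> of the hyperplane orthogonal to \<open>b0\<close>,
      which is null.\<close>
    then obtain b0 where b0: "b0 \<in> B" "b0 \<notin> b ` D k"
      using b(1) by (metis less_irrefl subsetI subset_antisym)
    define f where "f y = G k (\<lambda>d. y \<bullet> b d) + (y - pr y)" for y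
    have "f differentiable_on UNIV"
      unfolding f_def
      by (rule differentiable_on_add; (rule diff[OF k] differentiable_on_diff[OF differentiable_on_ident
            linear_imp_differentiable_on[OF lpr]])?)
    moreover have "b0 \<noteq> 0" using B(3)[OF b0(1)] by auto
    ultimately have "negligible (f ` {y. b0 \<bullet> y = 0})"
      by (intro negligible_differentiable_image_negligible negligible_hyperplane)
        (auto intro: differentiable_on_subset)
    moreover have "G k c + w \<in> f ` {y. b0 \<bullet> y = 0}" if w: "\<forall>b\<in>B. w \<bullet> b = 0" for c w
    proof
      let ?y = "(\<Sum>d\<in>D k. c d *\<^sub>R b d) + w"
      have yb: "?y \<bullet> b d = c d" if "d \<in> D k" for d
      proof -
        have "?y \<bullet> b d = (\<Sum>d'\<in>D k. c d' * (b d' \<bullet> b d))"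
          using w b that by (auto simp: inner_add_left inner_sum_left)
        also have "\<dots> = (\<Sum>d'\<in>D k. if d' = d then c d else 0)"
          using b that by (intro sum.cong) (auto simp: BB image_subset_iff inj_on_eq_iff)
        finally show ?thesis using that D(1)[OF k] by simp
      qed
      have "b0 \<bullet> ?y = 0"
        using w b b0 BB by (auto simp: inner_add_right inner_sum_right inner_commute[of b0 w] image_subset_iff intro!: sum.neutral)
      then show "?y \<in> {y. b0 \<bullet> y = 0}" by simp
      have "pr w = 0" using w by (simp add: pr_def)
      moreover have "(\<Sum>d\<in>D k. c d *\<^sub>R b d) \<in> T"
        using b B(1) T(1) by (intro subspace_sum subspace_scale) auto
      ultimately have "pr ?y = (\<Sum>d\<in>D k. c d *\<^sub>R b d)" by (simp add: linear_add[OF lpr] pr_id)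
      moreover have "G k (\<lambda>d. ?y \<bullet> b d) = G k c" by (rule local[OF k]) (rule yb)
      ultimately show "G k c + w = f ?y" by (simp add: f_def)
    qed
    ultimately show ?thesis by blast
  qed
  then obtain N where N: "\<And>k. k \<in> K \<Longrightarrow> negligible (N k)"
      "\<And>k c w. k \<in> K \<Longrightarrow> (\<And>b. b \<in> B \<Longrightarrow> w \<bullet> b = 0) \<Longrightarrow> G k c + w \<in> N k"
    by metis
  have "negligible (\<Union>(N ` K))" using K N(1) by (intro negligible_Union) auto
  then have "\<not> ball v e \<subseteq> \<Union>(N ` K)"
    using e negligible_subset[of _ "ball v e"] negligible_convex_interior[OF convex_ball, of v e] by auto
  \<comment> \<open>This point may lie outside \<open>T\<close>. Its projection \<open>pr z\<close>
    avoids the images because each \<open>N k\<close> contains the image together with all its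
    translates by vectors orthogonal to \<open>T\<close>.\<close>
  then obtain z where z: "dist v z < e" "\<And>k. k \<in> K \<Longrightarrow> z \<notin> N k"
    by (force simp: subset_iff)
  show thesis
  proof (rule that[of "pr z"])
    have "v - pr z = pr (v - z)" using pr_id[OF T(2)] by (simp add: linear_diff[OF lpr])
    then show "dist v (pr z) < e" using pr_norm[of "v - z"] z by (simp add: dist_norm)
    show "pr z \<noteq> G k c" if "k \<in> K" for k c
    proof
      assume "pr z = G k c"
      then have "z = G k c + (z - pr z)" by simp
      moreover have "(z - pr z) \<bullet> b = 0" if "b \<in> B" for b using prB[OF that] by (simp add: inner_diff_left)
      ultimately show False using N(2)[OF \<open>k \<in> K\<close>, of "z - pr z" c] z(2)[OF \<open>k \<in> K\<close>] by simp
    qed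
  qed (rule prT)
qed

section \<open>Elimination for decomposable 3-vectors\<close>

lemma span_pivot:
  fixes e :: "'i \<Rightarrow> 'a::real_vector"
  assumes "finite J" "x \<in> span (e ` J)" "x \<noteq> 0"
  shows "\<exists>i\<in>J. \<exists>\<alpha>. \<alpha> \<noteq> 0 \<and> x - \<alpha> *\<^sub>R e i \<in> span (e ` (J - {i}))"
  using assms
proof (induction J arbitrary: x rule: finite_induct)
  case (insert j J)
  obtain \<alpha> where \<alpha>: "x - \<alpha> *\<^sub>R e j \<in> span (e ` J)"
    using insert.prems(1) by (auto simp: span_breakdown_eq)
  show ?case
  proof (cases "\<alpha> = 0")
    case True
    then obtain i \<beta> where "i \<in> J" "\<beta> \<noteq> 0" "x - \<beta> *\<^sub>R e i \<in> span (e ` (J - {i}))"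
      using insert.IH[of x] \<alpha> insert.prems by auto
    moreover have "span (e ` (J - {i})) \<subseteq> span (e ` (insert j J - {i}))" by (intro span_mono) auto
    ultimately show ?thesis by blast
  next
    case False
    moreover have "insert j J - {j} = J" using insert.hyps by auto
    ultimately show ?thesis using \<alpha> by (intro bexI[of _ j] exI[of _ \<alpha>]) auto
  qed
qed simp

text \<open>The elimination step: a suitable multiple of the normalised row \<open>e i + z\<close>
  clears the coordinate of \<open>x\<close> at \<open>i\<close>.\<close>

lemma span_reduce:
  fixes e :: "'i \<Rightarrow> 'a::real_vector"
  assumes "i \<in> J" "x \<in> span (e ` J)" "z \<in> span (e ` (J - {i}))"
  shows "\<exists>\<beta>. x - \<beta> *\<^sub>R (e i + z) \<in> span (e ` (J - {i}))"
proof -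
  have "e ` J = insert (e i) (e ` (J - {i}))" using assms(1) by auto
  then obtain \<beta> where "x - \<beta> *\<^sub>R e i \<in> span (e ` (J - {i}))"
    using assms(2) by (auto simp: span_breakdown_eq)
  then have "(x - \<beta> *\<^sub>R e i) - \<beta> *\<^sub>R z \<in> span (e ` (J - {i}))"
    by (rule span_diff[OF _ span_scale[OF assms(3)]])
  then show ?thesis by (intro exI[of _ \<beta>]) (simp add: scaleR_add_right diff_diff_eq)
qed

text \<open>Gaussian elimination: decomposable 3-vectors in an \<open>n\<close>-dimensional space are covered by charts
  with \<open>3 * (n - 3) + 1\<close> parameters.\<close>
lemma alternating_trilinear_chart:
  fixes t :: "'a::real_vector \<Rightarrow> 'a \<Rightarrow> 'a \<Rightarrow> 'b::real_vector" and e :: "'i \<Rightarrow> 'a"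
  assumes lin: "\<And>y z. linear (\<lambda>x. t x y z)" "\<And>x z. linear (\<lambda>y. t x y z)" "\<And>x y. linear (\<lambda>z. t x y z)"
    and alt: "\<And>x y. x \<in> span (e ` I) \<Longrightarrow> y \<in> span (e ` I) \<Longrightarrow> t x x y = 0"
      "\<And>x y. x \<in> span (e ` I) \<Longrightarrow> y \<in> span (e ` I) \<Longrightarrow> t x y x = 0"
      "\<And>x y. x \<in> span (e ` I) \<Longrightarrow> y \<in> span (e ` I) \<Longrightarrow> t y x x = 0"
    and I: "finite I" and abc: "a \<in> span (e ` I)" "b \<in> span (e ` I)" "c \<in> span (e ` I)" "t a b c \<noteq> 0"
  obtains r i j k a' b' c' where "i \<in> I" "j \<in> I" "k \<in> I" "i \<noteq> j" "i \<noteq> k" "j \<noteq> k"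
    "a' \<in> span (e ` (I - {i, j, k}))" "b' \<in> span (e ` (I - {i, j, k}))" "c' \<in> span (e ` (I - {i, j, k}))"
    "t a b c = r *\<^sub>R t (e i + a') (e j + b') (e k + c')"
proof -
  note l = linear_add[OF lin(1)] linear_add[OF lin(2)] linear_add[OF lin(3)]
    linear_scale[OF lin(1)] linear_scale[OF lin(2)] linear_scale[OF lin(3)]
    linear_0[OF lin(1)] linear_0[OF lin(2)] linear_0[OF lin(3)]
  have sub: "x \<in> span (e ` J)" if "x \<in> span (e ` J')" "J' \<subseteq> J" for x J J'
    using that span_mono[of "e ` J'" "e ` J"] by blast
  have eI: "e i \<in> span (e ` J)" if "i \<in> J" for i J using that by (simp add: span_base)
  have "a \<noteq> 0" using abc(4) l by metis
  then obtain i \<alpha> where i: "i \<in> I" "\<alpha> \<noteq> 0" "a - \<alpha> *\<^sub>R e i \<in> span (e ` (I - {i}))"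
    using span_pivot[OF I abc(1)] by blast
  define I1 where "I1 = I - {i}"
  define a1 where "a1 = (1 / \<alpha>) *\<^sub>R (a - \<alpha> *\<^sub>R e i)"
  define A where "A = e i + a1"
  have a1: "a1 \<in> span (e ` I1)" using i by (simp add: a1_def I1_def span_scale)
  have aA: "a = \<alpha> *\<^sub>R A" using i by (simp add: A_def a1_def scaleR_add_right)
  obtain \<beta> where \<beta>: "b - \<beta> *\<^sub>R A \<in> span (e ` I1)" using span_reduce[OF i(1) abc(2) a1[unfolded I1_def]] by (auto simp: A_def I1_def)
  obtain \<gamma> where \<gamma>: "c - \<gamma> *\<^sub>R A \<in> span (e ` I1)" using span_reduce[OF i(1) abc(3) a1[unfolded I1_def]] by (auto simp: A_def I1_def)
  define b1 where "b1 = b - \<beta> *\<^sub>R A"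
  define c1 where "c1 = c - \<gamma> *\<^sub>R A"
  have AI: "A \<in> span (e ` I)" unfolding A_def using eI[OF i(1)] sub[OF a1, of I] by (auto simp: I1_def span_add)
  have b1: "b1 \<in> span (e ` I1)" "b1 \<in> span (e ` I)" using \<beta> sub[OF \<beta>, of I] by (auto simp: b1_def I1_def)
  have c1: "c1 \<in> span (e ` I1)" "c1 \<in> span (e ` I)" using \<gamma> sub[OF \<gamma>, of I] by (auto simp: c1_def I1_def)
  \<comment> \<open>Terms containing \<open>A\<close> twice vanish, so the other two arguments may
    be reduced modulo \<open>A\<close>.\<close>
  have "t a b c = t (\<alpha> *\<^sub>R A) (\<beta> *\<^sub>R A + b1) (\<gamma> *\<^sub>R A + c1)" using aA by (simp add: b1_def c1_def)
  also have "\<dots> = \<alpha> *\<^sub>R t A b1 c1" unfolding l using alt AI b1 c1 by simp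
  finally have 1: "t a b c = \<alpha> *\<^sub>R t A b1 c1" .
  have "b1 \<noteq> 0" using abc(4) 1 l by (metis scaleR_zero_right)
  moreover have fI1: "finite I1" using I by (simp add: I1_def)
  ultimately obtain j \<alpha>' where j: "j \<in> I1" "\<alpha>' \<noteq> 0" "b1 - \<alpha>' *\<^sub>R e j \<in> span (e ` (I1 - {j}))"
    using span_pivot[OF fI1 b1(1)] by blast
  define I2 where "I2 = I1 - {j}"
  define b2 where "b2 = (1 / \<alpha>') *\<^sub>R (b1 - \<alpha>' *\<^sub>R e j)"
  define B where "B = e j + b2"
  have b2: "b2 \<in> span (e ` I2)" using j by (simp add: b2_def I2_def span_scale)
  have bB: "b1 = \<alpha>' *\<^sub>R B" using j by (simp add: B_def b2_def scaleR_add_right)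
  obtain \<delta> where \<delta>: "a1 - \<delta> *\<^sub>R B \<in> span (e ` I2)" using span_reduce[OF j(1) a1 b2[unfolded I2_def]] by (auto simp: B_def I2_def)
  obtain \<epsilon> where \<epsilon>: "c1 - \<epsilon> *\<^sub>R B \<in> span (e ` I2)" using span_reduce[OF j(1) c1(1) b2[unfolded I2_def]] by (auto simp: B_def I2_def)
  define a2 where "a2 = a1 - \<delta> *\<^sub>R B"
  define A2 where "A2 = e i + a2"
  define c2 where "c2 = c1 - \<epsilon> *\<^sub>R B"
  have jI: "j \<in> I" using j by (simp add: I1_def)
  have I2I: "I2 \<subseteq> I" by (auto simp: I2_def I1_def)
  have BI: "B \<in> span (e ` I)" unfolding B_def using eI[OF jI] sub[OF b2 I2I] by (auto simp: span_add)
  have a2: "a2 \<in> span (e ` I2)" "A2 \<in> span (e ` I)" using \<delta> sub[OF \<delta> I2I] eI[OF i(1)] by (auto simp: a2_def A2_def span_add)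
  have c2: "c2 \<in> span (e ` I2)" "c2 \<in> span (e ` I)" using \<epsilon> sub[OF \<epsilon> I2I] by (auto simp: c2_def)
  \<comment> \<open>Reduction modulo \<open>B\<close> clears the coordinate at \<open>j\<close> of
    the first row as well and leaves its pivot \<open>e i\<close> in place.\<close>
  have "t A b1 c1 = t (\<delta> *\<^sub>R B + A2) (\<alpha>' *\<^sub>R B) (\<epsilon> *\<^sub>R B + c2)" using bB by (simp add: A_def A2_def a2_def c2_def)
  also have "\<dots> = \<alpha>' *\<^sub>R t A2 B c2" unfolding l using alt BI a2 c2 by simp
  finally have 2: "t A b1 c1 = \<alpha>' *\<^sub>R t A2 B c2" .
  have "c2 \<noteq> 0" using abc(4) 1 2 l by (metis scaleR_zero_right)
  moreover have fI2: "finite I2" using I by (simp add: I2_def I1_def)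
  ultimately obtain k \<alpha>'' where k: "k \<in> I2" "\<alpha>'' \<noteq> 0" "c2 - \<alpha>'' *\<^sub>R e k \<in> span (e ` (I2 - {k}))"
    using span_pivot[OF fI2 c2(1)] by blast
  define I3 where "I3 = I2 - {k}"
  define c3 where "c3 = (1 / \<alpha>'') *\<^sub>R (c2 - \<alpha>'' *\<^sub>R e k)"
  define C where "C = e k + c3"
  have c3: "c3 \<in> span (e ` I3)" using k by (simp add: c3_def I3_def span_scale)
  have cC: "c2 = \<alpha>'' *\<^sub>R C" using k by (simp add: C_def c3_def scaleR_add_right)
  obtain \<zeta> where \<zeta>: "a2 - \<zeta> *\<^sub>R C \<in> span (e ` I3)" using span_reduce[OF k(1) a2(1) c3[unfolded I3_def]] by (auto simp: C_def I3_def)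
  obtain \<eta> where \<eta>: "b2 - \<eta> *\<^sub>R C \<in> span (e ` I3)" using span_reduce[OF k(1) b2 c3[unfolded I3_def]] by (auto simp: C_def I3_def)
  define a3 where "a3 = a2 - \<zeta> *\<^sub>R C"
  define b3 where "b3 = b2 - \<eta> *\<^sub>R C"
  have kI: "k \<in> I" using k I2I by blast
  have I3I: "I3 \<subseteq> I" using I2I by (auto simp: I3_def)
  have CI: "C \<in> span (e ` I)" unfolding C_def using eI[OF kI] sub[OF c3 I3I] by (auto simp: span_add)
  have a3: "a3 \<in> span (e ` I3)" "e i + a3 \<in> span (e ` I)" using \<zeta> sub[OF \<zeta> I3I] eI[OF i(1)] by (auto simp: a3_def span_add)
  have b3: "b3 \<in> span (e ` I3)" "e j + b3 \<in> span (e ` I)" using \<eta> sub[OF \<eta> I3I] eI[OF jI] by (auto simp: b3_def span_add)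
  define A3 where "A3 = e i + a3"
  define B3 where "B3 = e j + b3"
  have A3I: "A3 \<in> span (e ` I)" "B3 \<in> span (e ` I)" using a3 b3 by (auto simp: A3_def B3_def)
  have "t A2 B c2 = t (\<zeta> *\<^sub>R C + A3) (\<eta> *\<^sub>R C + B3) (\<alpha>'' *\<^sub>R C)"
    using cC by (simp add: A2_def B_def A3_def B3_def a3_def b3_def)
  also have "\<dots> = \<alpha>'' *\<^sub>R t A3 B3 C" unfolding l using alt CI A3I by simp
  finally have 3: "t A2 B c2 = \<alpha>'' *\<^sub>R t (e i + a3) (e j + b3) (e k + c3)" by (simp add: C_def A3_def B3_def)
  have "I3 = I - {i, j, k}" by (auto simp: I3_def I2_def I1_def)
  then show thesis
    using that[of i j k a3 b3 c3 "\<alpha> * \<alpha>' * \<alpha>''"] i j k a3 b3 c3 1 2 3 jI kI by (auto simp: I1_def I2_def)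
qed

subsection \<open>Clifford systems\<close>

lemma transpose_add: "transpose (A + B) = transpose A + transpose (B :: 'a::semiring_1^'n^'m)"
  by (simp add: transpose_def vec_eq_iff)

lemma transpose_scaleR: "transpose (c *\<^sub>R A) = c *\<^sub>R transpose (A :: real^'n^'m)"
  by (simp add: transpose_def vec_eq_iff)

text \<open>\<open>large\<close> is the inequality 3 m1 < m2 + 9 after substituting m1 = m and m2 =
  l - m - 1.\<close>

locale clifford_sys =
  fixes P :: "nat \<Rightarrow> real ^ 'n ^ 'n" and m l :: nat
  assumes card_n: "CARD('n) = 2 * l" and sys: "clifford_system m P" and m3: "3 \<le> m" and large: "4 * m < l + 8"
begin

definition W where "W = span (P ` {0..m})"

lemma l_pos: "0 < l"
  using card_n zero_less_card_finite[where 'a='n] by linarith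

lemma subspace_W [simp]: "subspace W" by (simp add: W_def)

lemma W_closed [simp]:
  "A \<in> W \<Longrightarrow> B \<in> W \<Longrightarrow> A + B \<in> W" "A \<in> W \<Longrightarrow> B \<in> W \<Longrightarrow> A - B \<in> W"
  "A \<in> W \<Longrightarrow> - A \<in> W" "A \<in> W \<Longrightarrow> c *\<^sub>R A \<in> W" "0 \<in> W"
  using subspace_W by (auto simp: subspace_add subspace_diff subspace_neg subspace_scale subspace_0)

lemma P_in_W [simp]: "i \<le> m \<Longrightarrow> P i \<in> W"
  by (auto simp: W_def intro: span_base)

lemma transpose_W: "A \<in> W \<Longrightarrow> transpose A = A"
  unfolding W_def
proof (induction rule: span_induct)
  case base
  then show ?case using sys by (simp add: subspace_def transpose_add transpose_scaleR) (simp add: transpose_def vec_eq_iff)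
next
  case (step A)
  then show ?case using sys by (auto simp: clifford_system_def)
qed

lemma W_sym: "A \<in> W \<Longrightarrow> (A *v x) \<bullet> y = x \<bullet> (A *v y)"
  using matrix_vector_inner_transpose[of A x y] by (simp add: transpose_W)

text \<open>Having an anticommutator proportional to \<open>mat 1\<close> is a linear condition on
  either factor, so it passes from the generators to their span. Taking traces then identifies the
  scalar.\<close>

lemma anticommutator:
  assumes "A \<in> W" "B \<in> W"
  shows "A ** B + B ** A = (2 * trace_inner A B) *\<^sub>R mat 1"
proof -
  note bm = bilinear_ladd[OF bilinear_matrix_mult] bilinear_radd[OF bilinear_matrix_mult]
    bilinear_lmul[OF bilinear_matrix_mult] bilinear_rmul[OF bilinear_matrix_mult]
    bilinear_lzero[OF bilinear_matrix_mult] bilinear_rzero[OF bilinear_matrix_mult]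
  have sub: "subspace {A. \<exists>c. A ** B + B ** A = c *\<^sub>R mat 1}" for B :: "real^'n^'n"
  proof (rule subspaceI)
    have "0 ** B + B ** 0 = 0 *\<^sub>R (mat 1 :: real^'n^'n)" by (simp add: bm)
    then show "0 \<in> {A. \<exists>c. A ** B + B ** A = c *\<^sub>R mat 1}" by blast
  next
    fix A A' assume "A \<in> {A. \<exists>c. A ** B + B ** A = c *\<^sub>R mat 1}" "A' \<in> {A. \<exists>c. A ** B + B ** A = c *\<^sub>R mat 1}"
    then obtain c c' where *: "A ** B + B ** A = c *\<^sub>R mat 1" "A' ** B + B ** A' = c' *\<^sub>R mat 1" by blast
    have "(A + A') ** B + B ** (A + A') = (c + c') *\<^sub>R mat 1"
      using arg_cong2[OF *, of "(+)"] by (simp add: bm scaleR_add_left algebra_simps)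
    then show "A + A' \<in> {A. \<exists>c. A ** B + B ** A = c *\<^sub>R mat 1}" by blast
  next
    fix A and d :: real assume "A \<in> {A. \<exists>c. A ** B + B ** A = c *\<^sub>R mat 1}"
    then obtain c where *: "A ** B + B ** A = c *\<^sub>R mat 1" by blast
    have "(d *\<^sub>R A) ** B + B ** (d *\<^sub>R A) = (d * c) *\<^sub>R mat 1"
      using arg_cong[OF *, of "\<lambda>X. d *\<^sub>R X"] by (simp add: bm scaleR_add_right)
    then show "d *\<^sub>R A \<in> {A. \<exists>c. A ** B + B ** A = c *\<^sub>R mat 1}" by blast
  qed
  have 1: "\<exists>c. A ** P i + P i ** A = c *\<^sub>R mat 1" if "i \<le> m" for i
    using assms(1) unfolding W_def
  proof (induction rule: span_induct)
    case base show ?case by (rule sub)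
  next
    case (step A)
    then show ?case using sys that by (auto simp: clifford_system_def)
  qed
  have "\<exists>c. B ** A + A ** B = c *\<^sub>R mat 1"
    using assms(2) unfolding W_def
  proof (induction rule: span_induct)
    case base show ?case by (rule sub)
  next
    case (step B)
    then show ?case using 1 by (auto simp: add.commute)
  qed
  then obtain c where c: "A ** B + B ** A = c *\<^sub>R mat 1"
    by (auto simp: add.commute)
  from arg_cong[OF c, of trace] have "2 * trace (A ** B) = c * CARD('n)"
    unfolding trace_add trace_scaleR trace_I trace_mul_sym[of B A] by simp
  then have "c = 2 * trace_inner A B" by (simp add: trace_inner_def field_simps)
  with c show ?thesis by simp
qed

lemma anticomm:
  assumes "A \<in> W" "B \<in> W"
  shows "A *v (B *v x) = (2 * trace_inner A B) *\<^sub>R x - B *v (A *v x)"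
  using arg_cong[OF anticommutator[OF assms], of "\<lambda>M. M *v x"]
  by (simp add: mv_simps matrix_vector_mul_assoc algebra_simps)

lemma swap: "A \<in> W \<Longrightarrow> B \<in> W \<Longrightarrow> trace_inner A B = 0 \<Longrightarrow> A *v (B *v x) = - (B *v (A *v x))"
  using anticomm[of A B x] by simp

lemma sq:
  assumes "A \<in> W"
  shows "A *v (A *v x) = trace_inner A A *\<^sub>R x"
proof -
  have "A *v (A *v x) + A *v (A *v x) = (2 * trace_inner A A) *\<^sub>R x"
    by (subst (1) anticomm[OF assms assms]) simp
  then have "2 *\<^sub>R (A *v (A *v x)) = 2 *\<^sub>R (trace_inner A A *\<^sub>R x)"
    by (simp add: scaleR_2)
  then show ?thesis by (simp only: scaleR_cancel_left) simp
qed

lemma inner_P [simp]: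
  assumes "i \<le> m" "j \<le> m"
  shows "trace_inner (P i) (P j) = (if i = j then 1 else 0)"
proof -
  have "(2 * trace_inner (P i) (P j)) *\<^sub>R mat 1 = (if i = j then 2 else 0) *\<^sub>R (mat 1 :: real^'n^'n)"
    using anticommutator[of "P i" "P j"] sys assms by (auto simp: clifford_system_def)
  from arg_cong[OF this, of trace] show ?thesis by (simp add: trace_scaleR trace_I split: if_splits)
qed

lemma inner_W: "A \<in> W \<Longrightarrow> B \<in> W \<Longrightarrow> trace_inner A B = (A \<bullet> B) / real CARD('n)"
  by (simp add: trace_inner_eq_inner transpose_W)

lemma norm_nonneg_W [simp]: "A \<in> W \<Longrightarrow> 0 \<le> trace_inner A A"
  by (simp add: inner_W)

lemma inner_eq_0_W: "A \<in> W \<Longrightarrow> trace_inner A A = 0 \<Longrightarrow> A = 0"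
  by (simp add: inner_W)

lemma inner_Cauchy: "A \<in> W \<Longrightarrow> B \<in> W \<Longrightarrow> (trace_inner A B)\<^sup>2 \<le> trace_inner A A * trace_inner B B"
  using Cauchy_Schwarz_ineq[of A B]
  by (simp add: inner_W power2_eq_square divide_right_mono)

lemma inner_1_eq:
  assumes "A \<in> W" "B \<in> W" "trace_inner A A = 1" "trace_inner B B = 1" "trace_inner A B = 1"
  shows "A = B"
  using inner_eq_0_W[of "A - B"] assms by (simp add: ti_simps trace_inner_commute[of B A])

lemma expand_on:
  assumes "J \<subseteq> {0..m}" "A \<in> span (P ` J)"
  shows "A = (\<Sum>i\<in>J. trace_inner A (P i) *\<^sub>R P i)"
proof (rule linear_eq_on_span[where f = "\<lambda>A. A" and B = "P ` J", OF _ _ _ assms(2)])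
  show "linear (\<lambda>A. \<Sum>i\<in>J. trace_inner A (P i) *\<^sub>R P i)"
    by (rule linearI) (simp_all add: ti_simps scaleR_add_left sum.distrib scaleR_sum_right)
  fix A assume "A \<in> P ` J"
  then obtain j where j: "A = P j" "j \<in> J" by auto
  have fJ: "finite J" using assms(1) by (rule finite_subset) simp
  have le: "i \<le> m" if "i \<in> J" for i using that assms(1) by auto
  have "(\<Sum>i\<in>J. trace_inner A (P i) *\<^sub>R P i) = (\<Sum>i\<in>J. if i = j then P j else 0)"
    using j by (intro sum.cong) (auto simp: le)
  then show "A = (\<Sum>i\<in>J. trace_inner A (P i) *\<^sub>R P i)" using j fJ by simp
qed (simp add: linear_iff)

lemma expand: "A \<in> W \<Longrightarrow> A = (\<Sum>i=0..m. trace_inner A (P i) *\<^sub>R P i)"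
  unfolding W_def by (rule expand_on) simp_all

lemma inner_expand:
  assumes "A \<in> W" "B \<in> W"
  shows "trace_inner A B = (\<Sum>i=0..m. trace_inner A (P i) * trace_inner B (P i))"
  by (subst expand[OF assms(2)]) (simp add: trace_inner_sum_right ti_simps mult.commute)

lemma norm_mv: "A \<in> W \<Longrightarrow> (A *v x) \<bullet> (A *v y) = trace_inner A A * (x \<bullet> y)"
  by (simp add: W_sym sq)

text \<open>\<open>H2 x y\<close> is the element of \<open>W\<close> that represents the functional
  sending \<open>A\<close> to <A x, y> with respect to \<open>trace_inner\<close>; the squared
  length of \<open>H x\<close> is \<open>h x\<close>.\<close>

definition H2 where "H2 x y = (\<Sum>i=0..m. ((P i *v x) \<bullet> y) *\<^sub>R P i)"
definition h where "h x = (\<Sum>i=0..m. ((P i *v x) \<bullet> x)\<^sup>2)"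
abbreviation "H x \<equiv> H2 x x"

lemma H2_in_W [simp]: "H2 x y \<in> W"
  unfolding H2_def by (intro subspace_sum) auto

lemma inner_H2:
  assumes "A \<in> W"
  shows "trace_inner A (H2 x y) = (A *v x) \<bullet> y"
proof -
  have "(A *v x) \<bullet> y = (\<Sum>i=0..m. trace_inner A (P i) * ((P i *v x) \<bullet> y))"
    by (subst expand[OF assms]) (simp add: mv_simps mv_sum inner_sum_left)
  then show ?thesis by (simp add: H2_def trace_inner_sum_right ti_simps mult.commute)
qed

lemma h_eq_inner: "h x = trace_inner (H x) (H x)"
  unfolding inner_H2[OF H2_in_W]
  by (subst H2_def) (simp add: mv_simps mv_sum inner_sum_left h_def power2_eq_square)

lemma h_eq: "h x = (H x *v x) \<bullet> x"
  by (simp add: h_eq_inner inner_H2)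

lemma h_nonneg [simp]: "0 \<le> h x" by (simp add: h_def sum_nonneg)

lemma H2_commute: "H2 x y = H2 y x"
proof -
  have "(P i *v x) \<bullet> y = (P i *v y) \<bullet> x" if "i \<le> m" for i
    using W_sym[of "P i" x y] that by (simp add: inner_commute)
  then show ?thesis unfolding H2_def by (intro sum.cong) auto
qed

lemma isoparametric_fun_eq: "isoparametric_fun m P x = 1 - 2 * h x"
  by (simp add: isoparametric_fun_def h_def)

lemma clifford_sphere_eq: "clifford_sphere m P = {Q \<in> W. trace_inner Q Q = 1}"
  by (simp add: clifford_sphere_def W_def)

lemma inner_mv_le: "A \<in> W \<Longrightarrow> ((A *v x) \<bullet> y)\<^sup>2 \<le> trace_inner A A * (x \<bullet> x) * (y \<bullet> y)"
  using Cauchy_Schwarz_ineq[of "A *v x" y] by (simp add: norm_mv)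

text \<open>Cauchy-Schwarz for the operator \<open>H x\<close>: the number \<open>h x\<close> is at
  once <H x x, x> and the squared length of \<open>H x\<close>.\<close>

lemma h_le: "h x \<le> (x \<bullet> x)\<^sup>2"
proof (cases "h x = 0")
  case False
  have "(h x)\<^sup>2 \<le> h x * (x \<bullet> x)\<^sup>2"
    using inner_mv_le[of "H x" x x] by (simp add: h_eq_inner[symmetric] h_eq[symmetric] power2_eq_square mult.assoc)
  then show ?thesis using False h_nonneg[of x] by (simp add: power2_eq_square)
qed simp

lemma inner_H_le:
  assumes "A \<in> W" "trace_inner A A = 1"
  shows "((A *v x) \<bullet> x)\<^sup>2 \<le> h x"
  using inner_Cauchy[OF assms(1) H2_in_W, of x x] assms by (simp add: inner_H2 h_eq_inner)

text \<open>Gram-Schmidt against \<open>A\<close>, tried on \<open>P 0\<close> and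
  \<open>P 1\<close>. These are orthonormal, so they cannot both be multiples of
  \<open>A\<close>.\<close>

lemma exists_orthogonal_unit:
  assumes A: "A \<in> W" "trace_inner A A = 1"
  obtains B where "B \<in> W" "trace_inner B B = 1" "trace_inner A B = 0"
proof -
  note result = that
  define B where "B i = P i - trace_inner A (P i) *\<^sub>R A" for i
  have *: thesis if "i \<le> m" "B i \<noteq> 0" for i
  proof -
    have BW: "B i \<in> W" using that A by (simp add: B_def)
    have o: "trace_inner A (B i) = 0" using that A by (simp add: B_def ti_simps)
    have pos: "trace_inner (B i) (B i) > 0"
      using inner_eq_0_W[OF BW] that norm_nonneg_W[OF BW] by fastforce
    show thesis
      by (rule result[of "(1 / sqrt (trace_inner (B i) (B i))) *\<^sub>R B i"]) (use BW o pos in \<open>auto simp: ti_simps\<close>)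
  qed
  show thesis
  proof (cases "B 0 = 0 \<and> B 1 = 0")
    case True
    then have e: "P 0 = trace_inner A (P 0) *\<^sub>R A" "P 1 = trace_inner A (P 1) *\<^sub>R A"
      by (auto simp: B_def)
    have "trace_inner (P 0) (P 1) = trace_inner A (P 0) * trace_inner A (P 1)"
      by (subst e(1), subst e(2)) (simp add: ti_simps A(2))
    moreover have "trace_inner (P 0) (P 0) = trace_inner A (P 0) * trace_inner A (P 0)"
      by (subst (1 2) e(1)) (simp add: ti_simps A(2))
    moreover have "trace_inner (P 1) (P 1) = trace_inner A (P 1) * trace_inner A (P 1)"
      by (subst (1 2) e(2)) (simp add: ti_simps A(2))
    ultimately show thesis using m3 by auto
  next
    case False
    then show thesis using *[of 0] *[of 1] m3 by auto
  qed
qed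

section \<open>Dimensions of eigenspaces and divisibility of \<open>l\<close>\<close>

lemma inj_unit: "A \<in> W \<Longrightarrow> trace_inner A A = 1 \<Longrightarrow> inj_on ((*v) A) U"
  by (metis inj_on_inverseI scaleR_one sq)

lemma dim_eigenspace:
  assumes A: "A \<in> W" "trace_inner A A = 1"
  shows "dim {x. A *v x = x} = l" "dim {x. A *v x = - x} = l"
proof -
  obtain B where B: "B \<in> W" "trace_inner B B = 1" "trace_inner A B = 0"
    using exists_orthogonal_unit[OF A] by blast
  have "2 * dim {x \<in> UNIV. A *v x = x} = dim (UNIV :: (real^'n) set)"
       "2 * dim {x \<in> UNIV. A *v x = - x} = dim (UNIV :: (real^'n) set)"
    by (rule involution_eigenspace_dim[where f = "(*v) A" and k = "(*v) B"];
        (simp add: inj_unit B A sq W_sym swap)?)+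
  then show "dim {x. A *v x = x} = l" "dim {x. A *v x = - x} = l"
    using card_n by simp_all
qed

lemma P_rules:
  assumes "i \<le> m" "j \<le> m" "i < j"
  shows "P j *v (P i *v x) = - (P i *v (P j *v x))"
  using assms by (intro swap) auto

lemma P_sq [simp]: "i \<le> m \<Longrightarrow> P i *v (P i *v x) = x"
  by (simp add: sq)

text \<open>The products of \<open>P 1\<close> with \<open>P 2\<close> and with \<open>P 3\<close>
  commute with \<open>P 0\<close>, hence act on its +1-eigenspace, of dimension \<open>l\<close>.
  There they are anticommuting skew complex structures.\<close>

lemma four_dvd_l: "4 dvd l"
proof -
  define U where "U = {x. P 0 *v x = x}"
  have r: "P 1 *v (P 0 *v x) = - (P 0 *v (P 1 *v x))" "P 2 *v (P 0 *v x) = - (P 0 *v (P 2 *v x))"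
    "P 3 *v (P 0 *v x) = - (P 0 *v (P 3 *v x))" "P 2 *v (P 1 *v x) = - (P 1 *v (P 2 *v x))"
    "P 3 *v (P 1 *v x) = - (P 1 *v (P 3 *v x))" "P 3 *v (P 2 *v x) = - (P 2 *v (P 3 *v x))" for x
    using m3 by (auto intro!: P_rules)
  have s: "P 0 *v (P 0 *v x) = x" "P 1 *v (P 1 *v x) = x" "P 2 *v (P 2 *v x) = x" "P 3 *v (P 3 *v x) = x" for x
    using m3 by auto
  have y: "(P 1 *v x) \<bullet> y = x \<bullet> (P 1 *v y)" "(P 2 *v x) \<bullet> y = x \<bullet> (P 2 *v y)" "(P 3 *v x) \<bullet> y = x \<bullet> (P 3 *v y)" for x y
    using m3 by (auto intro!: W_sym)
  have cU: "P 1 *v (P 2 *v x) \<in> U" "P 1 *v (P 3 *v x) \<in> U" if "x \<in> U" for x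
  proof -
    have e: "P 0 *v x = x" using that by (simp add: U_def)
    have "P 0 *v (P 1 *v (P k *v x)) = P 1 *v (P k *v (P 0 *v x))" if "k = 2 \<or> k = 3" for k
      using that by (auto simp: r mv_simps simp del: One_nat_def)
    then show "P 1 *v (P 2 *v x) \<in> U" "P 1 *v (P 3 *v x) \<in> U"
      unfolding U_def by (simp_all add: e)
  qed
  have "4 dvd dim U"
  proof (rule four_dvd_dim)
    show "linear (\<lambda>x. P 1 *v (P 2 *v x))" "linear (\<lambda>x. P 1 *v (P 3 *v x))"
      by (auto intro!: linearI simp: mv_simps)
    show "subspace U" by (auto simp: U_def subspace_def mv_simps)
    show "(\<lambda>x. P 1 *v (P 2 *v x)) ` U \<subseteq> U" "(\<lambda>x. P 1 *v (P 3 *v x)) ` U \<subseteq> U"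
      using cU by auto
  qed (simp_all add: r s mv_simps y del: One_nat_def)
  then show ?thesis using dim_eigenspace(1)[of "P 0"] by (simp add: U_def)
qed

text \<open>For \<open>m \<ge> 4\<close>, \<open>large\<close> gives l > 4 m - 8, which is at least
  2 m. For \<open>m = 3\<close> it gives only l > 4, and divisibility by 4 raises this to l at least
  8.\<close>

lemma l_gt: "2 * m < l"
proof (cases "m = 3")
  case True
  then show ?thesis using four_dvd_l large by presburger
next
  case False
  then show ?thesis using m3 large by linarith
qed

end

subsection \<open>Normal circles and level sets\<close>

declare transpose_matrix_vector [simp del]

lemma orthogonal_matrix_inner:
  fixes A :: "real^'n^'n"
  assumes "orthogonal_matrix A"
  shows "(A *v x) \<bullet> (A *v y) = x \<bullet> y"
  using assms by (simp only: matrix_vector_inner_transpose matrix_vector_mul_assoc orthogonal_matrix_def) simp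

lemma orthogonal_matrix_cancel:
  fixes A :: "real^'n^'n"
  assumes "orthogonal_matrix A"
  shows "A *v (transpose A *v x) = x" "transpose A *v (A *v x) = x"
  using assms by (simp_all only: matrix_vector_mul_assoc orthogonal_matrix_def) simp_all

lemma sum_Basis_trace:
  fixes R :: "real^'n^'n"
  shows "(\<Sum>e\<in>Basis. (R *v e) \<bullet> e) = trace R"
proof -
  have "(\<Sum>e\<in>Basis. (R *v e) \<bullet> e) = (\<Sum>i\<in>UNIV. (R *v axis i 1) \<bullet> axis i 1)"
    by (simp add: Basis_vec_def sum.UNION_disjoint sum.reindex inj_on_def axis_eq_axis UNION_singleton_eq_range)
  also have "\<dots> = trace R"
    by (simp add: trace_def inner_axis matrix_vector_mult_basis column_def)
  finally show ?thesis .
qed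

text \<open>By cyclicity of the trace, inserting \<open>S ** S\<close> and carrying one factor past
  \<open>R\<close> changes nothing but the sign.\<close>

lemma trace_eq_0_of_anticommute:
  fixes R S :: "real^'n^'n"
  assumes "R ** S = - (S ** R)" "S ** S = mat 1"
  shows "trace R = 0"
proof -
  have "trace R = trace ((R ** S) ** S)"
    by (simp add: matrix_mul_assoc[symmetric] assms(2))
  also have "\<dots> = - trace ((S ** R) ** S)"
    by (simp add: assms(1) bilinear_lneg[OF bilinear_matrix_mult] trace_def sum_negf)
  also have "trace ((S ** R) ** S) = trace (S ** (S ** R))" by (rule trace_mul_sym)
  also have "\<dots> = trace R" by (simp add: matrix_mul_assoc assms(2))
  finally show ?thesis by simp
qed

lemma unit_multiple:
  fixes x :: "'a::euclidean_space"
  obtains c y where "y \<bullet> y = 1" "x = c *\<^sub>R y"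
proof (cases "x = 0")
  case True
  obtain b :: 'a where "b \<in> Basis" using nonempty_Basis by blast
  with True show thesis by (intro that[of b 0]) (auto simp: inner_same_Basis)
next
  case False
  then show thesis by (intro that[of "x /\<^sub>R norm x" "norm x"]) (auto simp: dot_square_norm power2_eq_square)
qed

context clifford_sys
begin

text \<open>The spherical distance to the focal manifold M_-, where \<open>h = 1\<close>, by
  \<open>inner_le_cos_ang\<close> and \<open>exists_nearest\<close> below. It runs from 0 on M_- to
  \<open>pi / 4\<close> on M_+.\<close>

definition ang where "ang x = arccos (sqrt (h x)) / 2"

lemma h_le_1: "x \<bullet> x = 1 \<Longrightarrow> h x \<le> 1"
  using h_le[of x] by simp

lemma sqrt_h: "x \<bullet> x = 1 \<Longrightarrow> -1 \<le> sqrt (h x) \<and> 0 \<le> sqrt (h x) \<and> sqrt (h x) \<le> 1"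
  using h_le_1[of x] real_sqrt_ge_zero[OF h_nonneg, of x] by (auto intro: order_trans[of "-1" 0])

lemma cos_ang: "x \<bullet> x = 1 \<Longrightarrow> cos (2 * ang x) = sqrt (h x)"
  using sqrt_h[of x] by (simp add: ang_def cos_arccos)

lemma ang_bounds: "x \<bullet> x = 1 \<Longrightarrow> 0 \<le> ang x \<and> ang x \<le> pi / 4"
  using sqrt_h[of x] arccos_lbound[of "sqrt (h x)"] arccos_le_pi2[of "sqrt (h x)"] by (simp add: ang_def)

lemma h_ang: "x \<bullet> x = 1 \<Longrightarrow> h x = (cos (2 * ang x))\<^sup>2"
  by (simp add: cos_ang)

lemma ang_eqI:
  assumes "0 \<le> \<tau>" "\<tau> \<le> pi / 4" "h y = (cos (2 * \<tau>))\<^sup>2"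
  shows "ang y = \<tau>"
proof -
  have "0 \<le> cos (2 * \<tau>)" using assms by (intro cos_ge_zero) auto
  then show ?thesis using assms by (simp add: ang_def arccos_cos)
qed

text \<open>A great circle normal to the level sets, through the points \<open>u\<close> and
  \<open>v\<close> of M_-. The last condition kills the mixed terms of \<open>H\<close>, so that
  along the whole circle \<open>H\<close> stays a multiple of the single element
  \<open>Q\<close>.\<close>

definition normal_circle where
  "normal_circle Q u v \<longleftrightarrow> Q \<in> W \<and> trace_inner Q Q = 1 \<and> Q *v u = u \<and> Q *v v = - v \<and>
     u \<bullet> u = 1 \<and> v \<bullet> v = 1 \<and> (\<forall>B\<in>W. (B *v u) \<bullet> v = 0)"

lemma normal_circle_point:
  assumes c: "normal_circle Q u v"
  defines "y \<equiv> \<lambda>\<tau>. cos \<tau> *\<^sub>R u + sin \<tau> *\<^sub>R v"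
  shows "y \<tau> \<bullet> y \<sigma> = cos (\<tau> - \<sigma>)" "H (y \<tau>) = cos (2 * \<tau>) *\<^sub>R Q" "h (y \<tau>) = (cos (2 * \<tau>))\<^sup>2"
proof -
  have Q: "Q \<in> W" "trace_inner Q Q = 1" "Q *v u = u" "Q *v v = - v" "u \<bullet> u = 1" "v \<bullet> v = 1"
    and B: "\<And>B. B \<in> W \<Longrightarrow> (B *v u) \<bullet> v = 0" using c by (auto simp: normal_circle_def)
  have uv: "u \<bullet> v = 0" using B[OF Q(1)] Q by simp
  show "y \<tau> \<bullet> y \<sigma> = cos (\<tau> - \<sigma>)"
    using Q uv by (simp add: y_def inner_add_left inner_add_right inner_commute[of v u] cos_diff)
  have "trace_inner A (H (y \<tau>)) = trace_inner A (cos (2 * \<tau>) *\<^sub>R Q)" if A: "A \<in> W" for A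
  proof -
    \<comment> \<open>That is, \<open>H u = Q\<close>, and below \<open>H v = - Q\<close>. Both come
      from moving \<open>Q\<close> past \<open>A\<close> and using that \<open>u\<close> and
      \<open>v\<close> are eigenvectors of \<open>Q\<close>.\<close>
    have "(A *v u) \<bullet> u = trace_inner A Q"
    proof -
      have "(A *v u) \<bullet> u = (A *v (Q *v u)) \<bullet> u" using Q by simp
      also have "\<dots> = 2 * trace_inner A Q - (Q *v (A *v u)) \<bullet> u"
        by (subst anticomm[OF A Q(1)]) (simp add: inner_diff_left Q)
      also have "(Q *v (A *v u)) \<bullet> u = (A *v u) \<bullet> u" using Q by (simp add: W_sym[OF Q(1)])
      finally show ?thesis by simp
    qed
    moreover have "(A *v v) \<bullet> v = - trace_inner A Q"
    proof -
      have "(A *v v) \<bullet> v = - ((A *v (Q *v v)) \<bullet> v)" using Q by (simp add: mv_simps)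
      also have "\<dots> = - (2 * trace_inner A Q) + (Q *v (A *v v)) \<bullet> v"
        by (subst anticomm[OF A Q(1)]) (simp add: inner_diff_left Q)
      also have "(Q *v (A *v v)) \<bullet> v = - ((A *v v) \<bullet> v)" using Q by (simp add: W_sym[OF Q(1)])
      finally show ?thesis by simp
    qed
    moreover have "(A *v v) \<bullet> u = 0" using B[OF A] W_sym[OF A, of u v] by (simp add: inner_commute)
    ultimately show ?thesis
      using B[OF A]
      by (simp add: inner_H2 A y_def mv_simps inner_add_left inner_add_right ti_simps cos_double)
         (simp add: algebra_simps power2_eq_square)
  qed
  from this[of "H (y \<tau>) - cos (2 * \<tau>) *\<^sub>R Q"]
  have "H (y \<tau>) - cos (2 * \<tau>) *\<^sub>R Q = 0" using Q by (intro inner_eq_0_W) (simp_all add: ti_simps)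
  then show e: "H (y \<tau>) = cos (2 * \<tau>) *\<^sub>R Q" by simp
  show "h (y \<tau>) = (cos (2 * \<tau>))\<^sup>2" by (simp add: h_eq_inner e ti_simps Q power2_eq_square)
qed

lemma unit_inner_1_eq:
  fixes x y :: "'a::real_inner"
  assumes "x \<bullet> x = 1" "y \<bullet> y = 1" "x \<bullet> y = 1" shows "x = y"
proof -
  have "(x - y) \<bullet> (x - y) = 0" using assms by (simp add: inner_diff_left inner_diff_right inner_commute[of y x])
  then show ?thesis by simp
qed

text \<open>Write \<open>H x = s *\<^sub>R Q\<close> with \<open>Q\<close> a unit element and split
  \<open>x\<close> along the eigenspaces of \<open>Q\<close>. Since <Q x, x> = s = cos (2 t), the
  two components have norms cos t and sin t, and normalising them gives \<open>u\<close> and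
  \<open>v\<close>.\<close>

lemma normal_circle_through:
  assumes x: "x \<bullet> x = 1"
  obtains Q u v where "normal_circle Q u v" "x = cos (ang x) *\<^sub>R u + sin (ang x) *\<^sub>R v"
proof -
  define s where "s = sqrt (h x)"
  define t where "t = ang x"
  have s: "0 \<le> s" "s \<le> 1" "cos (2 * t) = s" "s * s = h x"
    using sqrt_h[OF x] cos_ang[OF x] by (auto simp: s_def t_def)
  have t: "0 \<le> t" "t \<le> pi / 4" using ang_bounds[OF x] by (auto simp: t_def)
  have ct: "cos t > 0" using t pi_gt_zero by (intro cos_gt_zero_pi) linarith+
  have st: "sin t \<ge> 0" using t pi_gt_zero by (intro sin_ge_zero) linarith+
  have c2: "cos t * cos t = (1 + s) / 2" "sin t * sin t = (1 - s) / 2"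
    using s(3) cos_double_cos[of t] cos_double_sin[of t] by (simp_all add: power2_eq_square)
  \<comment> \<open>On M_+ the element \<open>H x\<close> vanishes and any unit element will
    do.\<close>
  have "\<exists>Q\<in>W. trace_inner Q Q = 1 \<and> H x = s *\<^sub>R Q"
  proof (cases "s = 0")
    case True
    then have "H x = 0" using s h_eq_inner[of x] by (intro inner_eq_0_W) auto
    then show ?thesis using True by (intro bexI[of _ "P 0"]) auto
  next
    case False
    then show ?thesis using s by (intro bexI[of _ "(1 / s) *\<^sub>R H x"]) (auto simp: ti_simps h_eq_inner[symmetric])
  qed
  then obtain Q where Q: "Q \<in> W" "trace_inner Q Q = 1" "H x = s *\<^sub>R Q" by blast
  have Qx: "(Q *v x) \<bullet> x = s" using inner_H2[OF Q(1), of x x] Q by (simp add: ti_simps)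
  have QQ: "Q *v (Q *v y) = y" for y using sq[OF Q(1)] Q by simp
  have Qn: "(Q *v x) \<bullet> (Q *v x) = 1" using norm_mv[OF Q(1)] Q x by simp
  show thesis
  proof (cases "s = 1")
    \<comment> \<open>On M_- the component \<open>v\<close> is absent and can be chosen freely: the
      -1-eigenspace has dimension \<open>l\<close>, more than the m + 1 conditions of orthogonality
      to the \<open>P i *v x\<close>.\<close>
    case True
    then have e: "Q *v x = x" using unit_inner_1_eq[OF Qn x] Qx by simp
    have "card ((\<lambda>i. P i *v x) ` {0..m}) \<le> m + 1"
      using card_image_le[of "{0..m}" "\<lambda>i. P i *v x"] by simp
    also have "m + 1 < dim {v. Q *v v = - v}" using dim_eigenspace(2)[OF Q(1,2)] l_gt m3 by simp
    finally have less: "card ((\<lambda>i. P i *v x) ` {0..m}) < dim {v. Q *v v = - v}" .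
    have sub: "subspace {v. Q *v v = - v}" by (auto simp: subspace_def mv_simps)
    obtain v where v0: "v \<in> {v. Q *v v = - v}" "norm v = 1" "\<And>y. y \<in> (\<lambda>i. P i *v x) ` {0..m} \<Longrightarrow> y \<bullet> v = 0"
      by (rule exists_unit_orthogonal[OF sub _ less]) auto
    then have v: "Q *v v = - v" "norm v = 1" "\<And>i. i \<le> m \<Longrightarrow> (P i *v x) \<bullet> v = 0" by auto
    have "(B *v x) \<bullet> v = 0" if "B \<in> W" for B
      by (subst expand[OF that]) (simp add: mv_simps mv_sum inner_sum_left v)
    then have "normal_circle Q x v" using Q e v x by (auto simp: normal_circle_def norm_eq_1)
    moreover have "t = 0" using True by (simp add: t_def ang_def s_def)
    ultimately show thesis by (intro that[of Q x v]) (auto simp: t_def)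
  next
    case False
    then have "sin t * sin t > 0" using c2 s by simp
    then have st: "sin t > 0" using st by (metis less_eq_real_def mult_zero_left order_less_irrefl)
    define u where "u = (1 / (2 * cos t)) *\<^sub>R (x + Q *v x)"
    define v where "v = (1 / (2 * sin t)) *\<^sub>R (x - Q *v x)"
    \<comment> \<open>The mixed terms cancel by symmetry. The other two agree because <B x, x> = <B,
      H x> is \<open>s\<close> times <B, Q>.\<close>
    have B: "(B *v (x + Q *v x)) \<bullet> (x - Q *v x) = 0" if B: "B \<in> W" for B
    proof -
      have 1: "(B *v (Q *v x)) \<bullet> x = (B *v x) \<bullet> (Q *v x)" 
        by (simp add: W_sym[OF B] inner_commute)
      have "(B *v (Q *v x)) \<bullet> (Q *v x) = (Q *v (B *v (Q *v x))) \<bullet> x" by (simp add: W_sym[OF Q(1)])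
      also have "\<dots> = 2 * trace_inner B Q * s - (B *v x) \<bullet> x"
        by (subst anticomm[OF Q(1) B]) (simp add: inner_diff_left QQ Qx trace_inner_commute)
      finally have 2: "(B *v (Q *v x)) \<bullet> (Q *v x) = (B *v x) \<bullet> x"
        using inner_H2[OF B, of x x] Q(3) by (simp add: ti_simps mult.commute)
      show ?thesis by (simp add: mv_simps inner_add_left inner_diff_right 1 2)
    qed
    have n: "(x + Q *v x) \<bullet> (x + Q *v x) = 2 + 2 * s" "(x - Q *v x) \<bullet> (x - Q *v x) = 2 - 2 * s"
      using Qx Qn x by (simp_all add: inner_add_left inner_add_right inner_diff_left inner_diff_right inner_commute[of x "Q *v x"])
    have "u \<bullet> u = (2 + 2 * s) / (4 * (cos t * cos t))" unfolding u_def by (simp add: n)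
    then have uu: "u \<bullet> u = 1" using s by (simp add: c2)
    have "v \<bullet> v = (2 - 2 * s) / (4 * (sin t * sin t))" unfolding v_def by (simp add: n)
    then have vv: "v \<bullet> v = 1" using s False by (simp add: c2)
    have "Q *v u = u" by (simp add: u_def mv_simps QQ add.commute)
    moreover have "Q *v v = - v" by (simp add: v_def mv_simps QQ scaleR_diff_right)
    moreover have "(A *v u) \<bullet> v = 0" if "A \<in> W" for A
      unfolding u_def v_def mv_simps(7,8) inner_scaleR_left inner_scaleR_right B[OF that] by simp
    ultimately have "normal_circle Q u v"
      using Q uu vv by (auto simp: normal_circle_def)
    moreover have "x = cos t *\<^sub>R u + sin t *\<^sub>R v"
    proof -
      have "cos t *\<^sub>R u = (1 / 2) *\<^sub>R (x + Q *v x)" using ct by (simp add: u_def)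
      moreover have "sin t *\<^sub>R v = (1 / 2) *\<^sub>R (x - Q *v x)" using st by (simp add: v_def)
      moreover have "(1 / 2) *\<^sub>R (x + q) + (1 / 2) *\<^sub>R (x - q) = x" for q
        by (simp add: scaleR_add_right scaleR_diff_right flip: scaleR_add_left)
      ultimately show ?thesis by simp
    qed
    ultimately show thesis by (intro that) (auto simp: t_def)
  qed
qed

text \<open>The difference of \<open>ang\<close> bounds the spherical distance from below. With
  \<open>Q\<close> from the normal circle through \<open>x\<close>, only the components of
  \<open>y\<close> in the two eigenspaces of \<open>Q\<close> matter. Their norms are cos \<tau> and
  sin \<tau> where cos (2 \<tau>) = <Q y, y>, and <Q y, y>^2 is at most \<open>h y\<close>, so
  \<tau> is at least \<open>ang y\<close>. Assuming \<open>h y \<le> h x\<close> first makes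
  \<open>ang y - ang x\<close> nonnegative, where the cosine decreases.\<close>

lemma inner_le_cos_ang:
  assumes "x \<bullet> x = 1" "y \<bullet> y = 1"
  shows "x \<bullet> y \<le> cos (ang x - ang y)"
proof -
  have *: "x \<bullet> y \<le> cos (ang x - ang y)" if x: "x \<bullet> x = 1" and y: "y \<bullet> y = 1" and le: "h y \<le> h x" for x y
  proof -
    obtain Q u v where c: "normal_circle Q u v" and xe: "x = cos (ang x) *\<^sub>R u + sin (ang x) *\<^sub>R v"
      using normal_circle_through[OF x] .
    have Q: "Q \<in> W" "trace_inner Q Q = 1" "Q *v u = u" "Q *v v = - v" "u \<bullet> u = 1" "v \<bullet> v = 1"
      using c by (auto simp: normal_circle_def)
    define t where "t = ang x"
    have t: "0 \<le> t" "t \<le> pi / 4" using ang_bounds[OF x] by (auto simp: t_def)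
    have cs: "0 \<le> cos t" "0 \<le> sin t" using t by (auto intro!: cos_ge_zero sin_ge_zero)
    define \<sigma> where "\<sigma> = (Q *v y) \<bullet> y"
    have "\<sigma>\<^sup>2 \<le> h y" using inner_H_le[OF Q(1,2)] by (simp add: \<sigma>_def)
    then have sig: "\<bar>\<sigma>\<bar> \<le> sqrt (h y)" by (metis real_sqrt_abs real_sqrt_le_mono)
    then have sig1: "-1 \<le> \<sigma>" "\<sigma> \<le> 1" using sqrt_h[OF y] by linarith+
    define \<tau> where "\<tau> = arccos \<sigma> / 2"
    have tau: "0 \<le> \<tau>" "\<tau> \<le> pi / 2" using arccos_bounded[OF sig1] by (auto simp: \<tau>_def)
    have cs': "0 \<le> cos \<tau>" "0 \<le> sin \<tau>" using tau by (auto intro!: cos_ge_zero sin_ge_zero)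
    have c2: "cos (2 * \<tau>) = \<sigma>" using sig1 by (simp add: \<tau>_def)
    have c2': "(cos \<tau>)\<^sup>2 = (1 + \<sigma>) / 2" "(sin \<tau>)\<^sup>2 = (1 - \<sigma>) / 2"
      using c2 cos_double_cos[of \<tau>] cos_double_sin[of \<tau>] by simp_all
    have Qn: "(Q *v y) \<bullet> (Q *v y) = 1" using norm_mv[OF Q(1)] Q y by simp
    have "u \<bullet> (Q *v y) = u \<bullet> y" "v \<bullet> (Q *v y) = - (v \<bullet> y)"
      using W_sym[OF Q(1), of u y] W_sym[OF Q(1), of v y] Q by auto
    then have uy: "4 * (u \<bullet> y)\<^sup>2 = (u \<bullet> (y + Q *v y))\<^sup>2" "4 * (v \<bullet> y)\<^sup>2 = (v \<bullet> (y - Q *v y))\<^sup>2"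
      by (simp_all add: inner_add_right inner_diff_right power2_eq_square)
    have "(u \<bullet> (y + Q *v y))\<^sup>2 \<le> 2 + 2 * \<sigma>"
      using Cauchy_Schwarz_ineq[of u "y + Q *v y"] Q y Qn
      by (simp add: inner_add_left inner_add_right \<sigma>_def inner_commute[of y "Q *v y"])
    then have "(u \<bullet> y)\<^sup>2 \<le> (cos \<tau>)\<^sup>2" using uy c2' by simp
    then have u1: "u \<bullet> y \<le> cos \<tau>" using cs'(1) by (rule power2_le_imp_le)
    have "(v \<bullet> (y - Q *v y))\<^sup>2 \<le> 2 - 2 * \<sigma>"
      using Cauchy_Schwarz_ineq[of v "y - Q *v y"] Q y Qn
      by (simp add: inner_diff_left inner_diff_right \<sigma>_def inner_commute[of y "Q *v y"])
    then have "(v \<bullet> y)\<^sup>2 \<le> (sin \<tau>)\<^sup>2" using uy c2' by simp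
    then have v1: "v \<bullet> y \<le> sin \<tau>" using cs'(2) by (rule power2_le_imp_le)
    have "x \<bullet> y = cos t * (u \<bullet> y) + sin t * (v \<bullet> y)"
      by (subst xe) (simp add: inner_add_left t_def)
    also have "\<dots> \<le> cos t * cos \<tau> + sin t * sin \<tau>"
      using u1 v1 cs by (intro add_mono mult_left_mono) auto
    also have "\<dots> = cos (\<tau> - t)" by (simp add: cos_diff mult.commute)
    also have "\<dots> \<le> cos (ang y - t)"
    proof (rule cos_monotone_0_pi_le)
      show "0 \<le> ang y - t"
        using arccos_le_mono[of "sqrt (h x)" "sqrt (h y)"] sqrt_h[OF x] sqrt_h[OF y] le
        by (simp add: t_def ang_def)
      show "ang y - t \<le> \<tau> - t"
        using arccos_le_mono[of "sqrt (h y)" \<sigma>] sqrt_h[OF y] sig sig1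
        by (simp add: \<tau>_def ang_def)
      show "\<tau> - t \<le> pi" using tau t pi_gt_zero by linarith
    qed
    finally show ?thesis by (simp add: t_def cos_diff mult.commute)
  qed
  show ?thesis
  proof (cases "h y \<le> h x")
    case False
    then show ?thesis using *[of y x] assms by (simp add: inner_commute cos_diff mult.commute)
  qed (use * assms in blast)
qed

text \<open>Moving along the normal circle through \<open>x\<close> to the parameter \<tau> attains
  equality in \<open>inner_le_cos_ang\<close>.\<close>

lemma exists_nearest:
  assumes x: "x \<bullet> x = 1" and "0 \<le> \<tau>" "\<tau> \<le> pi / 4"
  obtains y where "y \<bullet> y = 1" "ang y = \<tau>" "x \<bullet> y = cos (ang x - \<tau>)"
proof -
  obtain Q u v where c: "normal_circle Q u v" and xe: "x = cos (ang x) *\<^sub>R u + sin (ang x) *\<^sub>R v"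
    using normal_circle_through[OF x] .
  define y where "y = cos \<tau> *\<^sub>R u + sin \<tau> *\<^sub>R v"
  show thesis
  proof (rule that)
    show "y \<bullet> y = 1" using normal_circle_point(1)[OF c, of \<tau> \<tau>] by (simp add: y_def)
    show "ang y = \<tau>" using normal_circle_point(3)[OF c, of \<tau>] assms(2,3) by (intro ang_eqI) (auto simp: y_def)
    show "x \<bullet> y = cos (ang x - \<tau>)"
      using normal_circle_point(1)[OF c, of "ang x" \<tau>] xe by (simp add: y_def)
  qed
qed

section \<open>Isometries preserving a single level set\<close>

definition tube where "tube \<tau> = {x. x \<bullet> x = 1 \<and> ang x = \<tau>}"

text \<open>Both sides are the distance to the tube, of \<open>A *v x\<close> and of
  \<open>x\<close>. Comparing nearest points in either direction gives the two inequalities between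
  cosines.\<close>

lemma ang_diff_invariant:
  assumes A: "orthogonal_matrix A" "(*v) A ` tube \<tau> = tube \<tau>" and t: "0 \<le> \<tau>" "\<tau> \<le> pi / 4"
    and x: "x \<bullet> x = 1"
  shows "\<bar>ang (A *v x) - \<tau>\<bar> = \<bar>ang x - \<tau>\<bar>"
proof -
  note inn = orthogonal_matrix_inner[OF A(1)]
  have Ax: "(A *v x) \<bullet> (A *v x) = 1" using x by (simp add: inn)
  obtain y where y: "y \<bullet> y = 1" "ang y = \<tau>" "x \<bullet> y = cos (ang x - \<tau>)"
    using exists_nearest[OF x t] .
  then have "A *v y \<in> tube \<tau>" using A(2) by (auto simp: tube_def)
  then have 1: "cos (ang x - \<tau>) \<le> cos (ang (A *v x) - \<tau>)"
    using inner_le_cos_ang[OF Ax, of "A *v y"] y inn by (simp add: tube_def)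
  obtain z where z: "z \<bullet> z = 1" "ang z = \<tau>" "(A *v x) \<bullet> z = cos (ang (A *v x) - \<tau>)"
    using exists_nearest[OF Ax t] .
  then have "z \<in> (*v) A ` tube \<tau>" unfolding A(2) by (simp add: tube_def)
  then obtain y where y: "z = A *v y" "y \<in> tube \<tau>" by blast
  have 2: "cos (ang (A *v x) - \<tau>) \<le> cos (ang x - \<tau>)"
    using inner_le_cos_ang[OF x, of y] y z inn by (simp add: tube_def)
  have "cos \<bar>ang (A *v x) - \<tau>\<bar> = cos \<bar>ang x - \<tau>\<bar>" using 1 2 by simp
  moreover have "\<bar>ang (A *v x) - \<tau>\<bar> \<le> pi" "\<bar>ang x - \<tau>\<bar> \<le> pi"
    using ang_bounds[OF x] ang_bounds[OF Ax] t by linarith+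
  ultimately show ?thesis by (metis abs_ge_zero cos_inj_pi)
qed

text \<open>All values of \<open>ang\<close> lie on one side of an extreme \<tau>, so there the
  distance to the tube determines \<open>ang\<close> itself.\<close>

lemma ang_invariant_of_extreme:
  assumes A: "orthogonal_matrix A" and ex: "\<tau> = 0 \<or> \<tau> = pi / 4"
    and inv: "\<And>x. x \<bullet> x = 1 \<Longrightarrow> ang (A *v x) = \<tau> \<longleftrightarrow> ang x = \<tau>" and x: "x \<bullet> x = 1"
  shows "ang (A *v x) = ang x"
proof -
  have t: "0 \<le> \<tau>" "\<tau> \<le> pi / 4" using ex pi_ge_zero by (elim disjE; linarith)+
  have "(*v) A ` tube \<tau> = tube \<tau>"
  proof (intro equalityI subsetI)
    fix y assume "y \<in> tube \<tau>"
    then have y: "y \<bullet> y = 1" "ang y = \<tau>" by (auto simp: tube_def)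
    define z where "z = transpose A *v y"
    have e: "A *v z = y" by (simp add: z_def orthogonal_matrix_cancel[OF A])
    then have "z \<bullet> z = 1" using y orthogonal_matrix_inner[OF A, of z z] by simp
    then have "z \<in> tube \<tau>" using inv[of z] e y by (auto simp: tube_def)
    then show "y \<in> (*v) A ` tube \<tau>" using e by blast
  next
    fix y assume "y \<in> (*v) A ` tube \<tau>"
    then obtain z where z: "z \<bullet> z = 1" "ang z = \<tau>" "y = A *v z" by (auto simp: tube_def)
    then show "y \<in> tube \<tau>" using inv[of z] orthogonal_matrix_inner[OF A, of z z] by (simp add: tube_def)
  qed
  then have "\<bar>ang (A *v x) - \<tau>\<bar> = \<bar>ang x - \<tau>\<bar>"
    by (rule ang_diff_invariant[OF A _ t x])
  then show ?thesis
    using ang_bounds[OF x] ang_bounds[of "A *v x"] orthogonal_matrix_inner[OF A, of x x] x ex by auto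
qed

section \<open>Excluding the exchange of the two focal manifolds\<close>

lemma h_homogeneous: "h (c *\<^sub>R x) = c ^ 4 * h x"
  by (simp add: h_def mv_simps sum_distrib_left power2_eq_square algebra_simps power4_eq_xxxx)

lemma h_line_poly: "\<exists>p. \<forall>s. poly p s = h (A *v (x + s *\<^sub>R y))"
proof (intro exI allI)
  fix s
  let ?q = "\<lambda>i. [:(P i *v (A *v x)) \<bullet> (A *v x), (P i *v (A *v x)) \<bullet> (A *v y) + (P i *v (A *v y)) \<bullet> (A *v x), (P i *v (A *v y)) \<bullet> (A *v y):]"
  show "poly (\<Sum>i=0..m. (?q i)\<^sup>2) s = h (A *v (x + s *\<^sub>R y))"
    by (simp add: h_def poly_sum poly_power mv_simps inner_add_left inner_add_right algebra_simps)
qed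

text \<open>The pointwise alternative becomes a global one because both options are polynomial. On
  the line joining a counterexample to each, a product of two polynomials vanishes identically, so
  one factor is zero, contradicting the choice of the end point at \<open>s = 0\<close> or
  \<open>s = 1\<close>.\<close>

lemma h_dichotomy:
  assumes "\<And>x. h (A *v x) = h x \<or> h (A *v x) = (x \<bullet> x)\<^sup>2 - h x"
  shows "(\<forall>x. h (A *v x) = h x) \<or> (\<forall>x. h (A *v x) = (x \<bullet> x)\<^sup>2 - h x)"
proof (rule ccontr)
  assume "\<not> ?thesis"
  then obtain x y where x: "h (A *v x) \<noteq> h x" and y: "h (A *v y) \<noteq> (y \<bullet> y)\<^sup>2 - h y" by blast
  obtain p where p: "\<And>s. poly p s = h (A *v (x + s *\<^sub>R (y - x)))" using h_line_poly[of A x "y - x"] by blast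
  obtain q where q: "\<And>s. poly q s = h (x + s *\<^sub>R (y - x))" using h_line_poly[of "mat 1" x "y - x"] by auto
  define r where "r = [:x \<bullet> x, 2 * (x \<bullet> (y - x)), (y - x) \<bullet> (y - x):]"
  have r: "poly r s = (x + s *\<^sub>R (y - x)) \<bullet> (x + s *\<^sub>R (y - x))" for s
    by (simp add: r_def inner_add_left inner_add_right inner_commute[of "y - x" x])
      (simp add: algebra_simps)
  have "poly ((p - q) * (p - (r\<^sup>2 - q))) s = 0" for s
    using assms[of "x + s *\<^sub>R (y - x)"] by (auto simp: p q r)
  then have "(p - q) * (p - (r\<^sup>2 - q)) = 0" using poly_all_0_iff_0 by blast
  then consider "p = q" | "p = r\<^sup>2 - q" by auto
  then show False
  proof cases
    case 1
    then show False using p[of 0] q[of 0] x by simp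
  next
    case 2
    then have "poly p 1 = (poly r 1)\<^sup>2 - poly q 1" by simp
    then show False using p[of 1] q[of 1] r[of 1] y by simp
  qed
qed

text \<open>The Laplacian of the quartic form \<open>\<Sum>i. \<langle>R\<^sub>i x, x\<rangle>\<^sup>2\<close>, as a second difference.\<close>
lemma second_difference_sum:
  fixes R :: "nat \<Rightarrow> real^'n^'n"
  assumes sym: "\<And>i x y. i \<le> m \<Longrightarrow> (R i *v x) \<bullet> y = x \<bullet> (R i *v y)"
    and sqr: "\<And>i x. i \<le> m \<Longrightarrow> R i *v (R i *v x) = x"
    and tr: "\<And>i. i \<le> m \<Longrightarrow> trace (R i) = 0"
  defines "k \<equiv> \<lambda>x. \<Sum>i=0..m. ((R i *v x) \<bullet> x)\<^sup>2"
  shows "(\<Sum>e\<in>Basis. k (x + e) + k (x - e) - 2 * k x - 2 * k e) = 8 * real (m + 1) * (x \<bullet> x)"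
proof -
  \<comment> \<open>For a quartic form the second difference in direction \<open>e\<close> is the
    second derivative plus \<open>2 * k e\<close>; subtracting the latter leaves the exact
    derivative. Summed over a basis, the last term contributes the trace of \<open>R i\<close>,
    which is 0.\<close>
  have pt: "k (x + e) + k (x - e) - 2 * k x - 2 * k e =
      (\<Sum>i=0..m. 8 * ((R i *v x) \<bullet> e)\<^sup>2 + 4 * ((R i *v x) \<bullet> x) * ((R i *v e) \<bullet> e))" for e
  proof -
    have "((R i *v (x + e)) \<bullet> (x + e))\<^sup>2 + ((R i *v (x - e)) \<bullet> (x - e))\<^sup>2 - 2 * ((R i *v x) \<bullet> x)\<^sup>2 - 2 * ((R i *v e) \<bullet> e)\<^sup>2
       = 8 * ((R i *v x) \<bullet> e)\<^sup>2 + 4 * ((R i *v x) \<bullet> x) * ((R i *v e) \<bullet> e)" if "i \<le> m" for i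
    proof -
      have e: "(R i *v e) \<bullet> x = (R i *v x) \<bullet> e" using sym[OF that, of e x] by (simp add: inner_commute)
      show ?thesis by (simp add: mv_simps inner_add_left inner_add_right inner_diff_left inner_diff_right e)
          (simp add: power2_eq_square algebra_simps)
    qed
    then show ?thesis
      unfolding k_def sum_distrib_left sum.distrib[symmetric] sum_subtractf[symmetric] by (intro sum.cong) auto
  qed
  have 1: "(\<Sum>e\<in>Basis. ((R i *v x) \<bullet> e)\<^sup>2) = x \<bullet> x" if "i \<le> m" for i
  proof -
    have "(\<Sum>e\<in>Basis. ((R i *v x) \<bullet> e)\<^sup>2) = (R i *v x) \<bullet> (R i *v x)"
      by (subst euclidean_inner) (simp add: power2_eq_square)
    then show ?thesis using sym[OF that] sqr[OF that] by simp
  qed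
  have "(\<Sum>e\<in>Basis. k (x + e) + k (x - e) - 2 * k x - 2 * k e) =
     (\<Sum>i=0..m. 8 * (\<Sum>e\<in>Basis. ((R i *v x) \<bullet> e)\<^sup>2) + 4 * ((R i *v x) \<bullet> x) * (\<Sum>e\<in>Basis. (R i *v e) \<bullet> e))"
    unfolding pt by (subst sum.swap) (simp add: sum.distrib sum_distrib_left)
  also have "\<dots> = (\<Sum>i=0..m. 8 * (x \<bullet> x))"
    by (intro sum.cong) (auto simp: 1 sum_Basis_trace tr)
  finally show ?thesis by simp
qed

lemma P_mat:
  assumes "i \<le> m" "j \<le> m"
  shows "P i ** P i = mat 1" "i \<noteq> j \<Longrightarrow> P i ** P j = - (P j ** P i)"
proof -
  show "P i ** P i = mat 1"
    using assms by (simp add: matrix_eq matrix_vector_mul_assoc[symmetric])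
  show "P i ** P j = - (P j ** P i)" if "i \<noteq> j"
    using anticommutator[of "P i" "P j"] that assms by (simp add: eq_neg_iff_add_eq_0)
qed

text \<open>Composing \<open>h\<close> with \<open>A\<close> replaces the \<open>P i\<close> by
  conjugates that are again traceless symmetric involutions, so the Laplacian is unchanged. The flip
  would make that of |x|^4 twice as large, and at a unit vector 16 (m + 1) = 8 + 8 l forces
  \<open>l\<close> to be odd.\<close>

lemma no_flip:
  assumes A: "orthogonal_matrix A" and flip: "\<And>x. h (A *v x) = (x \<bullet> x)\<^sup>2 - h x"
  shows False
proof -
  define R where "R i = transpose A ** P i ** A" for i
  have R: "R i *v x = transpose A *v (P i *v (A *v x))" for i x
    by (simp add: R_def matrix_vector_mul_assoc matrix_mul_assoc)
  have AA: "A ** transpose A = mat 1" using A by (simp add: orthogonal_matrix_def)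
  have RR: "R i ** R j = transpose A ** (P i ** P j) ** A" for i j
  proof -
    have "R i ** R j = transpose A ** P i ** (A ** transpose A) ** P j ** A"
      by (simp only: R_def matrix_mul_assoc)
    then show ?thesis by (simp only: AA matrix_mul_rid matrix_mul_assoc)
  qed
  have trR: "trace (R i) = 0" if "i \<le> m" for i
  proof -
    obtain j where j: "j \<le> m" "j \<noteq> i" using m3 by (metis le0 le_trans one_le_numeral zero_neq_one)
    show ?thesis
    proof (rule trace_eq_0_of_anticommute)
      show "R i ** R j = - (R j ** R i)"
        unfolding RR P_mat(2)[OF that j(1) j(2)[symmetric]]
        by (simp add: matrix_eq mv_simps matrix_vector_mul_assoc[symmetric])
      show "R j ** R j = mat 1"
        unfolding RR P_mat(1)[OF j(1) j(1)] using A by (simp add: orthogonal_matrix_def)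
    qed
  qed
  have trP: "trace (P i) = 0" if "i \<le> m" for i
  proof -
    obtain j where j: "j \<le> m" "j \<noteq> i" using m3 by (metis le0 le_trans one_le_numeral zero_neq_one)
    show ?thesis using trace_eq_0_of_anticommute P_mat that j by metis
  qed
  note canc = orthogonal_matrix_cancel[OF A]
  have At: "(transpose A *v x) \<bullet> y = x \<bullet> (A *v y)" for x y
    using matrix_vector_inner_transpose[of A y x] by (simp add: inner_commute)
  have hR: "h (A *v x) = (\<Sum>i=0..m. ((R i *v x) \<bullet> x)\<^sup>2)" for x
    by (simp add: h_def R At)
  obtain x :: "real^'n" where x: "x \<bullet> x = 1" using norm_Basis[of "axis undefined 1 :: real^'n"] by (metis inner_same_Basis nonempty_Basis all_not_in_conv)
  have 1: "(\<Sum>e\<in>Basis. h (A *v (x + e)) + h (A *v (x - e)) - 2 * h (A *v x) - 2 * h (A *v e)) = 8 * real (m + 1) * (x \<bullet> x)"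
    unfolding hR
  proof (rule second_difference_sum)
    show "(R i *v x) \<bullet> y = x \<bullet> (R i *v y)" if "i \<le> m" for i x y
    proof -
      have "(R i *v x) \<bullet> y = (A *v x) \<bullet> (P i *v (A *v y))"
        using that by (simp add: R At W_sym)
      also have "\<dots> = x \<bullet> (R i *v y)"
        using At[of "P i *v (A *v y)" x] by (simp add: R inner_commute)
      finally show ?thesis .
    qed
  qed (auto simp: R canc trR)
  have 2: "(\<Sum>e\<in>Basis. h (x + e) + h (x - e) - 2 * h x - 2 * h e) = 8 * real (m + 1) * (x \<bullet> x)"
    unfolding h_def by (rule second_difference_sum) (auto simp: W_sym trP)
  have "(\<Sum>e\<in>Basis. h (A *v (x + e)) + h (A *v (x - e)) - 2 * h (A *v x) - 2 * h (A *v e)) =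
     (\<Sum>e\<in>Basis. 8 * (x \<bullet> e)\<^sup>2 + 4 - (h (x + e) + h (x - e) - 2 * h x - 2 * h e))"
  proof (rule sum.cong[OF refl])
    fix e :: "real^'n" assume e: "e \<in> Basis"
    \<comment> \<open>The corresponding second difference of |x|^4, for unit vectors
      \<open>x\<close> and \<open>e\<close>.\<close>
    have "((x + e) \<bullet> (x + e))\<^sup>2 + ((x - e) \<bullet> (x - e))\<^sup>2 - 2 * (x \<bullet> x)\<^sup>2 - 2 * (e \<bullet> e)\<^sup>2 = 8 * (x \<bullet> e)\<^sup>2 + 4"
      using e x by (simp add: inner_add_left inner_add_right inner_diff_left inner_diff_right inner_commute[of e x])
         (simp add: power2_eq_square algebra_simps)
    then show "h (A *v (x + e)) + h (A *v (x - e)) - 2 * h (A *v x) - 2 * h (A *v e) =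
       8 * (x \<bullet> e)\<^sup>2 + 4 - (h (x + e) + h (x - e) - 2 * h x - 2 * h e)"
      unfolding flip by argo
  qed
  also have "\<dots> = (\<Sum>e\<in>Basis. 8 * (x \<bullet> e)\<^sup>2 + 4) - (\<Sum>e\<in>Basis. h (x + e) + h (x - e) - 2 * h x - 2 * h e)"
    by (rule sum_subtractf)
  also have "\<dots> = 8 * (\<Sum>e\<in>Basis. (x \<bullet> e)\<^sup>2) + 4 * (2 * real l) - 8 * real (m + 1) * (x \<bullet> x)"
    unfolding 2 sum.distrib sum_distrib_left using card_n by simp
  also have "(\<Sum>e\<in>Basis. (x \<bullet> e)\<^sup>2) = x \<bullet> x"
    using euclidean_inner[of x x] by (simp add: power2_eq_square)
  finally have "2 * (m + 1) = l + 1" using 1 x by simp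
  then show False using four_dvd_l by presburger
qed

text \<open>Off the middle value, the distance to the tube is largest exactly on the farther focal
  manifold, which is therefore preserved, and \<open>ang_invariant_of_extreme\<close> applies. At
  \<open>\<tau> = pi / 8\<close> the reflection of \<open>ang\<close> in \<tau> remains possible
  pointwise; it exchanges \<open>h\<close> with 1 - h and is excluded by \<open>h_dichotomy\<close>
  and \<open>no_flip\<close>.\<close>

lemma h_invariant_of_tube:
  assumes A: "orthogonal_matrix A" "(*v) A ` tube \<tau> = tube \<tau>" and t: "0 \<le> \<tau>" "\<tau> \<le> pi / 4"
  shows "h (A *v x) = h x"
proof -
  have inn: "(A *v x) \<bullet> (A *v y) = x \<bullet> y" for x y by (rule orthogonal_matrix_inner[OF A(1)])
  have d: "\<bar>ang (A *v x) - \<tau>\<bar> = \<bar>ang x - \<tau>\<bar>" "0 \<le> ang x" "ang x \<le> pi / 4" "0 \<le> ang (A *v x)" "ang (A *v x) \<le> pi / 4"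
    if "x \<bullet> x = 1" for x
    using ang_diff_invariant[OF A t that] ang_bounds[OF that] ang_bounds[of "A *v x"] inn[of x x] that by auto
  have scale: "\<forall>x. h (A *v x) = h x \<or> h (A *v x) = (x \<bullet> x)\<^sup>2 - h x"
    if *: "\<And>x. x \<bullet> x = 1 \<Longrightarrow> h (A *v x) = h x \<or> h (A *v x) = 1 - h x"
  proof
    fix x :: "real^'n"
    obtain c y where y: "y \<bullet> y = 1" "x = c *\<^sub>R y" using unit_multiple .
    have "h x = c ^ 4 * h y" "h (A *v x) = c ^ 4 * h (A *v y)" "(x \<bullet> x)\<^sup>2 = c ^ 4"
      using y by (simp_all add: h_homogeneous mv_simps power2_eq_square power4_eq_xxxx)
    then show "h (A *v x) = h x \<or> h (A *v x) = (x \<bullet> x)\<^sup>2 - h x"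
      using *[OF y(1)] by (elim disjE) (simp_all add: right_diff_distrib)
  qed
  have scale': "h (A *v x) = h x" if *: "\<And>x. x \<bullet> x = 1 \<Longrightarrow> h (A *v x) = h x" for x
  proof -
    obtain c y where y: "y \<bullet> y = 1" "x = c *\<^sub>R y" using unit_multiple .
    then show ?thesis using *[OF y(1)] by (simp add: h_homogeneous mv_simps)
  qed
  consider "\<tau> < pi / 8" | "\<tau> > pi / 8" | "\<tau> = pi / 8" by linarith
  then show ?thesis
  proof cases
    case 1
    have "ang (A *v x) = ang x" if "x \<bullet> x = 1" for x
      by (rule ang_invariant_of_extreme[OF A(1) _ _ that, of "pi / 4"]) (use d 1 t in \<open>force simp: abs_if split: if_splits\<close>)+
    then have u: "h (A *v x) = h x" if "x \<bullet> x = 1" for x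
      using that inn[of x x] by (simp add: h_ang)
    then show ?thesis by (rule scale')
  next
    case 2
    have "ang (A *v x) = ang x" if "x \<bullet> x = 1" for x
      by (rule ang_invariant_of_extreme[OF A(1) _ _ that, of "0"]) (use d 2 t in \<open>force simp: abs_if split: if_splits\<close>)+
    then have u: "h (A *v x) = h x" if "x \<bullet> x = 1" for x
      using that inn[of x x] by (simp add: h_ang)
    then show ?thesis by (rule scale')
  next
    case 3
    have "h (A *v x) = h x \<or> h (A *v x) = 1 - h x" if x: "x \<bullet> x = 1" for x
    proof -
      have "ang (A *v x) = ang x \<or> ang (A *v x) = pi / 4 - ang x"
        using d(1)[OF x] 3 by (auto simp: abs_if split: if_splits)
      then show ?thesis
      proof
        assume "ang (A *v x) = pi / 4 - ang x"
        then have e: "2 * ang (A *v x) = pi / 2 - 2 * ang x" by simp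
        have "h (A *v x) = (cos (pi / 2 - 2 * ang x))\<^sup>2"
          using h_ang[of "A *v x"] inn[of x x] x unfolding e by simp
        also have "\<dots> = 1 - (cos (2 * ang x))\<^sup>2" by (simp add: cos_diff sin_squared_eq)
        finally show ?thesis using h_ang[OF x] by simp
      qed (use x inn[of x x] in \<open>simp add: h_ang\<close>)
    qed
    then have "(\<forall>x. h (A *v x) = h x) \<or> (\<forall>x. h (A *v x) = (x \<bullet> x)\<^sup>2 - h x)"
      using scale by (intro h_dichotomy) blast
    then show ?thesis using no_flip[OF A(1)] by blast
  qed
qed

end

subsection \<open>Isometries preserving the family\<close>

context clifford_sys
begin

lemma H2_add_left: "H2 (x + y) z = H2 x z + H2 y z"
  by (simp add: H2_def mv_simps inner_add_left scaleR_add_left sum.distrib)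

lemma H2_scaleR_left: "H2 (c *\<^sub>R x) y = c *\<^sub>R H2 x y"
  by (simp add: H2_def mv_simps scaleR_sum_right)

lemma H2_add_right: "H2 z (x + y) = H2 z x + H2 z y"
  using H2_add_left by (metis H2_commute)

lemma H2_scaleR_right: "H2 x (c *\<^sub>R y) = c *\<^sub>R H2 x y"
  using H2_scaleR_left by (metis H2_commute)

lemma H2_eq_0: "(\<And>i. i \<le> m \<Longrightarrow> (P i *v x) \<bullet> y = 0) \<Longrightarrow> H2 x y = 0"
  by (simp add: H2_def)

definition stable where "stable A \<longleftrightarrow> orthogonal_matrix A \<and> (\<forall>x. h (A *v x) = h x)"

lemma stable_transpose:
  assumes "stable A" shows "stable (transpose A)"
  using assms orthogonal_matrix_cancel unfolding stable_def
  by (metis orthogonal_matrix_transpose)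

text \<open>The conjugate \<open>R\<close> is a symmetric involution with an
  \<open>l\<close>-dimensional +1-eigenspace \<open>E\<close>, and every unit vector
  \<open>x\<close> of \<open>E\<close> is fixed by the unit element \<open>H x\<close> of
  \<open>W\<close>. Once \<open>H\<close> is shown to be constant on the unit sphere of
  \<open>E\<close>, its value \<open>S\<close> has the same +1-eigenspace as \<open>R\<close> and
  hence equals it.\<close>

lemma stable_conj_unit:
  assumes A: "stable A" and Q: "Q \<in> W" "trace_inner Q Q = 1"
  shows "transpose A ** Q ** A \<in> W"
proof -
  have oA: "orthogonal_matrix A" and hA: "\<And>x. h (A *v x) = h x" using A by (auto simp: stable_def)
  note canc = orthogonal_matrix_cancel[OF oA] and inn = orthogonal_matrix_inner[OF oA]
  have At: "(transpose A *v x) \<bullet> y = x \<bullet> (A *v y)" for x y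
    using matrix_vector_inner_transpose[of A y x] by (simp add: inner_commute)
  define R where "R = transpose A ** Q ** A"
  have R: "R *v x = transpose A *v (Q *v (A *v x))" for x
    by (simp add: R_def matrix_vector_mul_assoc matrix_mul_assoc)
  have RR: "R *v (R *v x) = x" for x
    by (simp add: R canc sq[OF Q(1)] Q(2))
  have Rsym: "(R *v x) \<bullet> y = x \<bullet> (R *v y)" for x y
  proof -
    have "(R *v x) \<bullet> y = (A *v x) \<bullet> (Q *v (A *v y))" by (simp add: R At W_sym[OF Q(1)])
    also have "\<dots> = x \<bullet> (R *v y)" using At[of "Q *v (A *v y)" x] by (simp add: R inner_commute)
    finally show ?thesis .
  qed
  define E where "E = {x. R *v x = x}"
  have sE: "subspace E" by (auto simp: E_def subspace_def mv_simps)
  have "E = (*v) (transpose A) ` {x. Q *v x = x}"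
  proof (intro equalityI subsetI)
    fix x assume "x \<in> E"
    then have "Q *v (A *v x) = A *v x" using canc(1)[of "Q *v (A *v x)"] by (simp add: E_def R)
    then show "x \<in> (*v) (transpose A) ` {x. Q *v x = x}" using canc(2)[of x] by (intro image_eqI[of _ _ "A *v x"]) auto
  qed (auto simp: E_def R canc)
  moreover have "inj ((*v) (transpose A))" by (metis injI canc(1))
  ultimately have dE: "dim E = l"
    using dim_image_eq[of "(*v) (transpose A)" "{x. Q *v x = x}"] dim_eigenspace(1)[OF Q]
    by (simp add: inj_on_subset)
  \<comment> \<open>\<open>Q\<close> fixes \<open>A *v x\<close>, so \<open>h\<close> takes its
    maximum 1 there and hence at \<open>x\<close>; equality in Cauchy-Schwarz then makes
    \<open>H x\<close> fix \<open>x\<close>.\<close>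
  have u: "trace_inner (H x) (H x) = 1 \<and> H x *v x = x" if x: "x \<in> E" "x \<bullet> x = 1" for x
  proof -
    have e: "Q *v (A *v x) = A *v x" using x canc(1)[of "Q *v (A *v x)"] by (simp add: E_def R)
    have "1 \<le> h (A *v x)" using inner_H_le[OF Q, of "A *v x"] x by (simp add: e inn)
    then have h1: "h x = 1" using h_le_1[OF x(2)] hA by simp
    have "H x *v x = x"
    proof (rule unit_inner_1_eq)
      show "(H x *v x) \<bullet> (H x *v x) = 1" using norm_mv[of "H x" x x] h_eq_inner[of x] h1 x by simp
      show "(H x *v x) \<bullet> x = 1" using h_eq[of x] h1 by simp
    qed (rule x)
    then show ?thesis using h1 h_eq_inner[of x] by simp
  qed
  define V where "V x = {y \<in> E. H x *v y = y}" for x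
  have sV: "subspace (V x)" for x using sE by (auto simp: V_def subspace_def mv_simps)
  have dV: "l \<le> dim (V x) + m" if x: "x \<in> E" "x \<bullet> x = 1" for x
  proof -
    define K where "K = {y \<in> E. \<forall>z\<in>(\<lambda>i. P i *v x) ` {0..m}. z \<bullet> y = 0}"
    have sK: "subspace K" using sE by (auto simp: K_def subspace_def inner_add_right)
    have K0: "H2 x y = 0" if "y \<in> K" for y using that by (intro H2_eq_0) (auto simp: K_def)
    have Kx: "x \<bullet> y = 0" if "y \<in> K" for y
      using inner_H2[OF H2_in_W[of x x], of x y] K0[OF that] u[OF x] by (simp add: ti_simps)
    have KV: "y \<in> V x" if y: "y \<in> K" "y \<bullet> y = 1" for y
    proof -
      have yE: "y \<in> E" using y by (simp add: K_def)
      \<comment> \<open>\<open>H z\<close> is the midpoint of the unit elements \<open>H x\<close>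
        and \<open>H y\<close> and is itself of unit length, which forces the two to
        coincide.\<close>
      define z where "z = (1 / sqrt 2) *\<^sub>R (x + y)"
      have zE: "z \<in> E" unfolding z_def using sE x yE by (simp add: subspace_add subspace_scale)
      have "z \<bullet> z = 1"
        using x y Kx[OF y(1)] by (simp add: z_def inner_add_left inner_add_right inner_commute[of y x])
      then have "trace_inner (H z) (H z) = 1" using u[OF zE] by simp
      moreover have "H z = (1 / 2) *\<^sub>R (H x + H y)"
        using K0[OF y(1)] H2_commute[of x y]
        by (simp add: z_def H2_add_left H2_add_right H2_scaleR_left H2_scaleR_right flip: scaleR_add_right)
      ultimately have "(1 + trace_inner (H x) (H y)) / 2 + (trace_inner (H x) (H y) + 1) / 2 = 2"
        using u[OF x] u[OF yE y(2)] by (simp add: ti_simps trace_inner_commute[of "H y" "H x"])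
      moreover have "t = 1" if "(1 + t) / 2 + (t + 1) / 2 = 2" for t :: real
        using that by (simp add: field_simps)
      ultimately have "trace_inner (H x) (H y) = 1" by blast
      then have "H x = H y" using u[OF x] u[OF yE y(2)] by (intro inner_1_eq) auto
      then show ?thesis using u[OF yE y(2)] yE by (simp add: V_def)
    qed
    have KV: "K \<subseteq> V x"
    proof
      fix y assume y: "y \<in> K"
      show "y \<in> V x"
      proof (cases "y = 0")
        case True
        then show ?thesis using sV by (simp add: subspace_0)
      next
        case False
        have "y /\<^sub>R norm y \<in> V x"
          using KV[of "y /\<^sub>R norm y"] y False sK by (simp add: subspace_scale dot_square_norm power2_eq_square)
        then have "norm y *\<^sub>R (y /\<^sub>R norm y) \<in> V x" using sV subspace_scale by blast
        then show ?thesis using False by simp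
      qed
    qed
    \<comment> \<open>\<open>K\<close> accounts for l - m - 1 dimensions of \<open>V x\<close>. The
      vector \<open>x\<close> itself adds one more, which brings the bound to l - m.\<close>
    have "x \<notin> span K" using Kx[of x] x sK by (auto simp: span_eq_iff[THEN iffD2])
    then have "dim K + 1 = dim (insert x K)" by (simp add: dim_insert)
    also have "\<dots> \<le> dim (V x)"
      using KV x u[OF x] by (intro dim_subset) (auto simp: V_def)
    finally have "dim K + 1 \<le> dim (V x)" .
    moreover have "card ((\<lambda>i. P i *v x) ` {0..m}) \<le> m + 1"
      using card_image_le[of "{0..m}" "\<lambda>i. P i *v x"] by simp
    ultimately show ?thesis
      using dim_orthogonal_ge[OF sE, of "(\<lambda>i. P i *v x) ` {0..m}"] dE unfolding K_def by simp
  qed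
  text \<open>Fibres of \<open>H\<close> on the unit sphere of \<open>E\<close> are great subspheres of dimension at least
    \<open>l - m - 1\<close>; as \<open>l > 2 * m\<close>, two of them meet.\<close>
  have const: "H x = H y" if x: "x \<in> E" "x \<bullet> x = 1" and y: "y \<in> E" "y \<bullet> y = 1" for x y
  proof (rule ccontr)
    assume ne: "H x \<noteq> H y"
    have "z = 0" if z: "z \<in> V x \<inter> V y" for z
    proof (rule ccontr)
      assume "z \<noteq> 0"
      define w where "w = z /\<^sub>R norm z"
      have w: "w \<bullet> w = 1" using \<open>z \<noteq> 0\<close> by (simp add: w_def dot_square_norm power2_eq_square)
      have wV: "w \<in> V x" "w \<in> V y" using z sV by (auto simp: w_def subspace_scale)
      then have wE: "w \<in> E" by (simp add: V_def)
      have "H a = H w" if "w \<in> V a" "a \<in> E" "a \<bullet> a = 1" for a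
        using that u[OF that(2,3)] u[OF wE w] w
        by (intro inner_1_eq) (auto simp: inner_H2 V_def)
      then show False using ne wV x y by metis
    qed
    then have "V x \<inter> V y = {0}" using sV subspace_0 by blast
    then have "dim {a + b |a b. a \<in> V x \<and> b \<in> V y} = dim (V x) + dim (V y)"
      using dim_sums_Int[OF sV sV, of x y] by simp
    moreover have "dim {a + b |a b. a \<in> V x \<and> b \<in> V y} \<le> dim E"
      using sE by (intro dim_subset) (auto simp: V_def subspace_add)
    ultimately show False using dV[OF x] dV[OF y] dE l_gt by linarith
  qed
  obtain x0 where x0: "x0 \<in> E" "x0 \<bullet> x0 = 1"
    using exists_unit_orthogonal[OF sE, of "{}"] dE l_pos by (auto simp: norm_eq_1)
  define S where "S = H x0"
  have SW: "S \<in> W" "trace_inner S S = 1" using u[OF x0] by (auto simp: S_def)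
  have SE: "S *v x = x" if x: "x \<in> E" for x
  proof (cases "x = 0")
    case False
    let ?y = "x /\<^sub>R norm x"
    have y: "?y \<in> E" "?y \<bullet> ?y = 1" using x sE False by (auto simp: subspace_scale dot_square_norm power2_eq_square)
    have "S *v ?y = ?y" using u[OF y] const[OF x0 y] by (simp add: S_def)
    then have "norm x *\<^sub>R (S *v ?y) = norm x *\<^sub>R ?y" by simp
    then show ?thesis using False by (simp add: mv_simps)
  qed simp
  have E: "E = {x. S *v x = x}"
    using SE sE dE dim_eigenspace(1)[OF SW]
    by (intro subspace_dim_equal) (auto simp: subspace_def mv_simps)
  have "S *v y = R *v y" for y
  proof -
    have 1: "S *v (y + R *v y) = y + R *v y"
      by (rule SE) (simp add: E_def mv_simps RR add.commute)
    \<comment> \<open>\<open>q\<close> lies in the -1-eigenspace of \<open>R\<close>. The vector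
      \<open>q + S *v q\<close> is fixed by \<open>S\<close>, hence lies in \<open>E\<close> and is
      orthogonal to \<open>q\<close>; this makes it vanish.\<close>
    define q where "q = y - R *v y"
    have Rq: "R *v q = - q" by (simp add: q_def mv_simps RR)
    define z where "z = q + S *v q"
    have Sz: "S *v z = z" by (simp add: z_def mv_simps sq[OF SW(1)] SW(2) add.commute)
    then have Rz: "R *v z = z" using E by (auto simp: E_def)
    have "z \<bullet> q = 0" using Rsym[of z q] by (simp add: Rz Rq)
    moreover have "z \<bullet> (S *v q) = z \<bullet> q" using W_sym[OF SW(1), of z q] by (simp add: Sz)
    ultimately have "z \<bullet> z = 0" by (subst (2) z_def) (simp add: inner_add_right)
    then have 2: "S *v q = - q" by (simp add: z_def eq_neg_iff_add_eq_0 add.commute)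
    have "2 *\<^sub>R (S *v y) = S *v (y + R *v y) + S *v q" by (simp add: q_def mv_simps scaleR_2)
    also have "\<dots> = 2 *\<^sub>R (R *v y)" unfolding 1 2 by (simp add: q_def scaleR_2)
    finally show ?thesis by simp
  qed
  then have "S = R" by (simp add: matrix_eq)
  then show ?thesis using SW by (simp add: R_def)
qed

lemma conj_scaleR: "transpose A ** (c *\<^sub>R Q) ** A = c *\<^sub>R (transpose A ** Q ** (A :: real^'n^'n))"
  by (simp add: bilinear_lmul[OF bilinear_matrix_mult] bilinear_rmul[OF bilinear_matrix_mult])

lemma stable_conj:
  assumes A: "stable A" and Q: "Q \<in> W"
  shows "transpose A ** Q ** A \<in> W"
proof (cases "Q = 0")
  case True
  then show ?thesis by (simp add: bilinear_lzero[OF bilinear_matrix_mult] bilinear_rzero[OF bilinear_matrix_mult])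
next
  case False
  define c where "c = sqrt (trace_inner Q Q)"
  have c: "c > 0" "c * c = trace_inner Q Q" using inner_eq_0_W[OF Q] norm_nonneg_W[OF Q] False by (auto simp: c_def less_le)
  have "transpose A ** ((1 / c) *\<^sub>R Q) ** A \<in> W"
    using Q c by (intro stable_conj_unit[OF A]) (auto simp: ti_simps)
  then have "c *\<^sub>R (transpose A ** ((1 / c) *\<^sub>R Q) ** A) \<in> W" by simp
  then show ?thesis using c by (simp add: conj_scaleR)
qed

lemma conj_mv: "(transpose A ** Q ** A) *v x = transpose A *v (Q *v ((A :: real^'n^'n) *v x))"
  by (simp add: matrix_vector_mul_assoc matrix_mul_assoc)

lemma trace_inner_conj:
  fixes A :: "real^'n^'n"
  assumes "orthogonal_matrix A"
  shows "trace_inner (transpose A ** Q ** A) (transpose A ** R ** A) = trace_inner Q R"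
proof -
  have AA: "A ** transpose A = mat 1" using assms by (simp add: orthogonal_matrix_def)
  have "(transpose A ** Q ** A) ** (transpose A ** R ** A) = transpose A ** Q ** (A ** transpose A) ** R ** A"
    by (simp only: matrix_mul_assoc)
  also have "\<dots> = transpose A ** (Q ** R ** A)" by (simp only: AA matrix_mul_rid matrix_mul_assoc)
  finally have "trace ((transpose A ** Q ** A) ** (transpose A ** R ** A)) = trace ((Q ** R ** A) ** transpose A)"
    using trace_mul_sym[of "transpose A" "Q ** R ** A"] by simp
  also have "(Q ** R ** A) ** transpose A = Q ** R"
    by (simp only: matrix_mul_assoc[symmetric] AA matrix_mul_rid)
  finally show ?thesis by (simp add: trace_inner_def)
qed

text \<open>Conjugating \<open>H (A *v x)\<close> back by \<open>A\<close> yields an element of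
  \<open>W\<close> with the same inner products against \<open>W\<close> as \<open>H x\<close>. The
  vector \<open>H x *v x\<close> is thus carried along by stable isometries.\<close>

lemma stable_H:
  assumes A: "stable A"
  shows "H (A *v x) *v (A *v x) = A *v (H x *v x)"
proof -
  have oA: "orthogonal_matrix A" using A by (simp add: stable_def)
  note canc = orthogonal_matrix_cancel[OF oA] and inn = orthogonal_matrix_inner[OF oA]
  define C where "C = transpose A ** H (A *v x) ** A"
  have C: "C \<in> W" unfolding C_def by (rule stable_conj[OF A H2_in_W])
  have "trace_inner B C = trace_inner B (H x)" if B: "B \<in> W" for B
  proof -
    define D where "D = A ** B ** transpose A"
    have D: "D \<in> W" using stable_conj[OF stable_transpose[OF A] B] by (simp add: D_def)
    have "transpose A ** D ** A = (transpose A ** A) ** B ** (transpose A ** A)"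
      by (simp only: D_def matrix_mul_assoc)
    then have BD: "transpose A ** D ** A = B" using oA by (simp add: orthogonal_matrix_def)
    have "trace_inner B C = trace_inner D (H (A *v x))"
      using trace_inner_conj[OF oA, of D "H (A *v x)"] by (simp add: BD C_def)
    also have "\<dots> = (A *v (B *v x)) \<bullet> (A *v x)"
      using conj_mv[of "transpose A" B "A *v x"] by (simp add: inner_H2 D canc D_def[symmetric]) 
    finally show ?thesis by (simp add: inn inner_H2 B)
  qed
  from this[of "C - H x"] have "C - H x = 0" using C by (intro inner_eq_0_W) (simp_all add: ti_simps)
  then have "transpose A *v (H (A *v x) *v (A *v x)) = H x *v x"
    using conj_mv[of A "H (A *v x)" x] by (simp add: C_def)
  then show ?thesis using canc(1) by metis
qed

section \<open>Inhomogeneity from the invariance of \<open>N_plus\<close>\<close>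

lemma M_plus_iff: "x \<in> M_plus m P \<longleftrightarrow> x \<bullet> x = 1 \<and> h x = 0"
  by (auto simp: M_plus_def level_set_def isoparametric_fun_eq norm_eq_1)

lemma stable_N_plus:
  assumes A: "stable A" and "A *v y \<in> N_plus m P"
  shows "y \<in> N_plus m P"
proof -
  have oA: "orthogonal_matrix A" and hA: "\<And>x. h (A *v x) = h x" using A by (auto simp: stable_def)
  note canc = orthogonal_matrix_cancel[OF oA] and inn = orthogonal_matrix_inner[OF oA]
  obtain Q :: "nat \<Rightarrow> real^'n^'n" where Q: "\<And>i. i < 4 \<Longrightarrow> Q i \<in> clifford_sphere m P"
    "\<And>i j. i < 4 \<Longrightarrow> j < 4 \<Longrightarrow> i \<noteq> j \<Longrightarrow> trace_inner (Q i) (Q j) = 0"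
    and e: "(Q 0 ** Q 1 ** Q 2 ** Q 3) *v (A *v y) = A *v y" and M: "A *v y \<in> M_plus m P"
    using assms(2) by (auto simp: N_plus_def)
  define R where "R i = transpose A ** Q i ** A" for i
  have "R i \<in> clifford_sphere m P" if "i < 4" for i
    using Q(1)[OF that] stable_conj[OF A] by (auto simp: clifford_sphere_eq R_def trace_inner_conj[OF oA])
  moreover have "trace_inner (R i) (R j) = 0" if "i < 4" "j < 4" "i \<noteq> j" for i j
    using Q(2)[OF that] by (simp add: R_def trace_inner_conj[OF oA])
  moreover have "(R 0 ** R 1 ** R 2 ** R 3) *v y = y"
  proof -
    have e': "Q 0 *v (Q 1 *v (Q 2 *v (Q 3 *v (A *v y)))) = A *v y"
      using e by (simp only: matrix_vector_mul_assoc matrix_mul_assoc)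
    have "(R 0 ** R 1 ** R 2 ** R 3) *v y = R 0 *v (R 1 *v (R 2 *v (R 3 *v y)))"
      by (simp only: matrix_vector_mul_assoc matrix_mul_assoc)
    also have "\<dots> = transpose A *v (A *v y)"
      unfolding R_def conj_mv canc(1) e' ..
    finally show ?thesis by (simp add: canc)
  qed
  moreover have "y \<in> M_plus m P" using M by (simp add: M_plus_iff inn hA)
  ultimately show ?thesis by (auto simp: N_plus_def intro!: exI[of _ R])
qed

lemma sqrt_half_bounds:
  assumes "-1 \<le> c" "c \<le> (1 :: real)"
  shows "-1 \<le> sqrt ((1 - c) / 2) \<and> 0 \<le> sqrt ((1 - c) / 2) \<and> sqrt ((1 - c) / 2) \<le> 1"
proof -
  have "0 \<le> sqrt ((1 - c) / 2)" "sqrt ((1 - c) / 2) \<le> 1" using assms by auto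
  then show ?thesis by linarith
qed

lemma level_set_eq_tube:
  assumes "-1 \<le> c" "c \<le> 1"
  shows "level_set m P c = tube (arccos (sqrt ((1 - c) / 2)) / 2)"
proof -
  let ?s = "sqrt ((1 - c) / 2)"
  have s: "-1 \<le> ?s" "0 \<le> ?s" "?s \<le> 1" using sqrt_half_bounds[of c] assms by auto
  have "h x = (1 - c) / 2 \<longleftrightarrow> ang x = arccos ?s / 2" if x: "x \<bullet> x = 1" for x
  proof
    assume "ang x = arccos ?s / 2"
    then have "arccos (sqrt (h x)) = arccos ?s" by (simp add: ang_def)
    then have "cos (arccos (sqrt (h x))) = cos (arccos ?s)" by simp
    then have "sqrt (h x) = ?s" using sqrt_h[OF x] cos_arccos[OF s(1,3)] by (simp add: cos_arccos)
    then show "h x = (1 - c) / 2" by (simp add: real_sqrt_eq_iff)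
  next
    assume "h x = (1 - c) / 2"
    then show "ang x = arccos ?s / 2" by (simp only: ang_def)
  qed
  moreover have "x \<in> level_set m P c \<longleftrightarrow> x \<bullet> x = 1 \<and> h x = (1 - c) / 2" for x
    by (auto simp: level_set_def isoparametric_fun_eq norm_eq_1)
  ultimately show ?thesis unfolding tube_def by blast
qed

lemma stable_of_level_set:
  assumes "orthogonal_matrix A" "(*v) A ` level_set m P c = level_set m P c" "-1 \<le> c" "c \<le> 1"
  shows "stable A"
proof -
  let ?s = "sqrt ((1 - c) / 2)"
  have s: "-1 \<le> ?s" "0 \<le> ?s" "?s \<le> 1" using sqrt_half_bounds[of c] assms by auto
  show ?thesis
    unfolding stable_def
    using h_invariant_of_tube[OF assms(1), of "arccos ?s / 2"] assms level_set_eq_tube[OF assms(3,4)]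
      arccos_lbound[OF s(1,3)] arccos_le_pi2[OF s(2,3)] by auto
qed

lemma N_plus_of_homogeneous_M_plus:
  assumes "homogeneously_embedded (M_plus m P)" "y \<in> N_plus m P" "x \<in> M_plus m P"
  shows "x \<in> N_plus m P"
proof -
  have "y \<in> M_plus m P" using assms(2) by (simp add: N_plus_def)
  then obtain A where A: "orthogonal_matrix A" "(*v) A ` M_plus m P = M_plus m P" "A *v x = y"
    using assms(1,3) unfolding homogeneously_embedded_def by blast
  then have "stable A" using stable_of_level_set[of A 1] by (simp add: M_plus_def)
  then show ?thesis using stable_N_plus[of A x] A assms(2) by simp
qed

text \<open>Follow normal circles from \<open>x\<close> and \<open>y\<close> in M_+ to points
  \<open>a\<close> and \<open>b\<close> of the level set. An isometry taking \<open>a\<close> to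
  \<open>b\<close> carries one parametrised circle to the other, hence \<open>x\<close> to
  \<open>y\<close>.\<close>

lemma N_plus_of_homogeneous_level_set:
  assumes hom: "homogeneously_embedded (level_set m P c)" and c: "-1 < c" "c < 1"
    and yN: "y \<in> N_plus m P" and xM: "x \<in> M_plus m P"
  shows "x \<in> N_plus m P"
proof -
  let ?s = "sqrt ((1 - c) / 2)"
  define \<tau> where "\<tau> = arccos ?s / 2"
  have s: "0 < ?s" "?s < 1" using c by auto
  then have s1: "-1 < ?s" by linarith
  have t: "0 < \<tau>" using arccos_lt_bounded[OF s1 s(2)] by (simp add: \<tau>_def)
  have "arccos ?s < pi / 2" using arccos_less_arccos[of 0 ?s] s by simp
  then have t: "0 < \<tau>" "\<tau> < pi / 4" "cos (2 * \<tau>) = ?s"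
    using t cos_arccos[of ?s] s s1 by (simp_all add: \<tau>_def)
  have L: "level_set m P c = tube \<tau>" using level_set_eq_tube[of c] c by (simp add: \<tau>_def)
  have st: "sin \<tau> > 0" "cos \<tau> > 0" using t pi_gt_zero by (auto intro!: sin_gt_zero cos_gt_zero)
  have yM: "y \<in> M_plus m P" using yN by (simp add: N_plus_def)
  have *: "\<exists>Q u v. normal_circle Q u v \<and> x = cos (pi / 4) *\<^sub>R u + sin (pi / 4) *\<^sub>R v" if "x \<in> M_plus m P" for x
  proof -
    have x: "x \<bullet> x = 1" "ang x = pi / 4" using that by (auto simp: M_plus_iff ang_def)
    then show ?thesis using normal_circle_through[OF x(1)] by metis
  qed
  obtain Q u v where cx: "normal_circle Q u v" and x: "x = cos (pi / 4) *\<^sub>R u + sin (pi / 4) *\<^sub>R v"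
    using *[OF xM] by blast
  obtain Q' u' v' where cy: "normal_circle Q' u' v'" and y: "y = cos (pi / 4) *\<^sub>R u' + sin (pi / 4) *\<^sub>R v'"
    using *[OF yM] by blast
  define a where "a = cos \<tau> *\<^sub>R u + sin \<tau> *\<^sub>R v"
  define b where "b = cos \<tau> *\<^sub>R u' + sin \<tau> *\<^sub>R v'"
  have pt: "(cos \<tau> *\<^sub>R u + sin \<tau> *\<^sub>R v) \<in> tube \<tau>" if "normal_circle Q u v" for Q u v
    using normal_circle_point[OF that, of \<tau>] t by (auto simp: tube_def intro!: ang_eqI)
  have "a \<in> tube \<tau>" "b \<in> tube \<tau>" using pt[OF cx] pt[OF cy] by (auto simp: a_def b_def)
  then obtain A where A: "orthogonal_matrix A" "(*v) A ` level_set m P c = level_set m P c" "A *v a = b"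
    using hom unfolding L homogeneously_embedded_def by blast
  then have sA: "stable A" using stable_of_level_set[of A c] c by simp
  \<comment> \<open>The points \<open>u\<close> and \<open>v\<close> of the circle are recovered
    from \<open>a\<close> and \<open>H a *v a\<close> alone, because \<open>H a\<close> is a nonzero
    multiple of \<open>Q\<close> here.\<close>
  have uv: "(2 * ?s * cos \<tau>) *\<^sub>R u = ?s *\<^sub>R a + H a *v a" "(2 * ?s * sin \<tau>) *\<^sub>R v = ?s *\<^sub>R a - H a *v a"
    if "normal_circle Q u v" "a = cos \<tau> *\<^sub>R u + sin \<tau> *\<^sub>R v" for Q u v a
  proof -
    have "H a *v a = ?s *\<^sub>R (cos \<tau> *\<^sub>R u - sin \<tau> *\<^sub>R v)"
      using normal_circle_point(2)[OF that(1), of \<tau>] that t by (simp add: mv_simps normal_circle_def scaleR_diff_right mult.commute)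
    moreover have "r *\<^sub>R (p + w) + r *\<^sub>R (p - w) = (2 * r) *\<^sub>R p" "r *\<^sub>R (p + w) - r *\<^sub>R (p - w) = (2 * r) *\<^sub>R w"
      for r and p w :: "real^'n"
      unfolding mult_2 scaleR_add_left by (simp_all add: scaleR_add_right scaleR_diff_right)
    ultimately show "(2 * ?s * cos \<tau>) *\<^sub>R u = ?s *\<^sub>R a + H a *v a" "(2 * ?s * sin \<tau>) *\<^sub>R v = ?s *\<^sub>R a - H a *v a"
      by (simp_all only: that(2) scaleR_scaleR[symmetric])
  qed
  have "(2 * ?s * cos \<tau>) *\<^sub>R (A *v u) = (2 * ?s * cos \<tau>) *\<^sub>R u'"
    unfolding uv(1)[OF cy b_def] mv_simps(8)[symmetric] uv(1)[OF cx a_def] 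
    using stable_H[OF sA, of a] A(3) by (simp add: mv_simps)
  then have 1: "A *v u = u'" using s st by simp
  have "(2 * ?s * sin \<tau>) *\<^sub>R (A *v v) = (2 * ?s * sin \<tau>) *\<^sub>R v'"
    unfolding uv(2)[OF cy b_def] mv_simps(8)[symmetric] uv(2)[OF cx a_def] 
    using stable_H[OF sA, of a] A(3) by (simp add: mv_simps)
  then have 2: "A *v v = v'" using s st by simp
  have "A *v x = y" by (simp add: x y mv_simps 1 2)
  then show ?thesis using stable_N_plus[OF sA, of x] yN by simp
qed

end

subsection \<open>Points fixed by a product of four generators\<close>

context clifford_sys
begin

definition P0123 where "P0123 x = P 0 *v (P 1 *v (P 2 *v (P 3 *v x)))"

lemma linear_P0123: "linear P0123"
  by (rule linearI) (simp_all add: P0123_def mv_simps)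

lemma anticomm0123:
  "P 1 *v (P 0 *v x) = - (P 0 *v (P 1 *v x))" "P 2 *v (P 0 *v x) = - (P 0 *v (P 2 *v x))"
  "P 3 *v (P 0 *v x) = - (P 0 *v (P 3 *v x))" "P 2 *v (P 1 *v x) = - (P 1 *v (P 2 *v x))"
  "P 3 *v (P 1 *v x) = - (P 1 *v (P 3 *v x))" "P 3 *v (P 2 *v x) = - (P 2 *v (P 3 *v x))"
  using m3 by (auto intro!: P_rules)

lemma sq0123:
  "P 0 *v (P 0 *v x) = x" "P 1 *v (P 1 *v x) = x" "P 2 *v (P 2 *v x) = x" "P 3 *v (P 3 *v x) = x"
  using m3 by auto

lemma P0123_involution: "P0123 (P0123 x) = x"
  by (simp add: P0123_def anticomm0123 sq0123 mv_simps del: One_nat_def)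

lemma P0123_sym: "P0123 x \<bullet> y = x \<bullet> P0123 y"
proof -
  have "P0123 x \<bullet> y = x \<bullet> (P 3 *v (P 2 *v (P 1 *v (P 0 *v y))))"
    using m3 by (simp add: P0123_def W_sym del: One_nat_def)
  then show ?thesis by (simp add: P0123_def anticomm0123 mv_simps del: One_nat_def)
qed

lemma P0123_anticomm: "i \<le> 3 \<Longrightarrow> P0123 (P i *v x) = - (P i *v P0123 x)"
proof -
  assume "i \<le> 3"
  then have "i = 0 \<or> i = 1 \<or> i = 2 \<or> i = 3" by auto
  then show ?thesis by (auto simp: P0123_def anticomm0123 sq0123 mv_simps simp del: One_nat_def)
qed

lemma P0123_comm:
  assumes "4 \<le> i" "i \<le> m" shows "P0123 (P i *v x) = P i *v P0123 x"
proof -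
  have r: "P k *v (P i *v x) = - (P i *v (P k *v x))" if "k \<le> 3" for k x
    using assms that by (intro swap) auto
  have "P 0 *v (P i *v x) = - (P i *v (P 0 *v x))" "P 1 *v (P i *v x) = - (P i *v (P 1 *v x))"
    "P 2 *v (P i *v x) = - (P i *v (P 2 *v x))" "P 3 *v (P i *v x) = - (P i *v (P 3 *v x))" for x
    using r by auto
  then show ?thesis by (simp only: P0123_def mv_simps minus_minus)
qed

text \<open>The conditions for \<open>i \<le> 3\<close> are automatic: those \<open>P i\<close>
  anticommute with the symmetric map \<open>P0123\<close> and so send its fixed vectors to
  orthogonal ones.\<close>

lemma N_plusI:
  assumes "x \<bullet> x = 1" "P0123 x = x" "\<And>i. 4 \<le> i \<Longrightarrow> i \<le> m \<Longrightarrow> (P i *v x) \<bullet> x = 0"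
  shows "x \<in> N_plus m P"
proof -
  have "(P i *v x) \<bullet> x = 0" if "i \<le> 3" for i
    using P0123_sym[of "P i *v x" x] P0123_anticomm[OF that, of x] assms(2) by simp
  then have "(P i *v x) \<bullet> x = 0" if "i \<le> m" for i
    using assms(3) that by (cases "i \<le> 3") auto
  then have "x \<in> M_plus m P" using assms(1) by (simp add: M_plus_iff h_def)
  moreover have "(P 0 ** P 1 ** P 2 ** P 3) *v x = x"
    using assms(2) by (simp only: P0123_def matrix_vector_mul_assoc matrix_mul_assoc)
  ultimately show ?thesis
    using m3 by (auto simp: N_plus_def clifford_sphere_eq intro!: exI[of _ P])
qed

text \<open>For \<open>m = 3\<close> any unit vector of \<open>E\<close> works. Otherwise take (u +
  v) / sqrt 2 with \<open>u\<close> and \<open>v\<close> unit vectors in the two eigenspaces of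
  \<open>P 4\<close> on \<open>E\<close>, and \<open>v\<close> orthogonal to \<open>P i *v u\<close>
  for all \<open>i \<ge> 5\<close>.\<close>

lemma N_plus_nonempty:
  assumes m4: "m = 4 \<Longrightarrow>
      P 0 ** P 1 ** P 2 ** P 3 ** P 4 \<noteq> mat 1 \<and> P 0 ** P 1 ** P 2 ** P 3 ** P 4 \<noteq> - mat 1"
  shows "N_plus m P \<noteq> {}"
proof -
  define E where "E = {x. P0123 x = x}"
  have sE: "subspace E"
    by (auto simp: E_def subspace_def linear_add[OF linear_P0123] linear_cmul[OF linear_P0123] linear_0[OF linear_P0123])
  have "2 * dim {x \<in> UNIV. P0123 x = x} = dim (UNIV :: (real^'n) set)"
    by (rule involution_eigenspace_dim(1)[where k = "(*v) (P 0)"])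
       (simp_all add: linear_P0123 P0123_involution P0123_sym P0123_anticomm inj_unit)
  then have dE: "dim E = l" using card_n by (simp add: E_def)
  show ?thesis
  proof (cases "m = 3")
    case True
    obtain x where "x \<in> E" "norm x = 1"
      using exists_unit_orthogonal[OF sE, of "{}"] dE l_pos by auto
    then have "x \<in> N_plus m P" using True by (intro N_plusI) (auto simp: E_def norm_eq_1)
    then show ?thesis by blast
  next
    case False
    then have m4': "4 \<le> m" using m3 by simp
    have P4: "P 4 *v x \<in> E" if "x \<in> E" for x using that P0123_comm[of 4 x] m4' by (simp add: E_def)
    define Ep where "Ep = {x \<in> E. P 4 *v x = x}"
    define En where "En = {x \<in> E. P 4 *v x = - x}"
    have sEp: "subspace Ep" and sEn: "subspace En"
      using sE by (auto simp: Ep_def En_def subspace_def mv_simps)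
    have dims: "0 < dim Ep \<and> card ((\<lambda>i. P i *v u) ` {5..m}) < dim En" for u
    proof (cases "m = 4")
      case True
      \<comment> \<open>If \<open>P 4\<close> were the scalar \<open>c\<close> on \<open>E\<close>,
        then \<open>P0123\<close> after \<open>P 4\<close> would be \<open>c\<close> there, and
        \<open>P 0\<close> transports this to the other eigenspace of \<open>P0123\<close>. The
        product of the five generators would be plus or minus the identity.\<close>
      have no_eig: "\<exists>x\<in>E. P 4 *v x \<noteq> c *\<^sub>R x" if c: "c = 1 \<or> c = -1" for c
      proof (rule ccontr)
        assume "\<not> ?thesis"
        then have e: "P 4 *v x = c *\<^sub>R x" if "x \<in> E" for x using that by blast
        have 1: "P0123 (P 4 *v x) = c *\<^sub>R x" if "x \<in> E" for x
          using e[OF that] that by (simp add: E_def linear_cmul[OF linear_P0123])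
        have 2: "P0123 (P 4 *v x) = c *\<^sub>R x" if "P0123 x = - x" for x
        proof -
          have "P 0 *v x \<in> E" using that by (simp add: E_def P0123_anticomm mv_simps)
          then have "P0123 (P 4 *v (P 0 *v x)) = P 0 *v (c *\<^sub>R x)" using 1 by (simp add: mv_simps)
          also have "P 4 *v (P 0 *v x) = - (P 0 *v (P 4 *v x))" using m4' by (intro P_rules) auto
          finally have "P 0 *v P0123 (P 4 *v x) = P 0 *v (c *\<^sub>R x)" by (simp add: P0123_anticomm linear_neg[OF linear_P0123])
          then have "P 0 *v (P 0 *v P0123 (P 4 *v x)) = P 0 *v (P 0 *v (c *\<^sub>R x))" by simp
          then show ?thesis by (simp add: sq0123)
        qed
        have "P0123 (P 4 *v x) = c *\<^sub>R x" for x
        proof -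
          have "x + P0123 x \<in> E" by (simp add: E_def linear_add[OF linear_P0123] P0123_involution add.commute)
          moreover have "P0123 (x - P0123 x) = - (x - P0123 x)" by (simp add: linear_diff[OF linear_P0123] P0123_involution)
          ultimately have "P0123 (P 4 *v (x + P0123 x)) + P0123 (P 4 *v (x - P0123 x)) = c *\<^sub>R (x + P0123 x) + c *\<^sub>R (x - P0123 x)"
            using 1 2 by simp
          moreover have "P0123 (P 4 *v (x + P0123 x)) + P0123 (P 4 *v (x - P0123 x)) = 2 *\<^sub>R P0123 (P 4 *v x)"
            by (simp add: mv_simps linear_add[OF linear_P0123] linear_diff[OF linear_P0123] scaleR_2)
          moreover have "c *\<^sub>R (x + P0123 x) + c *\<^sub>R (x - P0123 x) = 2 *\<^sub>R (c *\<^sub>R x)"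
            by (simp add: scaleR_add_right scaleR_diff_right scaleR_2 del: scaleR_scaleR)
          ultimately have "2 *\<^sub>R P0123 (P 4 *v x) = 2 *\<^sub>R (c *\<^sub>R x)" by simp
          then show ?thesis by (simp only: scaleR_cancel_left) simp
        qed
        then have "P 0 ** P 1 ** P 2 ** P 3 ** P 4 = c *\<^sub>R mat 1"
          by (simp add: matrix_eq P0123_def mv_simps matrix_vector_mul_assoc[symmetric] del: One_nat_def)
        then show False using m4[OF True] c by auto
      qed
      obtain x where x: "x \<in> E" "P 4 *v x \<noteq> - x" using no_eig[of "-1"] by auto
      obtain y where y: "y \<in> E" "P 4 *v y \<noteq> y" using no_eig[of 1] by auto
      have "x + P 4 *v x \<in> Ep" "x + P 4 *v x \<noteq> 0" "y - P 4 *v y \<in> En" "y - P 4 *v y \<noteq> 0"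
        using x y P4 sE m4' by (auto simp: Ep_def En_def subspace_add subspace_diff mv_simps add_eq_0_iff add.commute)
      then have "dim Ep \<noteq> 0" "dim En \<noteq> 0" unfolding dim_eq_0 by blast+
      then have "0 < dim Ep" "0 < dim En" by linarith+
      then show ?thesis using True by simp
    next
      case False
      \<comment> \<open>Now \<open>P 5\<close> exchanges the eigenspaces of \<open>P 4\<close> on
        \<open>E\<close>, so each has dimension l / 2. This exceeds \<open>m\<close>, while only m -
        4 conditions are imposed.\<close>
      then have m5: "5 \<le> m" using m4' by simp
      have d: "2 * dim Ep = dim E" "2 * dim En = dim E"
        unfolding Ep_def En_def
        by (rule involution_eigenspace_dim[where k = "(*v) (P 5)"];
            use sE P4 P0123_comm[of 5] m5 in \<open>auto simp: E_def W_sym inj_unit intro!: swap\<close>)+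
      have "card ((\<lambda>i. P i *v u) ` {5..m}) \<le> m - 4"
        using card_image_le[of "{5..m}" "\<lambda>i. P i *v u"] by simp
      then show ?thesis using d dE l_gt m5 by linarith
    qed
    obtain u where u: "u \<in> Ep" "norm u = 1"
      using exists_unit_orthogonal[OF sEp, of "{}"] dims by auto
    obtain v where v: "v \<in> En" "norm v = 1" and uv: "\<And>y. y \<in> (\<lambda>i. P i *v u) ` {5..m} \<Longrightarrow> y \<bullet> v = 0"
      using exists_unit_orthogonal[OF sEn, of "(\<lambda>i. P i *v u) ` {5..m}"] dims by auto
    have P4: "P 4 *v u = u" "P 4 *v v = - v" using u v by (auto simp: Ep_def En_def)
    have uv0: "u \<bullet> v = 0" using W_sym[of "P 4" u v] P4 m4' by simp
    define x where "x = (1 / sqrt 2) *\<^sub>R (u + v)"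
    have "x \<in> N_plus m P"
    proof (rule N_plusI)
      show "x \<bullet> x = 1"
        using u v uv0 by (simp add: x_def inner_add_left inner_add_right inner_commute[of v u] norm_eq_1)
      show "P0123 x = x"
        using u v by (simp add: x_def Ep_def En_def E_def linear_add[OF linear_P0123] linear_cmul[OF linear_P0123])
      fix i assume i: "4 \<le> i" "i \<le> m"
      have "(P i *v (u + v)) \<bullet> (u + v) = 0"
      proof (cases "i = 4")
        case True
        then show ?thesis
          using u v uv0 by (simp add: mv_simps P4 inner_add_left inner_add_right inner_diff_left inner_commute[of v u] norm_eq_1)
      next
        case False
        then have i5: "5 \<le> i" using i by simp
        \<comment> \<open>For \<open>i \<ge> 5\<close>, \<open>P i\<close> exchanges the eigenspaces
          of \<open>P 4\<close>, which kills the diagonal terms; the mixed terms vanish by the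
          choice of \<open>v\<close>.\<close>
        have a: "P i *v (P 4 *v y) = - (P 4 *v (P i *v y))" for y using i i5 by (intro swap) auto
        have s4: "(P 4 *v y) \<bullet> z = y \<bullet> (P 4 *v z)" for y z using m4' by (intro W_sym) auto
        have "(P i *v u) \<bullet> u = - ((P 4 *v (P i *v u)) \<bullet> u)" using a[of u] P4 by (metis inner_minus_left)
        then have "(P i *v u) \<bullet> u = 0" using s4[of "P i *v u" u] P4 by simp
        moreover have "P i *v v = P 4 *v (P i *v v)" using a[of v] by (simp add: P4 mv_simps)
        then have "(P i *v v) \<bullet> v = (P 4 *v (P i *v v)) \<bullet> v" by simp
        then have "(P i *v v) \<bullet> v = 0" using s4[of "P i *v v" v] P4 by simp
        moreover have "(P i *v u) \<bullet> v = 0" using uv i i5 by auto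
        moreover have "(P i *v v) \<bullet> u = 0" using calculation W_sym[of "P i" u v] i by (simp add: inner_commute)
        ultimately show ?thesis by (simp add: mv_simps inner_add_left inner_add_right)
      qed
      then show "(P i *v x) \<bullet> x = 0" by (simp add: x_def mv_simps)
    qed
    then show ?thesis by blast
  qed
qed

end

subsection \<open>Points not fixed by any product of four orthonormal elements\<close>

lemma differentiable_matrix_vector_mult:
  fixes A :: "'a::real_normed_vector \<Rightarrow> real^'n^'n"
  assumes "A differentiable (at x)" "f differentiable (at x)"
  shows "(\<lambda>y. A y *v f y) differentiable (at x)"
  using assms unfolding differentiable_def
  by (blast intro: bounded_bilinear.FDERIV[OF bounded_bilinear_matrix_vector_mult])

context clifford_sys
begin

text \<open>A rotation in the plane of \<open>A\<close> and \<open>B\<close> leaves the product of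
  an orthonormal pair unchanged; the angle is chosen so that the whole component along
  \<open>X\<close> moves into the first vector.\<close>

lemma rotate:
  assumes A: "A \<in> W" "trace_inner A A = 1" and B: "B \<in> W" "trace_inner B B = 1" and AB: "trace_inner A B = 0"
  obtains A' B' where "A' \<in> W" "trace_inner A' A' = 1" "B' \<in> W" "trace_inner B' B' = 1" "trace_inner A' B' = 0"
    "trace_inner B' X = 0" "(trace_inner A' X)\<^sup>2 = (trace_inner A X)\<^sup>2 + (trace_inner B X)\<^sup>2"
    "\<And>y. A' *v (B' *v y) = A *v (B *v y)"
    "\<And>C. trace_inner C A = 0 \<Longrightarrow> trace_inner C B = 0 \<Longrightarrow> trace_inner C A' = 0 \<and> trace_inner C B' = 0"
proof -
  define a where "a = trace_inner A X"
  define b where "b = trace_inner B X"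
  \<comment> \<open>The cosine and sine are the normalised components (a, b), or (1, 0) if both
    vanish.\<close>
  have "\<exists>c s. c * c + s * s = 1 \<and> c * b - s * a = 0 \<and> (c * a + s * b)\<^sup>2 = a\<^sup>2 + b\<^sup>2"
  proof (cases "a = 0 \<and> b = 0")
    case True
    then show ?thesis by (intro exI[of _ 1] exI[of _ 0]) auto
  next
    case False
    define \<rho> where "\<rho> = sqrt (a\<^sup>2 + b\<^sup>2)"
    have \<rho>: "\<rho> > 0" "\<rho> * \<rho> = a\<^sup>2 + b\<^sup>2" using False by (auto simp: \<rho>_def sum_power2_gt_zero_iff)
    have \<rho>2: "a * a + b * b = \<rho> * \<rho>" using \<rho>(2) by (simp add: power2_eq_square)
    have "a / \<rho> * (a / \<rho>) + b / \<rho> * (b / \<rho>) = (a * a + b * b) / (\<rho> * \<rho>)" by (simp add: add_divide_distrib)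
    then have "a / \<rho> * (a / \<rho>) + b / \<rho> * (b / \<rho>) = 1" unfolding \<rho>2 using \<rho>(1) by simp
    moreover have "a / \<rho> * a + b / \<rho> * b = (a * a + b * b) / \<rho>" by (simp add: add_divide_distrib)
    then have "a / \<rho> * a + b / \<rho> * b = \<rho>" unfolding \<rho>2 using \<rho>(1) by simp
    ultimately show ?thesis using \<rho> by (intro exI[of _ "a / \<rho>"] exI[of _ "b / \<rho>"]) (auto simp: power2_eq_square)
  qed
  then obtain c s where cs: "c * c + s * s = 1" "c * b - s * a = 0" "(c * a + s * b)\<^sup>2 = a\<^sup>2 + b\<^sup>2" by blast
  define A' where "A' = c *\<^sub>R A + s *\<^sub>R B"
  define B' where "B' = c *\<^sub>R B - s *\<^sub>R A"
  have BA: "trace_inner B A = 0" using AB by (simp add: trace_inner_commute)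
  show thesis
  proof (rule that[of A' B'])
    show "A' \<in> W" "B' \<in> W" using A B by (simp_all add: A'_def B'_def)
    show "trace_inner A' A' = 1" "trace_inner B' B' = 1" "trace_inner A' B' = 0"
      using A B AB BA cs by (simp_all add: A'_def B'_def ti_simps)
    show "trace_inner B' X = 0" "(trace_inner A' X)\<^sup>2 = (trace_inner A X)\<^sup>2 + (trace_inner B X)\<^sup>2"
      using cs by (simp_all add: A'_def B'_def ti_simps flip: a_def b_def)
    show "trace_inner C A' = 0 \<and> trace_inner C B' = 0" if "trace_inner C A = 0" "trace_inner C B = 0" for C
      using that by (simp add: A'_def B'_def ti_simps)
    fix y
    have "A' *v (B' *v y) = (c * c) *\<^sub>R (A *v (B *v y)) - (s * s) *\<^sub>R (B *v (A *v y))"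
      using A B by (simp add: A'_def B'_def mv_simps sq scaleR_add_right scaleR_diff_right)
    also have "\<dots> = (c * c + s * s) *\<^sub>R (A *v (B *v y))"
      by (simp add: swap[OF B(1) A(1) BA] scaleR_add_left)
    finally show "A' *v (B' *v y) = A *v (B *v y)" by (simp add: cs)
  qed
qed

lemma in_span_others:
  assumes "A \<in> W" "k \<le> m" "trace_inner A (P k) = 0"
  shows "A \<in> span (P ` ({0..m} - {k}))"
proof -
  have "A = (\<Sum>i\<in>{0..m}. trace_inner A (P i) *\<^sub>R P i)" by (rule expand[OF assms(1)])
  also have "\<dots> = (\<Sum>i\<in>{0..m} - {k}. trace_inner A (P i) *\<^sub>R P i)"
    using assms by (subst sum.remove[of _ k]) auto
  also have "\<dots> \<in> span (P ` ({0..m} - {k}))"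
    by (intro span_sum span_scale span_base) auto
  finally show ?thesis .
qed

lemma span_subset_W: "J \<subseteq> {0..m} \<Longrightarrow> A \<in> span (P ` J) \<Longrightarrow> A \<in> W"
  unfolding W_def using span_mono[of "P ` J" "P ` {0..m}"] by blast

text \<open>For \<open>p\<close> in the \<open>+1\<close>-eigenspace of \<open>P k\<close> with \<open>|p|\<^sup>2 = 1/2\<close>, \<open>pr k p\<close> projects the
  \<open>-1\<close>-eigenspace along the vectors \<open>P i p\<close>.\<close>
definition pr where "pr k p w = w - (\<Sum>i\<in>{0..m} - {k}. (2 * (w \<bullet> (P i *v p))) *\<^sub>R (P i *v p))"

definition tri where "tri k p A B C = pr k p (A *v (B *v (C *v p)))"

lemma linear_pr: "linear (pr k p)"
  by (rule linearI)
    (simp_all add: pr_def inner_add_left scaleR_add_left distrib_left sum.distrib scaleR_diff_right scaleR_sum_right mult.left_commute)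

lemma linear_tri:
  "linear (\<lambda>A. tri k p A B C)" "linear (\<lambda>B. tri k p A B C)" "linear (\<lambda>C. tri k p A B C)"
  by (rule linearI; simp add: tri_def mv_simps linear_add[OF linear_pr] linear_scale[OF linear_pr])+

text \<open>For \<open>p\<close> of squared length 1/2 the vectors \<open>P i *v p\<close> are
  orthogonal, also of squared length 1/2. The factor 2 in \<open>pr\<close> makes up for
  this.\<close>

lemma pr_span_0:
  assumes p: "p \<bullet> p = 1 / 2" and A: "A \<in> span (P ` ({0..m} - {k}))"
  shows "pr k p (A *v p) = 0"
proof (rule linear_eq_0_on_span[OF _ _ A])
  show "linear (\<lambda>A. pr k p (A *v p))"
    by (rule linearI; simp add: mv_simps linear_add[OF linear_pr] linear_scale[OF linear_pr])
  fix A assume "A \<in> P ` ({0..m} - {k})"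
  then obtain j where j: "A = P j" "j \<in> {0..m} - {k}" by blast
  have ij: "(P j *v p) \<bullet> (P i *v p) = (if i = j then 1 / 2 else 0)" if "i \<le> m" for i
  proof (cases "i = j")
    case True
    then show ?thesis using that p norm_mv[of "P i" p p] by simp
  next
    case False
    have "(P j *v p) \<bullet> (P i *v p) = p \<bullet> (P j *v (P i *v p))" using j by (simp add: W_sym)
    also have "\<dots> = - (p \<bullet> (P i *v (P j *v p)))" using swap[of "P j" "P i" p] j that False by simp
    also have "\<dots> = - ((P j *v p) \<bullet> (P i *v p))" using that j W_sym[of "P i" p "P j *v p"] by (simp add: inner_commute)
    finally show ?thesis using False by simp
  qed
  have "(\<Sum>i\<in>{0..m} - {k}. (2 * ((P j *v p) \<bullet> (P i *v p))) *\<^sub>R (P i *v p)) = (\<Sum>i\<in>{0..m} - {k}. if i = j then P j *v p else 0)"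
    by (intro sum.cong) (auto simp: ij)
  also have "\<dots> = P j *v p" using j by simp
  finally show "pr k p (A *v p) = 0" using j by (simp add: pr_def)
qed

text \<open>By the Clifford relations, a repeated argument collapses the triple product applied to
  \<open>p\<close> to a combination of \<open>A *v p\<close> and \<open>B *v p\<close>, which
  \<open>pr\<close> kills. Thus \<open>tri\<close> depends only on the 3-vector of its
  arguments.\<close>

lemma tri_alternating:
  assumes p: "p \<bullet> p = 1 / 2" and A: "A \<in> span (P ` ({0..m} - {k}))" and B: "B \<in> span (P ` ({0..m} - {k}))"
  shows "tri k p A A B = 0" "tri k p A B A = 0" "tri k p B A A = 0"
proof -
  have W: "A \<in> W" "B \<in> W" using span_subset_W A B by blast+
  note z = pr_span_0[OF p A] pr_span_0[OF p B]
  show "tri k p A A B = 0" "tri k p B A A = 0"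
    using W z by (simp_all add: tri_def sq mv_simps linear_scale[OF linear_pr])
  have "A *v (B *v (A *v p)) = (2 * trace_inner A B) *\<^sub>R (A *v p) - trace_inner A A *\<^sub>R (B *v p)"
    by (subst anticomm[OF W]) (simp add: sq W mv_simps)
  then show "tri k p A B A = 0"
    using z by (simp add: tri_def linear_diff[OF linear_pr] linear_scale[OF linear_pr])
qed

text \<open>In the rotated frame the fixed point equation reads \<open>A *v x = F x\<close>, where
  \<open>A = \<alpha> *\<^sub>R P k + R\<close> with \<alpha> nonzero and \<open>F\<close> is the
  product of the other three elements. Both \<open>R\<close> and \<open>F\<close> anticommute with
  \<open>P k\<close>, so the -1-part of the equation expresses \<alpha> q by \<open>R *v p\<close>
  and \<open>F p\<close>. Applying \<open>pr\<close> fixes \<open>q\<close> and removes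
  \<open>R *v p\<close>.\<close>

lemma fixed_point_tri:
  fixes Q :: "nat \<Rightarrow> real^'n^'n"
  assumes k: "k \<le> m" and Q: "\<And>j. j < 4 \<Longrightarrow> Q j \<in> W" "\<And>i j. i < 4 \<Longrightarrow> j < 4 \<Longrightarrow> trace_inner (Q i) (Q j) = (if i = j then 1 else 0)"
    and x: "Q 0 *v (Q 1 *v (Q 2 *v (Q 3 *v x))) = x" "x \<in> M_plus m P"
    and nz: "(\<Sum>j<4. (trace_inner (Q j) (P k))\<^sup>2) > (0 :: real)"
  defines "p \<equiv> (1 / 2) *\<^sub>R (x + P k *v x)" and "q \<equiv> (1 / 2) *\<^sub>R (x - P k *v x)"
  obtains r A B C where "A \<in> span (P ` ({0..m} - {k}))" "B \<in> span (P ` ({0..m} - {k}))" "C \<in> span (P ` ({0..m} - {k}))"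
    "q = r *\<^sub>R tri k p A B C"
proof -
  have Qs: "Q 0 \<in> W" "Q 1 \<in> W" "Q 2 \<in> W" "Q 3 \<in> W" using Q by auto
  have Qn: "trace_inner (Q 0) (Q 0) = 1" "trace_inner (Q 1) (Q 1) = 1" "trace_inner (Q 2) (Q 2) = 1" "trace_inner (Q 3) (Q 3) = 1"
    using Q by auto
  have Qo: "trace_inner (Q 0) (Q 1) = 0" "trace_inner (Q 0) (Q 2) = 0" "trace_inner (Q 0) (Q 3) = 0"
    "trace_inner (Q 1) (Q 2) = 0" "trace_inner (Q 1) (Q 3) = 0" "trace_inner (Q 2) (Q 3) = 0"
    using Q by auto
  have sum4: "(\<Sum>j<4. f j) = f 0 + f 1 + f 2 + f 3" for f :: "nat \<Rightarrow> real"
    by (simp add: eval_nat_numeral)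
  text \<open>Rotate the frame until only its first vector has a \<open>P k\<close>-component.\<close>
  obtain A2 D where r1: "A2 \<in> W" "trace_inner A2 A2 = 1" "D \<in> W" "trace_inner D D = 1" "trace_inner A2 D = 0"
    "trace_inner D (P k) = 0" "(trace_inner A2 (P k))\<^sup>2 = (trace_inner (Q 2) (P k))\<^sup>2 + (trace_inner (Q 3) (P k))\<^sup>2"
    "\<And>y. A2 *v (D *v y) = Q 2 *v (Q 3 *v y)"
    "\<And>C. trace_inner C (Q 2) = 0 \<Longrightarrow> trace_inner C (Q 3) = 0 \<Longrightarrow> trace_inner C A2 = 0 \<and> trace_inner C D = 0"
    using rotate[OF Qs(3) Qn(3) Qs(4) Qn(4) Qo(6), of "P k"] by metis
  have o1: "trace_inner (Q 0) A2 = 0" "trace_inner (Q 0) D = 0" "trace_inner (Q 1) A2 = 0" "trace_inner (Q 1) D = 0"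
    using r1(9) Qo by auto
  obtain A1 C where r2: "A1 \<in> W" "trace_inner A1 A1 = 1" "C \<in> W" "trace_inner C C = 1" "trace_inner A1 C = 0"
    "trace_inner C (P k) = 0" "(trace_inner A1 (P k))\<^sup>2 = (trace_inner (Q 1) (P k))\<^sup>2 + (trace_inner A2 (P k))\<^sup>2"
    "\<And>y. A1 *v (C *v y) = Q 1 *v (A2 *v y)"
    "\<And>X. trace_inner X (Q 1) = 0 \<Longrightarrow> trace_inner X A2 = 0 \<Longrightarrow> trace_inner X A1 = 0 \<and> trace_inner X C = 0"
    using rotate[OF Qs(2) Qn(2) r1(1,2) o1(3), of "P k"] by metis
  have o2: "trace_inner (Q 0) A1 = 0" "trace_inner (Q 0) C = 0" "trace_inner D A1 = 0" "trace_inner D C = 0"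
    using r2(9)[of "Q 0"] r2(9)[of D] Qo o1 r1(5) by (auto simp: trace_inner_commute)
  obtain A B where r3: "A \<in> W" "trace_inner A A = 1" "B \<in> W" "trace_inner B B = 1" "trace_inner A B = 0"
    "trace_inner B (P k) = 0" "(trace_inner A (P k))\<^sup>2 = (trace_inner (Q 0) (P k))\<^sup>2 + (trace_inner A1 (P k))\<^sup>2"
    "\<And>y. A *v (B *v y) = Q 0 *v (A1 *v y)"
    using rotate[OF Qs(1) Qn(1) r2(1,2) o2(1), of "P k"] by metis
  have fix1: "A *v (B *v (C *v (D *v x))) = x" by (simp only: r3(8) r2(8) r1(8) x(1))
  define \<alpha> where "\<alpha> = trace_inner A (P k)"
  have "\<alpha>\<^sup>2 > 0" using nz by (simp add: sum4 \<alpha>_def r3(7) r2(7) r1(7) add.assoc)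
  then have \<alpha>: "\<alpha> \<noteq> 0" by auto
  define R where "R = A - \<alpha> *\<^sub>R P k"
  have RW: "R \<in> W" using r3(1) k by (simp add: R_def)
  have Rk: "trace_inner R (P k) = 0" using k by (simp add: R_def ti_simps \<alpha>_def)
  have I: "R \<in> span (P ` ({0..m} - {k}))" "B \<in> span (P ` ({0..m} - {k}))" "C \<in> span (P ` ({0..m} - {k}))" "D \<in> span (P ` ({0..m} - {k}))"
    using in_span_others[OF _ k] RW Rk r3 r2 r1 by auto
  define F where "F y = B *v (C *v (D *v y))" for y
  have PkW: "P k \<in> W" using k by simp
  have PF: "P k *v F y = - F (P k *v y)" for y
    using swap[OF PkW r3(3)] swap[OF PkW r2(3)] swap[OF PkW r1(3)] r3(6) r2(6) r1(6)
    by (simp add: F_def mv_simps trace_inner_commute)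
  have PR: "P k *v (R *v y) = - (R *v (P k *v y))" for y
    using swap[OF PkW RW] Rk by (simp add: trace_inner_commute)
  have PP: "P k *v (P k *v y) = y" for y using k by simp
  have pq: "P k *v p = p" "P k *v q = - q" "x = p + q"
    by (simp_all add: p_def q_def mv_simps PP add.commute scaleR_diff_right scaleR_add_right)
  have lF: "F (y + z) = F y + F z" "F (- y) = - F y" for y z by (simp_all add: F_def mv_simps)
  have "A *v x = F x" using fix1 sq[OF r3(1), of "F x"] r3(2) by (simp add: F_def)
  then have "\<alpha> *\<^sub>R (P k *v x) + R *v x = F x" by (simp add: R_def mv_simps)
  then have e1: "\<alpha> *\<^sub>R p - \<alpha> *\<^sub>R q + (R *v p + R *v q) = F p + F q"
    by (simp add: pq mv_simps lF scaleR_diff_right)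
  \<comment> \<open>Applying \<open>P k\<close> flips the sign of the -1-part, so subtracting the
    two equations isolates it.\<close>
  from arg_cong[OF this, of "\<lambda>y. P k *v y"]
  have e2: "\<alpha> *\<^sub>R p + \<alpha> *\<^sub>R q + (- (R *v p) + R *v q) = - F p + F q"
    by (simp add: mv_simps PR PF pq lF)
  have "2 *\<^sub>R (\<alpha> *\<^sub>R q) = 2 *\<^sub>R (R *v p - F p)"
  proof -
    have "a + b + (- c + d) = - e + f \<Longrightarrow> a - b + (c + d) = e + f \<Longrightarrow> b + b = (c - e) + (c - e)" for a b c d e f :: "real^'n"
      by (smt (verit) add.commute add.left_commute add_diff_cancel_left' diff_add_cancel diff_diff_eq2 uminus_add_conv_diff)
    from this[OF e2 e1] show ?thesis unfolding scaleR_2 .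
  qed
  then have e3: "\<alpha> *\<^sub>R q = R *v p - F p" by (simp only: scaleR_cancel_left) simp
  have xx: "x \<bullet> x = 1" "(P k *v x) \<bullet> x = 0" and hx: "\<And>i. i \<le> m \<Longrightarrow> (P i *v x) \<bullet> x = 0"
    using x(2) k by (auto simp: M_plus_eq norm_eq_1)
  have pp: "p \<bullet> p = 1 / 2"
    using xx norm_mv[OF PkW, of x x] k by (simp add: p_def inner_add_left inner_add_right inner_commute[of x "P k *v x"])
  \<comment> \<open>Expanded in \<open>x\<close> and \<open>P k *v x\<close>, all four terms vanish:
    the mixed ones because \<open>P i\<close> and \<open>P k\<close> anticommute, the others because
    \<open>x\<close> is in M_+.\<close>
  have qP: "q \<bullet> (P i *v p) = 0" if i: "i \<le> m" "i \<noteq> k" for i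
  proof -
    have s: "P i *v (P k *v y) = - (P k *v (P i *v y))" for y using i k by (intro swap) auto
    have "(P i *v x) \<bullet> (P k *v x) = (P k *v (P i *v x)) \<bullet> x" using W_sym[OF PkW, of "P i *v x" x] by simp
    then have "(P i *v (P k *v x)) \<bullet> x = - ((P i *v x) \<bullet> (P k *v x))" by (simp add: s)
    moreover have "(P i *v (P k *v x)) \<bullet> x = (P i *v x) \<bullet> (P k *v x)"
      using i by (simp add: W_sym inner_commute)
    ultimately have "(P i *v x) \<bullet> (P k *v x) = 0" "(P i *v (P k *v x)) \<bullet> x = 0" by auto
    moreover have "(P i *v (P k *v x)) \<bullet> (P k *v x) = 0"
    proof -
      have "(P i *v (P k *v x)) \<bullet> (P k *v x) = - ((P i *v x) \<bullet> (P k *v (P k *v x)))"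
        by (simp add: s W_sym[OF PkW])
      then show ?thesis using hx[OF i(1)] by (simp add: PP)
    qed
    ultimately show ?thesis using hx[OF i(1)]
      by (simp add: p_def q_def mv_simps inner_add_left inner_add_right inner_diff_left inner_diff_right inner_commute)
  qed
  have "pr k p q = q" using qP by (simp add: pr_def)
  then have "\<alpha> *\<^sub>R q = pr k p (R *v p - F p)" by (simp add: e3[symmetric] linear_scale[OF linear_pr])
  also have "\<dots> = - tri k p B C D"
    using pr_span_0[OF pp I(1)] by (simp add: linear_diff[OF linear_pr] tri_def F_def)
  finally have e4: "\<alpha> *\<^sub>R q = - tri k p B C D" .
  have "q = (1 / \<alpha>) *\<^sub>R (\<alpha> *\<^sub>R q)" using \<alpha> by simp
  then have "q = (- 1 / \<alpha>) *\<^sub>R tri k p B C D" unfolding e4 by simp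
  with I show thesis by (intro that)
qed

end

section \<open>Closed pieces of \<open>N_plus\<close> and their charts\<close>

lemma bounded_bilinear_trace_inner: "bounded_bilinear (trace_inner :: real^'n^'n \<Rightarrow> _)"
  using bilinear_trace_inner by (simp add: bilinear_conv_bounded_bilinear)

lemmas continuous_on_mv [continuous_intros] =
  bounded_bilinear.continuous_on[OF bounded_bilinear_matrix_vector_mult]
lemmas continuous_on_trace_inner [continuous_intros] =
  bounded_bilinear.continuous_on[OF bounded_bilinear_trace_inner]

context clifford_sys
begin

lemma compact_M_plus: "compact (M_plus m P)"
proof -
  have "closed (M_plus m P)"
    unfolding M_plus_eq Collect_conj_eq Collect_all_eq Collect_imp_eq
    by (intro closed_Int closed_INT ballI closed_Un closed_Collect_eq closed_Collect_const continuous_intros; simp)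
      (auto intro!: closed_Collect_eq continuous_intros)
  moreover have "bounded (M_plus m P)"
    by (rule bounded_subset[OF bounded_sphere[of 0 1]]) (auto simp: M_plus_eq)
  ultimately show ?thesis by (simp add: compact_eq_bounded_closed)
qed

lemma compact_clifford_sphere: "compact (clifford_sphere m P)"
proof -
  have "clifford_sphere m P = W \<inter> {Q. trace_inner Q Q = 1}" by (auto simp: clifford_sphere_eq)
  moreover have "closed (W \<inter> {Q. trace_inner Q Q = 1})"
    by (rule closed_Int[OF closed_subspace[OF subspace_W] closed_Collect_eq]; intro continuous_intros)
  ultimately have "closed (clifford_sphere m P)" by simp
  moreover have "norm Q \<le> sqrt (real CARD('n))" if "Q \<in> clifford_sphere m P" for Q
  proof -
    have "Q \<bullet> Q = real CARD('n)" using that by (auto simp: clifford_sphere_eq inner_W field_simps)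
    then show ?thesis by (simp add: norm_eq_sqrt_inner)
  qed
  then have "bounded (clifford_sphere m P)" unfolding bounded_iff by blast
  ultimately show ?thesis by (simp add: compact_eq_bounded_closed)
qed

text \<open>The \<open>m + 1\<close> coordinates of four orthonormal vectors have total square sum \<open>4\<close>, so every point of \<open>N\<^sub>+\<close> lies in
  some \<open>N_near k\<close>; the non-strict bound makes these sets closed.\<close>
definition N_near where
  "N_near k = {x \<in> M_plus m P. \<exists>a\<in>clifford_sphere m P. \<exists>b\<in>clifford_sphere m P. \<exists>c\<in>clifford_sphere m P. \<exists>d\<in>clifford_sphere m P.
     trace_inner a b = 0 \<and> trace_inner a c = 0 \<and> trace_inner a d = 0 \<and>
     trace_inner b c = 0 \<and> trace_inner b d = 0 \<and> trace_inner c d = 0 \<and>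
     a *v (b *v (c *v (d *v x))) = x \<and>
     4 / (real m + 1) \<le> (trace_inner a (P k))\<^sup>2 + (trace_inner b (P k))\<^sup>2 + (trace_inner c (P k))\<^sup>2 + (trace_inner d (P k))\<^sup>2}"

text \<open>It is the projection to the first factor of a closed subset of the compact product of
  M_+ with four Clifford spheres.\<close>

lemma closed_N_near: "closed (N_near k)"
proof -
  define \<Sigma> where "\<Sigma> = clifford_sphere m P"
  define C where "C = {z :: (real^'n) \<times> (real^'n^'n) \<times> (real^'n^'n) \<times> (real^'n^'n) \<times> (real^'n^'n).
     trace_inner (fst (snd z)) (fst (snd (snd z))) = 0 \<and> trace_inner (fst (snd z)) (fst (snd (snd (snd z)))) = 0 \<and>
     trace_inner (fst (snd z)) (snd (snd (snd (snd z)))) = 0 \<and>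
     trace_inner (fst (snd (snd z))) (fst (snd (snd (snd z)))) = 0 \<and> trace_inner (fst (snd (snd z))) (snd (snd (snd (snd z)))) = 0 \<and>
     trace_inner (fst (snd (snd (snd z)))) (snd (snd (snd (snd z)))) = 0 \<and>
     fst (snd z) *v (fst (snd (snd z)) *v (fst (snd (snd (snd z))) *v (snd (snd (snd (snd z))) *v fst z))) = fst z \<and>
     4 / (real m + 1) \<le> (trace_inner (fst (snd z)) (P k))\<^sup>2 + (trace_inner (fst (snd (snd z))) (P k))\<^sup>2 +
        (trace_inner (fst (snd (snd (snd z)))) (P k))\<^sup>2 + (trace_inner (snd (snd (snd (snd z)))) (P k))\<^sup>2}"
  have "closed C"
    unfolding C_def by (intro closed_Collect_conj closed_Collect_eq closed_Collect_le continuous_intros)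
  then have "compact ((M_plus m P \<times> \<Sigma> \<times> \<Sigma> \<times> \<Sigma> \<times> \<Sigma>) \<inter> C)"
    unfolding \<Sigma>_def by (intro compact_Int_closed compact_Times compact_M_plus compact_clifford_sphere)
  then have "compact (fst ` ((M_plus m P \<times> \<Sigma> \<times> \<Sigma> \<times> \<Sigma> \<times> \<Sigma>) \<inter> C))"
    by (intro compact_continuous_image continuous_intros)
  moreover have "N_near k = fst ` ((M_plus m P \<times> \<Sigma> \<times> \<Sigma> \<times> \<Sigma> \<times> \<Sigma>) \<inter> C)"
  proof (intro equalityI subsetI)
    fix x assume "x \<in> N_near k"
    then obtain a b c d where "(x, a, b, c, d) \<in> (M_plus m P \<times> \<Sigma> \<times> \<Sigma> \<times> \<Sigma> \<times> \<Sigma>) \<inter> C"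
      by (auto simp: N_near_def C_def \<Sigma>_def)
    then show "x \<in> fst ` ((M_plus m P \<times> \<Sigma> \<times> \<Sigma> \<times> \<Sigma> \<times> \<Sigma>) \<inter> C)" by (metis fst_conv imageI)
  next
    fix x assume "x \<in> fst ` ((M_plus m P \<times> \<Sigma> \<times> \<Sigma> \<times> \<Sigma> \<times> \<Sigma>) \<inter> C)"
    then obtain a b c d where "(x, a, b, c, d) \<in> (M_plus m P \<times> \<Sigma> \<times> \<Sigma> \<times> \<Sigma> \<times> \<Sigma>) \<inter> C"
      by force
    then show "x \<in> N_near k" unfolding N_near_def C_def \<Sigma>_def by simp blast
  qed
  ultimately show ?thesis by (simp add: compact_imp_closed)
qed

text \<open>The three arguments are the rows of a reduced echelon form with pivots \<open>i\<close>,
  \<open>j\<close>, \<open>i'\<close>. Keys with first entry 0, 1, 2 hold the remaining entries of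
  these rows; the key (3, 0) holds a common scalar factor.\<close>

definition chart :: "nat \<Rightarrow> real^'n \<Rightarrow> nat \<times> nat \<times> nat \<Rightarrow> (nat \<times> nat \<Rightarrow> real) \<Rightarrow> real^'n" where
  "chart k p = (\<lambda>(i, j, i') c. c (3, 0) *\<^sub>R
     tri k p (P i + (\<Sum>n\<in>{0..m} - {k} - {i, j, i'}. c (0, n) *\<^sub>R P n))
             (P j + (\<Sum>n\<in>{0..m} - {k} - {i, j, i'}. c (1, n) *\<^sub>R P n))
             (P i' + (\<Sum>n\<in>{0..m} - {k} - {i, j, i'}. c (2, n) *\<^sub>R P n)))"

definition chart_dom :: "nat \<Rightarrow> nat \<times> nat \<times> nat \<Rightarrow> (nat \<times> nat) set" where
  "chart_dom k = (\<lambda>(i, j, i'). insert (3, 0) ({0, 1, 2} \<times> ({0..m} - {k} - {i, j, i'})))"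

definition charts where
  "charts k = {(i, j, i'). i \<in> {0..m} - {k} \<and> j \<in> {0..m} - {k} \<and> i' \<in> {0..m} - {k} \<and> i \<noteq> j \<and> i \<noteq> i' \<and> j \<noteq> i'}"

lemma finite_charts: "finite (charts k)"
  by (rule finite_subset[of _ "{0..m} \<times> {0..m} \<times> {0..m}"]) (auto simp: charts_def)

lemma chart_dom_card:
  assumes "k \<le> m" "\<kappa> \<in> charts k"
  shows "finite (chart_dom k \<kappa>)" "card (chart_dom k \<kappa>) \<le> 3 * (m - 3) + 1"
proof -
  obtain i j i' where \<kappa>: "\<kappa> = (i, j, i')" by (cases \<kappa>) auto
  have "card ({0..m} - {k} - {i, j, i'}) = m - 3"
    using assms by (subst card_Diff_subset) (auto simp: \<kappa> charts_def)
  then show "finite (chart_dom k \<kappa>)" "card (chart_dom k \<kappa>) \<le> 3 * (m - 3) + 1"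
    unfolding \<kappa> chart_dom_def by (auto intro!: order_trans[OF card_insert_le_m1] simp: card_insert_if card_cartesian_product)
qed

lemma chart_cong:
  assumes "\<And>d. d \<in> chart_dom k \<kappa> \<Longrightarrow> c d = c' d"
  shows "chart k p \<kappa> c = chart k p \<kappa> c'"
proof -
  obtain i j i' where \<kappa>: "\<kappa> = (i, j, i')" by (cases \<kappa>) auto
  have *: "(\<Sum>n\<in>{0..m} - {k} - {i, j, i'}. c (s, n) *\<^sub>R P n) = (\<Sum>n\<in>{0..m} - {k} - {i, j, i'}. c' (s, n) *\<^sub>R P n)"
    if "s \<in> {0, 1, 2}" for s
    using assms that unfolding \<kappa> chart_dom_def by (intro sum.cong) auto
  have "c (3, 0) = c' (3, 0)" using assms by (simp add: \<kappa> chart_dom_def)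
  then show ?thesis using *[of 0] *[of 1] *[of 2] by (simp add: \<kappa> chart_def)
qed

lemma chart_differentiable: "(\<lambda>y :: real^'n. chart k p \<kappa> (\<lambda>d. y \<bullet> b d)) differentiable_on UNIV"
proof -
  obtain i j i' where \<kappa>: "\<kappa> = (i, j, i')" by (cases \<kappa>) auto
  have sc: "(\<lambda>y. f y *\<^sub>R g y) differentiable (at x)"
    if "f differentiable (at x)" "g differentiable (at x)" for f :: "real^'n \<Rightarrow> real" and g :: "real^'n \<Rightarrow> 'b::real_normed_vector" and x
    using that unfolding differentiable_def by (blast intro: bounded_bilinear.FDERIV[OF bounded_bilinear_scaleR])
  have inn: "(\<lambda>y. y \<bullet> a) differentiable (at x)" for a x :: "real^'n"
    by (intro linear_imp_differentiable bounded_linear.linear bounded_linear_inner_left)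
  have mat: "(\<lambda>y. M + (\<Sum>n\<in>J. (y \<bullet> a n) *\<^sub>R P n)) differentiable (at x)"
    if "finite J" for M J and a :: "nat \<Rightarrow> real^'n" and x
    using that by (intro differentiable_add differentiable_const differentiable_sum sc inn) auto
  have pr: "(\<lambda>y. pr k p (f y)) differentiable (at x)" if "f differentiable (at x)" for f :: "real^'n \<Rightarrow> real^'n" and x
    using differentiable_compose[of "pr k p" f x UNIV] linear_imp_differentiable[OF linear_pr] that by simp
  show ?thesis
    unfolding differentiable_on_def \<kappa> chart_def tri_def prod.case
    by (auto intro!: sc inn pr differentiable_matrix_vector_mult mat)
qed

lemma tri_in_chart:
  assumes k: "k \<le> m" and p: "p \<bullet> p = 1 / 2"
    and ABC: "A \<in> span (P ` ({0..m} - {k}))" "B \<in> span (P ` ({0..m} - {k}))" "C \<in> span (P ` ({0..m} - {k}))"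
    and nz: "tri k p A B C \<noteq> 0"
  shows "\<exists>\<kappa>\<in>charts k. \<exists>c. r *\<^sub>R tri k p A B C = chart k p \<kappa> c"
proof -
  obtain s i j i' a b c where \<kappa>: "i \<in> {0..m} - {k}" "j \<in> {0..m} - {k}" "i' \<in> {0..m} - {k}" "i \<noteq> j" "i \<noteq> i'" "j \<noteq> i'"
    and abc: "a \<in> span (P ` ({0..m} - {k} - {i, j, i'}))" "b \<in> span (P ` ({0..m} - {k} - {i, j, i'}))" "c \<in> span (P ` ({0..m} - {k} - {i, j, i'}))"
    and e: "tri k p A B C = s *\<^sub>R tri k p (P i + a) (P j + b) (P i' + c)"
    using alternating_trilinear_chart[where t = "tri k p" and e = P and I = "{0..m} - {k}", OF linear_tri tri_alternating[OF p] _ ABC nz]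
    by (metis finite_Diff finite_atLeastAtMost)
  have J: "{0..m} - {k} - {i, j, i'} \<subseteq> {0..m}" by auto
  define f where "f = (\<lambda>(q :: nat, n). if q = 0 then trace_inner a (P n) else if q = 1 then trace_inner b (P n)
     else if q = 2 then trace_inner c (P n) else r * s)"
  have "r *\<^sub>R tri k p A B C = chart k p (i, j, i') f"
    by (simp add: chart_def f_def e expand_on[OF J abc(1), symmetric] expand_on[OF J abc(2), symmetric] expand_on[OF J abc(3), symmetric])
  moreover have "(i, j, i') \<in> charts k" using \<kappa> by (simp add: charts_def)
  ultimately show ?thesis by blast
qed

lemma N_near_tri:
  assumes k: "k \<le> m" and x: "x \<in> N_near k"
  defines "p \<equiv> (1 / 2) *\<^sub>R (x + P k *v x)" and "q \<equiv> (1 / 2) *\<^sub>R (x - P k *v x)"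
  obtains r A B C where "A \<in> span (P ` ({0..m} - {k}))" "B \<in> span (P ` ({0..m} - {k}))" "C \<in> span (P ` ({0..m} - {k}))"
    "q = r *\<^sub>R tri k p A B C"
proof -
  obtain a b c d where S: "a \<in> W" "b \<in> W" "c \<in> W" "d \<in> W" "trace_inner a a = 1" "trace_inner b b = 1" "trace_inner c c = 1" "trace_inner d d = 1"
    and o: "trace_inner a b = 0" "trace_inner a c = 0" "trace_inner a d = 0" "trace_inner b c = 0" "trace_inner b d = 0" "trace_inner c d = 0"
    and fx: "a *v (b *v (c *v (d *v x))) = x"
    and ge: "4 / (real m + 1) \<le> (trace_inner a (P k))\<^sup>2 + (trace_inner b (P k))\<^sup>2 + (trace_inner c (P k))\<^sup>2 + (trace_inner d (P k))\<^sup>2"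
    and xM: "x \<in> M_plus m P"
    using x unfolding N_near_def clifford_sphere_eq by blast
  define Q where "Q = (\<lambda>j :: nat. if j = 0 then a else if j = 1 then b else if j = 2 then c else d)"
  have Q: "Q 0 = a" "Q 1 = b" "Q 2 = c" "Q 3 = d" by (simp_all add: Q_def)
  have lt4: "j < 4 \<Longrightarrow> j = 0 \<or> j = 1 \<or> j = 2 \<or> j = 3" for j :: nat by auto
  have "0 < 4 / (real m + 1)" by simp
  also note ge
  also have "(trace_inner a (P k))\<^sup>2 + (trace_inner b (P k))\<^sup>2 + (trace_inner c (P k))\<^sup>2 + (trace_inner d (P k))\<^sup>2
     = (\<Sum>j<4. (trace_inner (Q j) (P k))\<^sup>2)" by (simp add: eval_nat_numeral Q_def)
  finally have pos: "0 < (\<Sum>j<4. (trace_inner (Q j) (P k))\<^sup>2)" .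
  show thesis
  proof (rule fixed_point_tri[OF k _ _ _ xM pos])
    show "Q j \<in> W" if "j < 4" for j using S by (simp add: Q_def)
    show "trace_inner (Q i) (Q j) = (if i = j then 1 else 0)" if "i < 4" "j < 4" for i j
      using lt4[OF that(1)] lt4[OF that(2)] S o by (auto simp: Q_def trace_inner_commute)
    show "Q 0 *v (Q 1 *v (Q 2 *v (Q 3 *v x))) = x" unfolding Q by (rule fx)
  qed (use that in \<open>auto simp: p_def q_def\<close>)
qed

text \<open>Keep \<open>p\<close> and move \<open>q\<close> within \<open>T\<close>, the vectors of
  the -1-eigenspace orthogonal to the \<open>P i *v p\<close>. Any such vector of squared length 1/2
  again gives a point of M_+, whereas points of \<open>N_near k\<close> only come from the chart
  images.\<close>

lemma dense_complement_N_near: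
  assumes k: "k \<le> m" and x: "x \<in> M_plus m P" and e: "0 < e"
  obtains y where "y \<in> M_plus m P" "dist x y < e" "y \<notin> N_near k"
proof -
  define p where "p = (1 / 2) *\<^sub>R (x + P k *v x)"
  define q where "q = (1 / 2) *\<^sub>R (x - P k *v x)"
  have PkW: "P k \<in> W" using k by simp
  have PP: "P k *v (P k *v y) = y" for y using k by simp
  have xx: "x \<bullet> x = 1" and hx: "\<And>i. i \<le> m \<Longrightarrow> (P i *v x) \<bullet> x = 0"
    using x by (auto simp: M_plus_eq norm_eq_1)
  have pq: "P k *v p = p" "P k *v q = - q" "x = p + q"
    by (simp_all add: p_def q_def mv_simps PP add.commute scaleR_diff_right scaleR_add_right)
  have pp: "p \<bullet> p = 1 / 2" and qq: "q \<bullet> q = 1 / 2"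
    using xx hx[OF k] norm_mv[OF PkW, of x x] k
    by (simp_all add: p_def q_def inner_add_left inner_add_right inner_diff_left inner_diff_right inner_commute[of x "P k *v x"])
  have pm: "u \<bullet> v = 0" if "P k *v u = u" "P k *v v = - v" for u v
    using W_sym[OF PkW, of u v] that by simp
  have s: "P i *v (P k *v y) = - (P k *v (P i *v y))" if "i \<le> m" "i \<noteq> k" for i y using that k by (intro swap) auto
  have Pp: "(P i *v u) \<bullet> u = 0" if i: "i \<le> m" "i \<noteq> k" and u: "P k *v u = u \<or> P k *v u = - u" for i u
  proof -
    have "(P i *v (P k *v u)) \<bullet> u = - ((P i *v u) \<bullet> (P k *v u))" by (simp add: s[OF i] W_sym[OF PkW])
    then show ?thesis using u by (auto simp: mv_simps)
  qed
  define T0 where "T0 = {v. P k *v v = - v}"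
  define T where "T = {v \<in> T0. \<forall>w\<in>(\<lambda>i. P i *v p) ` ({0..m} - {k}). w \<bullet> v = 0}"
  have sT0: "subspace T0" by (auto simp: T0_def subspace_def mv_simps)
  have sT: "subspace T" using sT0 by (auto simp: T_def subspace_def inner_add_right)
  have qT: "q \<in> T"
  proof -
    have "(P i *v p) \<bullet> q = 0" if i: "i \<le> m" "i \<noteq> k" for i
    proof -
      have "(P i *v q) \<bullet> p = (P i *v p) \<bullet> q" using i W_sym[of "P i" q p] by (simp add: inner_commute)
      then have "(P i *v x) \<bullet> x = 2 * ((P i *v p) \<bullet> q)"
        using Pp[OF i, of p] Pp[OF i, of q] by (simp add: pq mv_simps inner_add_left inner_add_right)
      then show ?thesis using hx[OF i(1)] by simp
    qed
    then show ?thesis using pq by (auto simp: T_def T0_def)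
  qed
  \<comment> \<open>The parameter count 3 (m - 3) + 1 is below l - m exactly by
    \<open>large\<close>.\<close>
  have dT: "3 * (m - 3) + 1 < dim T"
  proof -
    have "card ((\<lambda>i. P i *v p) ` ({0..m} - {k})) \<le> m"
      using card_image_le[of "{0..m} - {k}" "\<lambda>i. P i *v p"] k by simp
    moreover have "l \<le> dim T + card ((\<lambda>i. P i *v p) ` ({0..m} - {k}))"
      using dim_orthogonal_ge[OF sT0, of "(\<lambda>i. P i *v p) ` ({0..m} - {k})"] dim_eigenspace(2)[of "P k"] k
      by (simp add: T_def T0_def)
    ultimately show ?thesis using large m3 by linarith
  qed
  \<comment> \<open>Radial rescaling to norm 1 / sqrt 2, the length required of the -1-component. It
    fixes \<open>q\<close> and is continuous there, so a small move of \<open>q\<close> stays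
    small.\<close>
  define n where "n v = (1 / (sqrt 2 * norm v)) *\<^sub>R v" for v :: "real^'n"
  have nq: "norm q = 1 / sqrt 2" by (simp only: norm_eq_sqrt_inner qq real_sqrt_divide real_sqrt_one)
  then have q0: "q \<noteq> 0" by auto
  have "n q = q" by (simp add: n_def nq)
  have "isCont n q" unfolding n_def using q0 by (intro continuous_intros) auto
  then obtain \<delta> where \<delta>: "\<delta> > 0" "\<And>v. dist v q < \<delta> \<Longrightarrow> dist (n v) q < e"
    using e \<open>n q = q\<close> unfolding continuous_at_eps_delta by metis
  obtain v where v: "v \<in> T" "dist q v < min \<delta> (norm q)" "\<And>\<kappa> c. \<kappa> \<in> charts k \<Longrightarrow> v \<noteq> chart k p \<kappa> c"
  proof (rule exists_avoiding_lowdim_images[where G = "chart k p" and D = "chart_dom k" and K = "charts k", OF sT qT])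
    show "0 < min \<delta> (norm q)" using \<delta> q0 by simp
    show "card (chart_dom k \<kappa>) < dim T" if "\<kappa> \<in> charts k" for \<kappa>
      using chart_dom_card(2)[OF k that] dT by linarith
  qed (use finite_charts chart_dom_card[OF k] chart_differentiable chart_cong in blast)+
  have v0: "v \<noteq> 0" using v(2) by (auto simp: dist_norm)
  have nv: "n v \<in> T" using v(1) sT by (simp add: n_def subspace_scale)
  have nvnv: "n v \<bullet> n v = 1 / 2" using v0 by (simp add: n_def dot_square_norm power2_eq_square)
  have nvE: "P k *v n v = - n v" using nv by (simp add: T_def T0_def)
  define y where "y = p + n v"
  show thesis
  proof (rule that[of y])
    have "dist x y = dist (n v) q" by (simp add: y_def pq(3) dist_norm norm_minus_commute)
    then show "dist x y < e" using \<delta>(2)[of v] v(2) by (simp add: dist_commute)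
    have "y \<bullet> y = 1"
      using pm[OF pq(1) nvE] pp nvnv by (simp add: y_def inner_add_left inner_add_right inner_commute[of "n v" p])
    moreover have "(P i *v y) \<bullet> y = 0" if i: "i \<le> m" for i
    proof (cases "i = k")
      case True
      then show ?thesis using pm[OF pq(1) nvE] pp nvnv
        by (simp add: y_def mv_simps pq nvE inner_add_left inner_add_right inner_diff_left inner_commute[of "n v" p])
    next
      case False
      have "(P i *v p) \<bullet> n v = 0" using nv i False by (auto simp: T_def)
      moreover have "(P i *v n v) \<bullet> p = (P i *v p) \<bullet> n v" using i W_sym[of "P i" "n v" p] by (simp add: inner_commute)
      ultimately show ?thesis using Pp[OF i False, of p] Pp[OF i False, of "n v"] pq nvE
        by (simp add: y_def mv_simps inner_add_left inner_add_right)
    qed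
    ultimately show "y \<in> M_plus m P" by (simp add: M_plus_eq norm_eq_1)
    show "y \<notin> N_near k"
    proof
      assume "y \<in> N_near k"
      moreover have "(1 / 2) *\<^sub>R (y + P k *v y) = p" "(1 / 2) *\<^sub>R (y - P k *v y) = n v"
        by (simp_all add: y_def mv_simps pq nvE scaleR_add_right scaleR_diff_right flip: scaleR_add_left)
      ultimately obtain r A B C where ABC: "A \<in> span (P ` ({0..m} - {k}))" "B \<in> span (P ` ({0..m} - {k}))" "C \<in> span (P ` ({0..m} - {k}))"
        and nt: "n v = r *\<^sub>R tri k p A B C"
        using N_near_tri[OF k, of y] by metis
      have nz: "tri k p A B C \<noteq> 0" using nt nvnv by auto
      \<comment> \<open>Passing from \<open>n v\<close> back to \<open>v\<close> is harmless, as the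
        scalar parameter of the charts absorbs the factor.\<close>
      have "v = (sqrt 2 * norm v) *\<^sub>R n v" using v0 by (simp add: n_def)
      then have "v = (sqrt 2 * norm v * r) *\<^sub>R tri k p A B C" by (simp add: nt)
      then show False using tri_in_chart[OF k pp ABC nz] v(3) by metis
    qed
  qed
qed

text \<open>The sets are avoided one at a time: since \<open>N_near\<close> is closed, a
  sufficiently small further move does not re-enter those already left.\<close>

lemma exists_avoiding_N_near:
  assumes "finite K" "K \<subseteq> {0..m}" "x \<in> M_plus m P" "0 < e"
  shows "\<exists>y\<in>M_plus m P. dist x y < e \<and> (\<forall>k\<in>K. y \<notin> N_near k)"
  using assms
proof (induction K arbitrary: x e rule: finite_induct)
  case empty
  then show ?case by (intro bexI[of _ x]) auto
next
  case (insert k K)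
  obtain y where y: "y \<in> M_plus m P" "dist x y < e / 2" "\<And>k. k \<in> K \<Longrightarrow> y \<notin> N_near k"
    using insert.IH[of x "e / 2"] insert.prems by auto
  have "open (- (\<Union>k\<in>K. N_near k))"
    using insert.hyps(1) closed_N_near by (intro open_Compl closed_UN) auto
  then obtain \<delta> where \<delta>: "\<delta> > 0" "ball y \<delta> \<subseteq> - (\<Union>k\<in>K. N_near k)"
    using y(3) by (metis (no_types, lifting) ComplI UN_E openE)
  have "k \<le> m" using insert.prems by simp
  then obtain z where z: "z \<in> M_plus m P" "dist y z < min \<delta> (e / 2)" "z \<notin> N_near k"
    using dense_complement_N_near[of k y "min \<delta> (e / 2)"] y(1) \<delta>(1) insert.prems by auto
  have "dist x z < e" using dist_triangle[of x z y] y z by simp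
  moreover have "z \<notin> N_near k'" if "k' \<in> K" for k' using \<delta>(2) z(2) that by auto
  ultimately show ?case using z by (intro bexI[of _ z]) auto
qed

lemma N_plus_subset_N_near:
  assumes "x \<in> N_plus m P"
  shows "\<exists>k\<le>m. x \<in> N_near k"
proof -
  obtain Q :: "nat \<Rightarrow> real^'n^'n" where Q: "\<And>i. i < 4 \<Longrightarrow> Q i \<in> clifford_sphere m P"
    "\<And>i j. i < 4 \<Longrightarrow> j < 4 \<Longrightarrow> i \<noteq> j \<Longrightarrow> trace_inner (Q i) (Q j) = 0"
    and fx: "(Q 0 ** Q 1 ** Q 2 ** Q 3) *v x = x" and xM: "x \<in> M_plus m P"
    using assms by (auto simp: N_plus_def)
  define f where "f k = (trace_inner (Q 0) (P k))\<^sup>2 + (trace_inner (Q 1) (P k))\<^sup>2 + (trace_inner (Q 2) (P k))\<^sup>2 + (trace_inner (Q 3) (P k))\<^sup>2" for k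
  have "(\<Sum>k=0..m. (trace_inner (Q i) (P k))\<^sup>2) = 1" if "i < 4" for i
    using Q(1)[OF that] inner_expand[of "Q i" "Q i"] by (auto simp: clifford_sphere_eq power2_eq_square)
  then have sum: "(\<Sum>k=0..m. f k) = 4" by (simp add: f_def sum.distrib)
  have "\<exists>k\<le>m. 4 / (real m + 1) \<le> f k"
  proof (rule ccontr)
    assume "\<not> ?thesis"
    then have "(\<Sum>k=0..m. f k) < (\<Sum>k=0..m. 4 / (real m + 1))" by (intro sum_strict_mono) auto
    also have "\<dots> = (real m + 1) * (4 / (real m + 1))" by (simp add: add.commute)
    also have "\<dots> = 4"
    proof -
      have "a * (4 / a) = 4" if "0 < a" for a :: real using that by simp
      from this[of "real m + 1"] show ?thesis by simp
    qed
    finally show False using sum by simp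
  qed
  then obtain k where k: "k \<le> m" "4 / (real m + 1) \<le> f k" by blast
  have "Q 0 *v (Q 1 *v (Q 2 *v (Q 3 *v x))) = x"
    using fx by (simp only: matrix_vector_mul_assoc matrix_mul_assoc)
  moreover have "Q 0 \<in> clifford_sphere m P" "Q 1 \<in> clifford_sphere m P" "Q 2 \<in> clifford_sphere m P" "Q 3 \<in> clifford_sphere m P"
    using Q(1) by auto
  moreover have "trace_inner (Q 0) (Q 1) = 0" "trace_inner (Q 0) (Q 2) = 0" "trace_inner (Q 0) (Q 3) = 0"
    "trace_inner (Q 1) (Q 2) = 0" "trace_inner (Q 1) (Q 3) = 0" "trace_inner (Q 2) (Q 3) = 0"
    using Q(2) by auto
  ultimately have "x \<in> N_near k"
    unfolding N_near_def using xM k(2)[unfolded f_def] by blast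
  then show ?thesis using k by blast
qed

lemma N_plus_ne_M_plus:
  assumes "M_plus m P \<noteq> {}"
  shows "N_plus m P \<noteq> M_plus m P"
proof -
  obtain x where "x \<in> M_plus m P" using assms by blast
  then obtain y where y: "y \<in> M_plus m P" "\<forall>k\<in>{0..m}. y \<notin> N_near k"
    using exists_avoiding_N_near[of "{0..m}" x 1] by auto
  then show ?thesis using N_plus_subset_N_near[of y] by fastforce
qed

end

theorem theorem5p2:
  fixes P :: "nat \<Rightarrow> real ^ 'n ^ 'n"
    and m l :: nat
    and m\<^sub>1 m\<^sub>2 :: int
  assumes "CARD('n) = 2 * l"
    and "clifford_system m P"
    and "m\<^sub>1 = int m"
    and "m\<^sub>2 = int l - int m - 1"
    and "9 \<le> 3 * m\<^sub>1"
    and "3 * m\<^sub>1 < m\<^sub>2 + 9"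
    and "m\<^sub>1 = 4 \<Longrightarrow>
      P 0 ** P 1 ** P 2 ** P 3 ** P 4 \<noteq> mat 1 \<and> P 0 ** P 1 ** P 2 ** P 3 ** P 4 \<noteq> - mat 1"
  shows "N_plus m P \<noteq> {} \<and> N_plus m P \<noteq> M_plus m P \<and>
    \<not> homogeneously_embedded (M_plus m P) \<and>
    (\<forall>c. -1 < c \<and> c < 1 \<longrightarrow> \<not> homogeneously_embedded (level_set m P c))"
proof -
  interpret clifford_sys P m l
    using assms by unfold_locales auto
  have ne: "N_plus m P \<noteq> {}" using assms(3,7) by (intro N_plus_nonempty) auto
  then obtain y where y: "y \<in> N_plus m P" by blast
  have sub: "N_plus m P \<subseteq> M_plus m P" by (auto simp: N_plus_def)
  then have ne': "N_plus m P \<noteq> M_plus m P" using y by (intro N_plus_ne_M_plus) auto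
  then obtain x where "x \<in> M_plus m P" "x \<notin> N_plus m P" using sub by blast
  then show ?thesis
    using ne ne' y N_plus_of_homogeneous_M_plus N_plus_of_homogeneous_level_set by blast
qed

end
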